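(* Let $\mathcal{A}$ and $\mathcal{B}$ be complex unital $C^{\star}$-algebras with nonzero identities, and let $T:\mathcal{A}\to\mathcal{B}$ be a bounded homomorphism which has the Riesz property. Then every $a\in\mathcal{A}$ such that $Ta$ is quasinilpotent in $\mathcal{B}$ has a decomposition $a=c+d$ in which $d$ is a normal element of $\mathcal{A}$ belonging to $T^{-1}(0)$ and $c$ is quasinilpotent in $\mathcal{A}$. That is, $$T^{-1}QN(\mathcal{B})=T^{-1}(0)+QN(\mathcal{A}).$$
   Context: A homomorphism $T:\mathcal{A}\to\mathcal{B}$ is a unital homomorphism of complex algebras (it maps invertible elements to invertible elements); it is not assumed to preserve the involution. $T^{-1}(0)=\{a\in\mathcal{A}: Ta=0\}$ is its null space. $\sigma_{\mathcal{A}}(a)$ denotes the spectrum of $a$ in $\mathcal{A}$. $QN(\mathcal{A})$ is the set of quasinilpotent elements of $\mathcal{A}$ (those with $\sigma_{\mathcal{A}}(a)=\{0\}$), and similarly for $QN(\mathcal{B})$. $T^{-1}QN(\mathcal{B})=\{a\in\mathcal{A}: Ta\in QN(\mathcal{B})\}$ is the set of $T$-Riesz elements. $T^{-1}(0)+QN(\mathcal{A})=\{d+c: d\in T^{-1}(0),\ c\in QN(\mathcal{A})\}$. For a compact set $K\subseteq\mathbb{C}$, $\mathrm{iso}(K)$ is the set of isolated points of $K$ and $\mathrm{acc}(K)=K\setminus\mathrm{iso}(K)$. $T$ has the Riesz property if for every $a\in T^{-1}(0)$ one has $\mathrm{acc}(\sigma_{\mathcal{A}}(a))\subseteq\{0\}$.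 An element $d$ is normal if $dd^{*}=d^{*}d$. *)

theory Defs
  imports "HOL-Analysis.Analysis"
begin

text \<open>
  Complex unital Banach algebras with nonzero identity. The parent class
  \<^class>\<open>real_normed_algebra_1\<close> provides \<open>0 \<noteq> 1\<close> and \<open>norm 1 = 1\<close>; in a unital
  C*-algebra with nonzero identity the latter is automatic, so it is no extra restriction below.
  The symbol for complex scalar multiplication is local to this development: the
  distribution only has real vector spaces as type classes.
\<close>

class complex_banach_algebra_1 = real_normed_algebra_1 + banach +
  fixes scaleC :: "complex \<Rightarrow> 'a \<Rightarrow> 'a"  (infixr \<open>*\<^sub>C\<close> 75)
  assumes scaleR_eq_scaleC: "r *\<^sub>R x = complex_of_real r *\<^sub>C x"
    and scaleC_add_right: "z *\<^sub>C (x + y) = z *\<^sub>C x + z *\<^sub>C y"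
    and scaleC_add_left: "(z + w) *\<^sub>C x = z *\<^sub>C x + w *\<^sub>C x"
    and scaleC_scaleC: "z *\<^sub>C w *\<^sub>C x = (z * w) *\<^sub>C x"
    and mult_scaleC_left: "(z *\<^sub>C x) * y = z *\<^sub>C (x * y)"
    and mult_scaleC_right: "x * (z *\<^sub>C y) = z *\<^sub>C (x * y)"
    and norm_scaleC: "norm (z *\<^sub>C x) = cmod z * norm x"

class cstar_algebra_1 = complex_banach_algebra_1 +
  fixes star :: "'a \<Rightarrow> 'a"
  assumes star_star: "star (star x) = x"
    and star_add: "star (x + y) = star x + star y"
    and star_scaleC: "star (z *\<^sub>C x) = cnj z *\<^sub>C star x"
    and star_mult: "star (x * y) = star y * star x"
    and norm_star_mult: "norm (star x * x) = (norm x)\<^sup>2"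

definition normal_element :: "'a::cstar_algebra_1 \<Rightarrow> bool" where
  "normal_element d \<longleftrightarrow> d * star d = star d * d"

definition invertible_element :: "'a::ring_1 \<Rightarrow> bool" where
  "invertible_element a \<longleftrightarrow> (\<exists>b. a * b = 1 \<and> b * a = 1)"

definition spectrum :: "'a::complex_banach_algebra_1 \<Rightarrow> complex set" where
  "spectrum a = {z. \<not> invertible_element (a - z *\<^sub>C 1)}"

definition QN :: "'a::complex_banach_algebra_1 set" where
  "QN = {a. spectrum a = {0}}"

definition iso :: "complex set \<Rightarrow> complex set" where
  "iso K = {z. z isolated_in K}"

definition acc :: "complex set \<Rightarrow> complex set" where
  "acc K = K - iso K"

text \<open>
  Homomorphisms are unital and complex linear; compatibility with the involution is not required.
\<close>

definition algebra_hom ::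
  "('a::complex_banach_algebra_1 \<Rightarrow> 'b::complex_banach_algebra_1) \<Rightarrow> bool" where
  "algebra_hom T \<longleftrightarrow>
     (\<forall>x y. T (x + y) = T x + T y) \<and>
     (\<forall>z x. T (z *\<^sub>C x) = z *\<^sub>C T x) \<and>
     (\<forall>x y. T (x * y) = T x * T y) \<and>
     T 1 = 1"

definition bounded_algebra_hom ::
  "('a::complex_banach_algebra_1 \<Rightarrow> 'b::complex_banach_algebra_1) \<Rightarrow> bool" where
  "bounded_algebra_hom T \<longleftrightarrow> algebra_hom T \<and> (\<exists>K. \<forall>x. norm (T x) \<le> K * norm x)"

definition null_space ::
  "('a::complex_banach_algebra_1 \<Rightarrow> 'b::complex_banach_algebra_1) \<Rightarrow> 'a set" where
  "null_space T = {a. T a = 0}"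

definition Riesz_property ::
  "('a::complex_banach_algebra_1 \<Rightarrow> 'b::complex_banach_algebra_1) \<Rightarrow> bool" where
  "Riesz_property T \<longleftrightarrow> (\<forall>a\<in>null_space T. acc (spectrum a) \<subseteq> {0})"

end

theory Submission
  imports Defs "HOL-Complex_Analysis.Complex_Analysis"
    "HOL-Computational_Algebra.Fundamental_Theorem_Algebra"
begin

text \<open>
  The kernel \<open>J\<close> of \<open>T\<close> is a closed ideal in which, by the Riesz property, every projection is a finite sum of
  minimal ones. If \<open>T a\<close> is quasinilpotent, suitable powers of \<open>a\<close> are close to \<open>J\<close>, hence are small
  perturbations of sums of rank-one terms, and the analytic Fredholm argument for rank-one perturbations shows
  that the spectrum of \<open>a\<close> is countable. Its nonzero points \<open>\<lambda>\<^sub>n\<close> can then be encircled, the Riesz idempotents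
  \<open>e\<^sub>n\<close> lie in \<open>J\<close>, and \<open>\<lambda>\<^sub>n \<rightarrow> 0\<close>. With \<open>p\<^sub>n\<close> the range projection of \<open>e\<^sub>0 + \<dots> + e\<^sub>n\<close> and
  \<open>q\<^sub>n = p\<^sub>n - p\<^sub>n\<^sub>-\<^sub>1\<close>, West's choice \<open>d = \<Sum> \<lambda>\<^sub>n q\<^sub>n\<close> is normal and lies in \<open>J\<close>. A nonzero \<open>z\<close> in the spectrum
  of \<open>c = a - d\<close> would have a left eigenvector \<open>g c = z g\<close>; since \<open>(a - \<lambda>\<^sub>n) e\<^sub>n\<close> is quasinilpotent, induction on
  \<open>n\<close> gives \<open>g e\<^sub>n = 0\<close>, so \<open>g d = 0\<close> and \<open>g a = z g\<close>. Then \<open>z\<close> is some \<open>\<lambda>\<^sub>n\<close>, and invertibility of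
  \<open>a - \<lambda>\<^sub>n\<close> on \<open>1 - e\<^sub>n\<close> forces \<open>g = 0\<close>.
\<close>

section \<open>Inverses and spectra in complex Banach algebras\<close>

text \<open>The Riesz property speaks only of elements of the null space, while the spectrum to be
  controlled is that of \<open>a\<close>, which merely becomes quasinilpotent under
  \<open>T\<close>. Finiteness does not transfer at once, but countability does: deleting a
  countable set from the complement of a disc leaves it connected, so a holomorphic function that is
  not identically zero has only countably many zeros there. Among uncountably many radii some circle
  then misses the spectrum, and its idempotent lies in the null space, where the Riesz property
  finally isolates the points.

  The algebras are abstract, so there are no vectors, ranges or kernels. An eigenvector becomes an
  element \<open>g\<close> with \<open>g * (c - z *\<^sub>C 1) = 0\<close>, a range becomes a
  projection \<open>p\<close> with \<open>e * p = p\<close> and \<open>p * e = e\<close>, and rank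
  one means that the corner of \<open>q\<close> is scalar. Left eigenvectors suit range projections:
  multiplying \<open>g * d\<close> by \<open>p (Suc n)\<close> on the right cuts the series off
  after its n-th term.\<close>

lemma scaleC_one [simp]: "(1::complex) *\<^sub>C x = x"
  for x :: "'a::complex_banach_algebra_1"
  using scaleR_eq_scaleC[of 1 x] by simp

lemma scaleC_zero_left [simp]: "(0::complex) *\<^sub>C x = 0"
  for x :: "'a::complex_banach_algebra_1"
  using scaleR_eq_scaleC[of 0 x] by simp

lemma scaleC_zero_right [simp]: "z *\<^sub>C (0::'a::complex_banach_algebra_1) = 0"
  using norm_scaleC[of z "0::'a"] by simp

lemma scaleC_minus_left: "(- z) *\<^sub>C x = - (z *\<^sub>C x)"
  for x :: "'a::complex_banach_algebra_1"
  using scaleC_add_left[of "-z" z x] by (simp add: eq_neg_iff_add_eq_0)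

lemma scaleC_minus_right: "z *\<^sub>C (- x) = - (z *\<^sub>C x)"
  for x :: "'a::complex_banach_algebra_1"
  using scaleC_add_right[of z "-x" x] by (simp add: eq_neg_iff_add_eq_0)

lemma scaleC_diff_left: "(z - w) *\<^sub>C x = z *\<^sub>C x - w *\<^sub>C x"
  for x :: "'a::complex_banach_algebra_1"
  using scaleC_add_left[of z "-w" x] by (simp add: scaleC_minus_left)

lemma scaleC_diff_right: "z *\<^sub>C (x - y) = z *\<^sub>C x - z *\<^sub>C y"
  for x :: "'a::complex_banach_algebra_1"
  using scaleC_add_right[of z x "-y"] by (simp add: scaleC_minus_right)

lemmas scaleC_algebra = scaleC_add_left scaleC_add_right scaleC_minus_left scaleC_minus_right
  scaleC_diff_left scaleC_diff_right

declare scaleC_scaleC [simp] mult_scaleC_left [simp] mult_scaleC_right [simp] norm_scaleC [simp]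

lemma scaleC_eq_0_iff: "z *\<^sub>C x = 0 \<longleftrightarrow> z = 0 \<or> x = 0"
  for x :: "'a::complex_banach_algebra_1"
  by (metis norm_eq_zero norm_scaleC mult_eq_0_iff)

lemma scaleC_sum_left: "(\<Sum>i\<in>I. f i) *\<^sub>C x = (\<Sum>i\<in>I. f i *\<^sub>C x)"
  for x :: "'a::complex_banach_algebra_1"
  by (induction I rule: infinite_finite_induct) (simp_all add: scaleC_add_left)

lemma power_scaleC: "(z *\<^sub>C x) ^ n = z ^ n *\<^sub>C x ^ n"
  for x :: "'a::complex_banach_algebra_1"
  by (induction n) (simp_all add: mult.commute)

lemma bounded_bilinear_scaleC:
  "bounded_bilinear (scaleC :: complex \<Rightarrow> 'a \<Rightarrow> 'a::complex_banach_algebra_1)"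
proof
  show "\<exists>K. \<forall>z (x::'a). norm (z *\<^sub>C x) \<le> cmod z * norm x * K"
    by (rule exI[of _ 1]) simp
qed (simp_all add: scaleC_add_left scaleC_add_right scaleR_eq_scaleC scaleR_conv_of_real mult.commute)

lemmas tendsto_scaleC [tendsto_intros] = bounded_bilinear.tendsto[OF bounded_bilinear_scaleC]
lemmas continuous_on_scaleC [continuous_intros] =
  bounded_bilinear.continuous_on[OF bounded_bilinear_scaleC]

definition ainv :: "'a::ring_1 \<Rightarrow> 'a" where
  "ainv x = (THE y. x * y = 1 \<and> y * x = 1)"

lemma ainv_unique:
  assumes "x * y = 1" "y * x = (1::'a::ring_1)"
  shows "ainv x = y"
  unfolding ainv_def using assms
  by (intro the_equality) (auto, metis mult.assoc mult.left_neutral mult.right_neutral)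

lemma invertible_elementI: "x * y = 1 \<Longrightarrow> y * x = 1 \<Longrightarrow> invertible_element x"
  by (auto simp: invertible_element_def)

lemma
  assumes "invertible_element x"
  shows ainv_right [simp]: "x * ainv x = 1" and ainv_left [simp]: "ainv x * x = 1"
proof -
  obtain y where "x * y = 1" "y * x = 1"
    using assms by (auto simp: invertible_element_def)
  with ainv_unique[OF this] show "x * ainv x = 1" "ainv x * x = 1" by auto
qed

lemma ainv_cancel:
  assumes "invertible_element x"
  shows "ainv x * (x * y) = y" "x * (ainv x * y) = y"
  using assms by (simp_all flip: mult.assoc)

lemma invertible_one [simp]: "invertible_element (1::'a::ring_1)"
  by (rule invertible_elementI[of _ 1]) simp_all

lemma invertible_ainv: "invertible_element x \<Longrightarrow> invertible_element (ainv x)"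
  by (rule invertible_elementI[of _ x]) simp_all

lemma invertible_mult:
  assumes "invertible_element x" "invertible_element y"
  shows "invertible_element (x * y)"
  using assms by (intro invertible_elementI[of _ "ainv y * ainv x"]) (simp_all add: mult.assoc ainv_cancel)

lemma invertible_minus_iff [simp]: "invertible_element (- x) \<longleftrightarrow> invertible_element (x::'a::ring_1)"
proof -
  have "invertible_element (- x)" if "invertible_element x" for x :: 'a
    using that by (intro invertible_elementI[of _ "- ainv x"]) simp_all
  from this[of x] this[of "-x"] show ?thesis by auto
qed

text \<open>A left and a right inverse of \<open>x\<close> can both be read off from
  \<open>ainv (x * y)\<close>, and they must coincide. The contrapositive carries spectral points of
  an element to spectral points of its polynomials and powers.\<close>

lemma invertible_commuting_factor:
  assumes "x * y = y * x" "invertible_element (x * y)"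
  shows "invertible_element (x::'a::ring_1)"
proof -
  let ?b = "ainv (x * y)"
  have r: "x * (y * ?b) = 1" using ainv_right[OF assms(2)] by (simp add: mult.assoc)
  have l: "(?b * y) * x = 1" using ainv_left[OF assms(2)] assms(1) by (simp add: mult.assoc)
  have "?b * y = y * ?b" using l r by (metis mult.assoc mult.left_neutral mult.right_neutral)
  with l r show ?thesis by (intro invertible_elementI[of _ "y * ?b"]) simp_all
qed

lemma ainv_commute:
  assumes "invertible_element x" "y * x = x * y"
  shows "y * ainv x = ainv x * (y::'a::ring_1)"
proof -
  have "ainv x * (y * x) * ainv x = ainv x * (x * y) * ainv x" using assms(2) by simp
  then show ?thesis using assms(1) by (simp add: mult.assoc ainv_cancel)
qed

lemma invertible_scaleC:
  assumes "z \<noteq> 0"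
  shows "invertible_element (z *\<^sub>C x) \<longleftrightarrow> invertible_element (x::'a::complex_banach_algebra_1)"
proof -
  have *: "invertible_element (z *\<^sub>C x)" if "invertible_element x" "z \<noteq> 0" for z and x :: 'a
    using that by (intro invertible_elementI[of _ "inverse z *\<^sub>C ainv x"]) simp_all
  from *[of x z] *[of "z *\<^sub>C x" "inverse z"] assms show ?thesis by auto
qed

lemma ainv_power:
  assumes "invertible_element x"
  shows "invertible_element (x ^ n)" "ainv (x ^ n) = ainv x ^ n"
proof -
  have *: "x ^ n * y ^ n = 1" if "x * y = 1" for x y :: 'a
  proof (induction n)
    case (Suc n)
    have "x ^ Suc n * y ^ Suc n = x ^ n * (x * y) * y ^ n"
      by (simp only: mult.assoc power_Suc2[of x] power_Suc[of y])
    with Suc that show ?case by simp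
  qed simp
  note * = *[OF ainv_right[OF assms]] *[OF ainv_left[OF assms]]
  show "invertible_element (x ^ n)" by (rule invertible_elementI[OF *])
  show "ainv (x ^ n) = ainv x ^ n" by (rule ainv_unique[OF *])
qed

lemma neumann:
  fixes x :: "'a::{real_normed_algebra_1,banach}"
  assumes "norm x < 1"
  shows "invertible_element (1 - x)" "norm (ainv (1 - x)) \<le> 1 / (1 - norm x)"
proof -
  have sm: "summable (\<lambda>n. x ^ n)"
  proof (rule summable_comparison_test')
    show "summable (\<lambda>n. norm x ^ n)" using assms by (simp add: summable_geometric)
  qed (rule norm_power_ineq)
  let ?s = "\<Sum>n. x ^ n"
  have "x * ?s = (\<Sum>n. x ^ Suc n)" "?s * x = (\<Sum>n. x ^ Suc n)"
    using suminf_mult[OF sm, of x] suminf_mult2[OF sm, of x] by (simp_all add: power_commutes)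
  moreover have "(\<Sum>n. x ^ Suc n) = ?s - 1" using suminf_split_head[OF sm] by simp
  ultimately have x: "x * ?s = ?s - 1" "?s * x = ?s - 1" by auto
  then have *: "(1 - x) * ?s = 1" "?s * (1 - x) = 1" by (simp_all add: algebra_simps)
  show "invertible_element (1 - x)" by (rule invertible_elementI[OF *])
  have "norm ?s = norm (1 + x * ?s)" using x by simp
  also have "\<dots> \<le> 1 + norm x * norm ?s"
    by (rule norm_triangle_le) (use norm_mult_ineq[of x ?s] in simp)
  finally show "norm (ainv (1 - x)) \<le> 1 / (1 - norm x)"
    using assms unfolding ainv_unique[OF *] by (simp add: field_simps)
qed

text \<open>Write \<open>y = x * (1 - u)\<close> with \<open>norm u \<le> 1/2\<close>; a Neumann
  series inverts the second factor with norm at most 2. The explicit bound is what makes inversion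
  continuous.\<close>

lemma invertible_perturb:
  fixes x :: "'a::{real_normed_algebra_1,banach}"
  assumes "invertible_element x" "norm (y - x) * norm (ainv x) \<le> 1/2"
  shows "invertible_element y" "norm (ainv y) \<le> 2 * norm (ainv x)"
proof -
  let ?u = "ainv x * (x - y)"
  have "norm ?u \<le> norm (ainv x) * norm (x - y)" by (rule norm_mult_ineq)
  then have u: "norm ?u \<le> 1/2" using assms(2) by (simp add: mult.commute norm_minus_commute)
  have y: "y = x * (1 - ?u)" using assms(1) by (simp add: right_diff_distrib ainv_cancel)
  have i: "invertible_element (1 - ?u)" using neumann[of ?u] u by auto
  have "invertible_element (x * (1 - ?u))" by (rule invertible_mult[OF assms(1) i])
  then show "invertible_element y" by (simp only: flip: y)
  have "ainv (x * (1 - ?u)) = ainv (1 - ?u) * ainv x"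
    using assms(1) i by (intro ainv_unique) (simp_all only: mult.assoc ainv_cancel ainv_left ainv_right)
  then have e: "ainv y = ainv (1 - ?u) * ainv x" by (simp only: flip: y)
  have "norm (ainv (1 - ?u)) \<le> 1 / (1 - norm ?u)" using neumann[of ?u] u by auto
  also have "\<dots> \<le> 1 / (1/2)" using u by (intro divide_left_mono) auto
  finally have "norm (ainv (1 - ?u)) \<le> 2" by simp
  then show "norm (ainv y) \<le> 2 * norm (ainv x)"
    unfolding e by (rule order_trans[OF norm_mult_ineq mult_right_mono[OF _ norm_ge_zero]])
qed

lemma norm_ainv_pos:
  fixes x :: "'a::real_normed_algebra_1"
  assumes "invertible_element x"
  shows "norm (ainv x) > 0"
  using ainv_right[OF assms] by fastforce

lemma open_invertible: "open {x::'a::{real_normed_algebra_1,banach}. invertible_element x}"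
proof (rule openI)
  fix x :: 'a assume "x \<in> {x. invertible_element x}"
  then have x: "invertible_element x" by simp
  show "\<exists>e>0. ball x e \<subseteq> {x. invertible_element x}"
  proof (intro exI conjI)
    show "1 / (2 * norm (ainv x)) > 0" using norm_ainv_pos[OF x] by simp
    show "ball x (1 / (2 * norm (ainv x))) \<subseteq> {x. invertible_element x}"
      using norm_ainv_pos[OF x]
      by (auto intro!: invertible_perturb(1)[OF x] simp: dist_norm norm_minus_commute field_simps)
  qed
qed

lemma ainv_diff:
  assumes "invertible_element x" "invertible_element y"
  shows "ainv y - ainv x = ainv y * (x - y) * ainv x"
  using assms by (simp add: algebra_simps ainv_cancel)

lemma isCont_ainv:
  fixes x :: "'a::{real_normed_algebra_1,banach}"
  assumes x: "invertible_element x"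
  shows "isCont ainv x"
proof -
  let ?K = "norm (ainv x)"
  have "\<forall>\<^sub>F y in at x. norm (y - x) < 1 / (2 * ?K)"
    using norm_ainv_pos[OF x] by (auto simp: eventually_at dist_norm intro!: exI[of _ "1 / (2 * ?K)"])
  then have "\<forall>\<^sub>F y in at x. norm (ainv y - ainv x) \<le> 2 * ?K * norm (y - x) * ?K"
  proof eventually_elim
    case (elim y)
    then have "norm (y - x) * ?K \<le> 1/2" using norm_ainv_pos[OF x] by (simp add: field_simps)
    note y = invertible_perturb[OF x this]
    have "norm (ainv y - ainv x) \<le> norm (ainv y) * norm (x - y) * norm (ainv x)"
      unfolding ainv_diff[OF x y(1)]
      by (rule order_trans[OF norm_mult_ineq mult_right_mono[OF norm_mult_ineq norm_ge_zero]])
    also have "\<dots> \<le> 2 * ?K * norm (x - y) * ?K"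
      by (intro mult_right_mono y) auto
    finally show ?case by (simp add: norm_minus_commute)
  qed
  moreover have "((\<lambda>y. 2 * ?K * norm (y - x) * ?K) \<longlongrightarrow> 2 * ?K * norm (x - x) * ?K) (at x)"
    by (intro tendsto_intros)
  then have "((\<lambda>y. 2 * ?K * norm (y - x) * ?K) \<longlongrightarrow> 0) (at x)" by simp
  ultimately have "((\<lambda>y. ainv y - ainv x) \<longlongrightarrow> 0) (at x)"
    by (rule Lim_null_comparison)
  then show ?thesis unfolding isCont_def by (rule LIM_zero_cancel)
qed

lemma continuous_on_ainv [continuous_intros]:
  fixes f :: "'b::topological_space \<Rightarrow> 'a::{real_normed_algebra_1,banach}"
  assumes "continuous_on S f" "\<And>s. s \<in> S \<Longrightarrow> invertible_element (f s)"
  shows "continuous_on S (\<lambda>s. ainv (f s))"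
proof -
  have "continuous_on {x::'a. invertible_element x} ainv"
    by (auto intro: continuous_at_imp_continuous_on isCont_ainv)
  from continuous_on_compose2[OF this assms(1)] assms(2) show ?thesis by auto
qed

lemma not_spectrum_iff: "z \<notin> spectrum a \<longleftrightarrow> invertible_element (a - z *\<^sub>C 1)"
  by (simp add: spectrum_def)

lemma open_preimage_invertible:
  fixes f :: "complex \<Rightarrow> 'a::complex_banach_algebra_1"
  assumes "continuous_on UNIV f"
  shows "open {z. invertible_element (f z)}"
  using open_vimage[OF open_invertible assms] by (simp add: vimage_def)

lemma closed_spectrum: "closed (spectrum a)"
proof -
  have "open {z. invertible_element (a - z *\<^sub>C 1)}"
    by (intro open_preimage_invertible continuous_intros)
  then show ?thesis unfolding closed_def spectrum_def by (simp add: Collect_neg_eq)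
qed

lemma spectrum_norm_le:
  assumes "z \<in> spectrum a"
  shows "cmod z \<le> norm a"
proof (rule ccontr)
  assume "\<not> cmod z \<le> norm a"
  then have lt: "norm a < cmod z" and z0: "z \<noteq> 0" by auto
  have "norm (inverse z *\<^sub>C a) < 1" using lt z0 by (simp add: norm_inverse norm_divide field_simps)
  then have "invertible_element (1 - inverse z *\<^sub>C a)" by (rule neumann)
  then have "invertible_element ((- z) *\<^sub>C (1 - inverse z *\<^sub>C a))"
    by (subst invertible_scaleC) (use z0 in auto)
  then have "invertible_element (a - z *\<^sub>C 1)" using z0 by (simp add: scaleC_algebra)
  with assms show False by (simp add: spectrum_def)
qed

lemma compact_spectrum: "compact (spectrum a)"
  unfolding compact_eq_bounded_closed bounded_iff
  using closed_spectrum spectrum_norm_le by blast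

lemma one_minus_scaleC_invertible_iff:
  fixes x :: "'a::complex_banach_algebra_1"
  assumes "z \<noteq> 0"
  shows "invertible_element (1 - z *\<^sub>C x) \<longleftrightarrow> inverse z \<notin> spectrum x"
proof -
  have "1 - z *\<^sub>C x = (- z) *\<^sub>C (x - inverse z *\<^sub>C 1)" using assms by (simp add: scaleC_algebra)
  then show ?thesis
    using assms invertible_scaleC[of "-z" "x - inverse z *\<^sub>C 1"] by (simp add: not_spectrum_iff del: inverse_eq_divide)
qed

section \<open>Resolvent averages and the spectral radius\<close>

lemma sum_root_of_unity_powers:
  assumes "0 < j" "j < n"
  shows "(\<Sum>k<n. (cis (2 * pi / real n) ^ k) ^ j) = 0"
proof -
  let ?w = "cis (2 * pi * real j / real n)"
  have n: "n > 0" using assms by simp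
  have "inj_on (\<lambda>k. cis (2 * pi * real k / real n)) {..<n}"
    using Complex.bij_betw_roots_unity[OF n] by (simp add: bij_betw_def)
  from inj_onD[OF this, of j 0] assms have w1: "?w \<noteq> 1" by auto
  have "?w ^ n = cis (2 * pi * real j)" using n by (simp add: Complex.DeMoivre)
  also have "\<dots> = 1" by (simp add: cis_multiple_2pi)
  finally have wn: "?w ^ n = 1" .
  have "(\<Sum>k<n. (cis (2 * pi / real n) ^ k) ^ j) = (\<Sum>k<n. ?w ^ k)"
    by (intro sum.cong refl) (simp add: Complex.DeMoivre mult_ac)
  also have "\<dots> = 0" using geometric_sum[OF w1, of n] wn by simp
  finally show ?thesis .
qed

lemma geometric_sum_right: "(\<Sum>j<n. u ^ j) * (1 - u) = 1 - (u::'a::ring_1) ^ n"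
proof (induction n)
  case (Suc n)
  have "(\<Sum>j<Suc n. u ^ j) * (1 - u) = (\<Sum>j<n. u ^ j) * (1 - u) + u ^ n * (1 - u)"
    by (simp only: sum.lessThan_Suc distrib_right)
  also have "\<dots> = 1 - u ^ Suc n" unfolding Suc by (simp add: algebra_simps power_commutes)
  finally show ?case .
qed simp

text \<open>Partial fractions: since each rotated copy of \<open>y\<close> has the same n-th power,
  multiplying the k-th inverse by \<open>1 - y ^ n\<close> leaves a geometric sum of length
  \<open>n\<close>, and summing over \<open>k\<close> cancels every power except the zeroth.\<close>

lemma root_of_unity_average:
  fixes y :: "'a::complex_banach_algebra_1"
  assumes n: "n > 0" and inv: "\<And>k. k < n \<Longrightarrow> invertible_element (1 - cis (2 * pi / real n) ^ k *\<^sub>C y)"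
  shows "invertible_element (1 - y ^ n)"
    and "ainv (1 - y ^ n) = inverse (real n) *\<^sub>R (\<Sum>k<n. ainv (1 - cis (2 * pi / real n) ^ k *\<^sub>C y))"
proof -
  let ?w = "cis (2 * pi / real n)"
  let ?g = "\<lambda>k. ainv (1 - ?w ^ k *\<^sub>C y)"
  let ?S = "inverse (real n) *\<^sub>R (\<Sum>k<n. ?g k)"
  have wn: "?w ^ n = 1" using n by (simp add: Complex.DeMoivre)
  have g: "(1 - y ^ n) * ?g k = (\<Sum>j<n. (?w ^ k) ^ j *\<^sub>C y ^ j)" if "k < n" for k
  proof -
    have "(?w ^ k *\<^sub>C y) ^ n = y ^ n"
      using wn by (simp add: power_scaleC flip: power_mult) (simp add: mult.commute[of k] power_mult)
    with geometric_sum_right[of "?w ^ k *\<^sub>C y" n]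
    have "1 - y ^ n = (\<Sum>j<n. (?w ^ k) ^ j *\<^sub>C y ^ j) * (1 - ?w ^ k *\<^sub>C y)"
      by (simp add: power_scaleC)
    then show ?thesis using inv[OF that] by (simp add: mult.assoc)
  qed
  have "(1 - y ^ n) * (\<Sum>k<n. ?g k) = (\<Sum>k<n. \<Sum>j<n. (?w ^ k) ^ j *\<^sub>C y ^ j)"
    unfolding sum_distrib_left by (intro sum.cong refl g) simp
  also have "\<dots> = (\<Sum>j<n. (\<Sum>k<n. (?w ^ k) ^ j) *\<^sub>C y ^ j)"
    by (subst sum.swap) (simp add: scaleC_sum_left)
  also have "\<dots> = (\<Sum>j<n. if j = 0 then of_nat n *\<^sub>C 1 else 0)"
    by (intro sum.cong refl) (auto simp: sum_root_of_unity_powers)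
  also have "\<dots> = real n *\<^sub>R 1" using n by (simp add: scaleR_eq_scaleC)
  finally have r: "(1 - y ^ n) * ?S = 1" using n by simp
  have "(1 - y ^ n) * ?g k = ?g k * (1 - y ^ n)" if "k < n" for k
    by (rule ainv_commute[OF inv[OF that]]) (simp add: algebra_simps scaleC_algebra power_commutes)
  then have "(1 - y ^ n) * ?S = ?S * (1 - y ^ n)"
    by (simp add: sum_distrib_left sum_distrib_right)
  with r have l: "?S * (1 - y ^ n) = 1" by simp
  show "invertible_element (1 - y ^ n)" by (rule invertible_elementI[OF r l])
  show "ainv (1 - y ^ n) = ?S" by (rule ainv_unique[OF r l])
qed

lemma norm_average_le:
  assumes "n > 0" "\<And>k. k < n \<Longrightarrow> norm (f k) \<le> c"
  shows "norm (inverse (real n) *\<^sub>R (\<Sum>k<n. f k :: 'a::real_normed_vector)) \<le> c"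
proof -
  have "norm (\<Sum>k<n. f k) \<le> (\<Sum>k<n. c)" using assms(2) by (intro sum_norm_le) auto
  then show ?thesis using assms(1) by (simp add: field_simps)
qed

text \<open>Each inverse is an average of values of the single function
  \<open>ainv (1 - z *\<^sub>C x)\<close> over rotations of one point of \<open>K\<close>. A bound
  and a modulus of uniform continuity on the compact set \<open>K\<close> therefore serve all
  \<open>n\<close> at once; this uniformity in \<open>n\<close> takes the place of contour
  estimates.\<close>

lemma resolvent_averages:
  fixes x :: "'a::complex_banach_algebra_1"
  assumes K: "compact K" "\<And>z w. z \<in> K \<Longrightarrow> cmod w = 1 \<Longrightarrow> w * z \<in> K"
    and inv: "\<And>z. z \<in> K \<Longrightarrow> invertible_element (1 - z *\<^sub>C x)"
  obtains C where "C > 0"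
    and "\<And>n z. n > 0 \<Longrightarrow> z \<in> K \<Longrightarrow> invertible_element (1 - (z *\<^sub>C x) ^ n)"
    and "\<And>n z. n > 0 \<Longrightarrow> z \<in> K \<Longrightarrow> norm (ainv (1 - (z *\<^sub>C x) ^ n)) \<le> C"
    and "\<And>e. e > 0 \<Longrightarrow> \<exists>d>0. \<forall>n>0. \<forall>z\<in>K. \<forall>z'\<in>K. cmod (z - z') < d \<longrightarrow>
           norm (ainv (1 - (z *\<^sub>C x) ^ n) - ainv (1 - (z' *\<^sub>C x) ^ n)) \<le> e"
proof -
  let ?f = "\<lambda>z. ainv (1 - z *\<^sub>C x)"
  let ?w = "\<lambda>n k. cis (2 * pi / real n) ^ k"
  have w: "cmod (?w n k) = 1" for n k by (simp add: norm_power)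
  have cont: "continuous_on K ?f" by (intro continuous_intros inv)
  have inv': "invertible_element (1 - ?w n k *\<^sub>C (z *\<^sub>C x))" if "z \<in> K" for z n k
    using inv[OF K(2)[OF that w]] by simp
  note avg = root_of_unity_average[OF _ inv']
  have E: "ainv (1 - (z *\<^sub>C x) ^ n) = inverse (real n) *\<^sub>R (\<Sum>k<n. ?f (?w n k * z))"
    if "n > 0" "z \<in> K" for n z
    using avg(2)[OF that] by simp
  have "compact (?f ` K)" by (rule compact_continuous_image[OF cont K(1)])
  then obtain C where C: "C > 0" "\<And>z. z \<in> K \<Longrightarrow> norm (?f z) \<le> C"
    using compact_imp_bounded[of "?f ` K"] unfolding bounded_pos by auto
  have unif: "uniformly_continuous_on K ?f" by (rule compact_uniformly_continuous[OF cont K(1)])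
  show ?thesis
  proof (rule that[OF C(1)])
    fix e :: real assume "e > 0"
    with unif obtain d where d: "d > 0"
      "\<And>z z'. z \<in> K \<Longrightarrow> z' \<in> K \<Longrightarrow> dist z' z < d \<Longrightarrow> dist (?f z') (?f z) < e"
      unfolding uniformly_continuous_on_def by metis
    show "\<exists>d>0. \<forall>n>0. \<forall>z\<in>K. \<forall>z'\<in>K. cmod (z - z') < d \<longrightarrow>
           norm (ainv (1 - (z *\<^sub>C x) ^ n) - ainv (1 - (z' *\<^sub>C x) ^ n)) \<le> e"
    proof (intro exI conjI allI impI ballI)
      fix n :: nat and z z' assume n: "n > 0" and z: "z \<in> K" "z' \<in> K" "cmod (z - z') < d"
      have "ainv (1 - (z *\<^sub>C x) ^ n) - ainv (1 - (z' *\<^sub>C x) ^ n)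
        = inverse (real n) *\<^sub>R (\<Sum>k<n. ?f (?w n k * z) - ?f (?w n k * z'))"
        using n z by (simp only: E sum_subtractf scaleR_diff_right)
      also have "norm \<dots> \<le> e"
      proof (rule norm_average_le[OF n])
        fix k
        have "cmod (?w n k * z - ?w n k * z') = cmod (z - z')"
          by (simp only: w norm_mult mult_1 flip: right_diff_distrib)
        then have "dist (?f (?w n k * z)) (?f (?w n k * z')) < e"
          using z(3) by (intro d(2) K(2) z(1,2) w) (simp only: dist_norm)
        then show "norm (?f (?w n k * z) - ?f (?w n k * z')) \<le> e" by (simp add: dist_norm)
      qed
      finally show "norm (ainv (1 - (z *\<^sub>C x) ^ n) - ainv (1 - (z' *\<^sub>C x) ^ n)) \<le> e" .
    qed (rule d)
  next
    fix n :: nat and z assume n: "n > 0" and z: "z \<in> K"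
    show "invertible_element (1 - (z *\<^sub>C x) ^ n)" by (rule avg(1)[OF n z])
    show "norm (ainv (1 - (z *\<^sub>C x) ^ n)) \<le> C"
      unfolding E[OF n z] by (intro norm_average_le[OF n] C(2) K(2) z w)
  qed
qed

lemma ainv_tendsto_one:
  fixes u :: "nat \<Rightarrow> 'a::{real_normed_algebra_1,banach}"
  assumes "u \<longlonglongrightarrow> 0"
  shows "(\<lambda>n. ainv (1 - u n)) \<longlonglongrightarrow> 1"
proof -
  have "(\<lambda>n. 1 - u n) \<longlonglongrightarrow> 1 - 0" by (intro tendsto_intros assms)
  then have "(\<lambda>n. ainv (1 - u n)) \<longlonglongrightarrow> ainv 1"
    using isCont_tendsto_compose[OF isCont_ainv[OF invertible_one]] by simp
  then show ?thesis by (simp add: ainv_unique[of 1 1])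
qed

text \<open>If the powers of \<open>s x\<close> tend to 0, then \<open>ainv (1 - (s x) ^ n)\<close>
  tends to 1, and equicontinuity in the radius passes closeness to 1 on to slightly larger radii.
  From radius 0, finitely many steps of length \<open>d/2\<close> reach \<open>t\<close>. This is
  the upper half of the spectral radius formula.\<close>

lemma gelfand_disc:
  fixes x :: "'a::complex_banach_algebra_1"
  assumes inv: "\<And>z. cmod z \<le> R \<Longrightarrow> invertible_element (1 - z *\<^sub>C x)"
    and t: "0 \<le> t" "t < R"
  shows "(\<lambda>n. t ^ n * norm (x ^ n)) \<longlonglongrightarrow> 0"
proof -
  obtain C where
    i: "\<And>n z. n > 0 \<Longrightarrow> z \<in> cball 0 R \<Longrightarrow> invertible_element (1 - (z *\<^sub>C x) ^ n)" and
    eq: "\<And>e. e > 0 \<Longrightarrow> \<exists>d>0. \<forall>n>0. \<forall>z\<in>cball 0 R. \<forall>z'\<in>cball 0 R. cmod (z - z') < d \<longrightarrow>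
           norm (ainv (1 - (z *\<^sub>C x) ^ n) - ainv (1 - (z' *\<^sub>C x) ^ n)) \<le> e"
  proof (rule resolvent_averages[of "cball 0 R" x])
    fix C :: real
    assume a: "\<And>n z. n > 0 \<Longrightarrow> z \<in> cball 0 R \<Longrightarrow> invertible_element (1 - (z *\<^sub>C x) ^ n)"
    assume b: "\<And>e. e > 0 \<Longrightarrow> \<exists>d>0. \<forall>n>0. \<forall>z\<in>cball 0 R. \<forall>z'\<in>cball 0 R. cmod (z - z') < d \<longrightarrow>
           norm (ainv (1 - (z *\<^sub>C x) ^ n) - ainv (1 - (z' *\<^sub>C x) ^ n)) \<le> e"
    show thesis by (rule that[OF a b])
  qed (use inv in \<open>auto simp: norm_mult\<close>)
  obtain d where d: "d > 0" "\<And>n z z'. n > 0 \<Longrightarrow> cmod z \<le> R \<Longrightarrow> cmod z' \<le> R \<Longrightarrow> cmod (z - z') < d \<Longrightarrow>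
           norm (ainv (1 - (z *\<^sub>C x) ^ n) - ainv (1 - (z' *\<^sub>C x) ^ n)) \<le> 1/4"
    using eq[of "1/4"] by auto
  have key: "(\<lambda>n. t ^ n * norm (x ^ n)) \<longlonglongrightarrow> 0" if "0 \<le> t" "t \<le> real k * (d/2)" "t < R" for t k
    using that
  proof (induction k arbitrary: t)
    case 0
    then have "t = 0" by simp
    moreover have "(\<lambda>n. 0 ^ n * norm (x ^ n)) \<longlonglongrightarrow> 0"
      by (rule tendsto_eventually) (auto simp: eventually_sequentially intro!: exI[of _ 1])
    ultimately show ?case by simp
  next
    case (Suc k)
    \<comment> \<open>\<open>s\<close> is one step back, where the induction hypothesis applies;
      \<open>s'\<close> lies beyond \<open>t\<close>, so that mere boundedness at \<open>s'\<close>
      gives geometric decay at \<open>t\<close>. The two are less than \<open>d\<close>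
      apart.\<close>
    define s where "s = max 0 (t - d/2)"
    define s' where "s' = min R (t + d/4)"
    have s: "0 \<le> s" "s \<le> real k * (d/2)" "s < R" and s': "s' > t" "s' \<le> R" "s' - s < d" "s' \<ge> s"
      using Suc.prems d(1) by (auto simp: s_def s'_def algebra_simps max_def min_def)
    have "(\<lambda>n. (of_real s *\<^sub>C x) ^ n) \<longlonglongrightarrow> 0"
      using Suc.IH[OF s] s(1) by (subst tendsto_norm_zero_iff[symmetric]) (simp add: power_scaleC norm_power)
    from ainv_tendsto_one[OF this]
    have "\<forall>\<^sub>F n in sequentially. dist (ainv (1 - (of_real s *\<^sub>C x) ^ n)) 1 < 1/4"
      by (rule tendstoD) simp
    then have "\<forall>\<^sub>F n in sequentially. s' ^ n * norm (x ^ n) \<le> 3"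
      using eventually_gt_at_top[of 0]
    proof eventually_elim
      case (elim n)
      let ?y = "(of_real s' *\<^sub>C x) ^ n"
      let ?E = "ainv (1 - ?y)"
      \<comment> \<open>Two errors of 1/4 put \<open>?E\<close> within 1/2 of 1; its inverse
        \<open>1 - ?y\<close> then has norm at most 2, whence the bound 3.\<close>
      have "norm (?E - ainv (1 - (of_real s *\<^sub>C x) ^ n)) \<le> 1/4"
        using elim s s' by (intro d(2)) (simp_all flip: of_real_diff)
      with elim(1) have E: "norm (1 - ?E) \<le> 1/2"
        using norm_triangle_ineq[of "?E - ainv (1 - (of_real s *\<^sub>C x) ^ n)" "ainv (1 - (of_real s *\<^sub>C x) ^ n) - 1"]
        by (simp add: dist_norm norm_minus_commute)
      have iy: "invertible_element (1 - ?y)" using elim s s' by (intro i) simp_all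
      have "norm (ainv (1 - (1 - ?E))) \<le> 1 / (1 - norm (1 - ?E))" using E by (intro neumann) simp
      also have "\<dots> \<le> 1 / (1/2)" using E by (intro divide_left_mono) auto
      finally have "norm (1 - ?y) \<le> 2" using ainv_unique[of ?E "1 - ?y"] iy by simp
      then have "norm ?y \<le> 3" using norm_triangle_ineq4[of 1 "1 - ?y"] by simp
      then show ?case using s s' by (simp add: power_scaleC norm_power)
    qed
    then have "\<forall>\<^sub>F n in sequentially. norm (t ^ n * norm (x ^ n)) \<le> 3 * (t / s') ^ n"
    proof eventually_elim
      case (elim n)
      have "s' > 0" using s' Suc.prems by simp
      have "norm (t ^ n * norm (x ^ n)) = (t / s') ^ n * (s' ^ n * norm (x ^ n))"
        using \<open>s' > 0\<close> Suc.prems by (simp add: power_divide abs_mult)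
      also have "\<dots> \<le> (t / s') ^ n * 3" using elim \<open>s' > 0\<close> Suc.prems by (intro mult_left_mono) auto
      finally show ?case by simp
    qed
    moreover have "(\<lambda>n. 3 * (t / s') ^ n) \<longlonglongrightarrow> 0"
      using s' Suc.prems by (intro tendsto_mult_right_zero LIMSEQ_power_zero) simp
    ultimately show ?case by (rule Lim_null_comparison)
  qed
  obtain k where "2 * t / d < real k" using reals_Archimedean2 by blast
  then have "t \<le> real k * (d/2)" using d(1) by (simp add: field_simps)
  then show ?thesis using key[OF t(1) _ t(2)] by blast
qed

lemma spectral_radius_powers:
  fixes x :: "'a::complex_banach_algebra_1"
  assumes r: "\<And>z. z \<in> spectrum x \<Longrightarrow> cmod z \<le> r" and s: "s > r" "s > 0"
  shows "(\<lambda>n. norm (x ^ n) / s ^ n) \<longlonglongrightarrow> 0"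
proof -
  \<comment> \<open>The spectrum is not yet known to be nonempty, so \<open>r\<close> may be
    negative; \<open>max r 0\<close> keeps \<open>m\<close> positive.\<close>
  define m where "m = (max r 0 + s) / 2"
  have m: "m > r" "m < s" "m > 0" using s by (auto simp: m_def max_def)
  have "(\<lambda>n. (1 / s) ^ n * norm (x ^ n)) \<longlonglongrightarrow> 0"
  proof (rule gelfand_disc[where R = "1 / m"])
    fix z :: complex assume z: "cmod z \<le> 1 / m"
    show "invertible_element (1 - z *\<^sub>C x)"
    proof (cases "z = 0")
      case False
      then have "m \<le> cmod (inverse z)" using z m by (simp add: norm_divide field_simps)
      then have "inverse z \<notin> spectrum x" using r[of "inverse z"] m by auto
      then show ?thesis using one_minus_scaleC_invertible_iff[OF False, of x] by blast
    qed simp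
  qed (use m s in \<open>simp_all add: field_simps\<close>)
  then show ?thesis by (simp add: power_one_over field_simps)
qed

text \<open>Emptiness would make the powers of \<open>x\<close> decay faster than every geometric
  sequence, whereas the then invertible \<open>x\<close> satisfies
  \<open>1 \<le> norm (x ^ n) * norm (ainv x) ^ n\<close>.\<close>

lemma spectrum_nonempty: "spectrum (x::'a::complex_banach_algebra_1) \<noteq> {}"
proof
  assume e: "spectrum x = {}"
  then have ix: "invertible_element x" using not_spectrum_iff[of 0 x] by simp
  let ?s = "1 / norm (ainv x)"
  have "(\<lambda>n. norm (x ^ n) / ?s ^ n) \<longlonglongrightarrow> 0"
    by (rule spectral_radius_powers[where r = 0]) (use e norm_ainv_pos[OF ix] in auto)
  moreover have "norm (x ^ n) / ?s ^ n \<ge> 1" for n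
  proof -
    have "x ^ n * ainv x ^ n = 1" using ainv_right[OF ainv_power(1)[OF ix]] ainv_power(2)[OF ix] by simp
    then have "1 = norm (x ^ n * ainv x ^ n)" by simp
    also have "\<dots> \<le> norm (x ^ n) * norm (ainv x) ^ n"
      by (rule order_trans[OF norm_mult_ineq mult_left_mono[OF norm_power_ineq norm_ge_zero]])
    finally show ?thesis by (simp add: power_one_over)
  qed
  ultimately have "(1::real) \<le> 0" by (intro LIMSEQ_le_const) auto
  then show False by simp
qed

lemma spectrum_subset_0_powers:
  fixes x :: "'a::complex_banach_algebra_1"
  assumes "spectrum x \<subseteq> {0}"
  shows "(\<lambda>n. t ^ n * norm (x ^ n)) \<longlonglongrightarrow> 0"
proof -
  have "(\<lambda>n. norm (x ^ n) / (1 / (\<bar>t\<bar> + 1)) ^ n) \<longlonglongrightarrow> 0"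
    by (rule spectral_radius_powers[where r = 0]) (use assms in auto)
  then have *: "(\<lambda>n. (\<bar>t\<bar> + 1) ^ n * norm (x ^ n)) \<longlonglongrightarrow> 0"
    by (simp add: power_one_over mult.commute)
  have "norm (t ^ n * norm (x ^ n)) \<le> (\<bar>t\<bar> + 1) ^ n * norm (x ^ n)" for n
    by (auto simp: abs_mult power_abs intro!: mult_right_mono power_mono)
  then show ?thesis by (intro Lim_null_comparison[OF _ *] always_eventually allI)
qed

section \<open>Riesz idempotents\<close>

lemma commute_mult: "y * x = x * y \<Longrightarrow> z * x = x * z \<Longrightarrow> (y * z) * x = x * (y * (z::'a::ring_1))"
  by (metis mult.assoc)

lemma commute_add: "y * x = x * y \<Longrightarrow> z * x = x * z \<Longrightarrow> (y + z) * x = x * (y + (z::'a::ring_1))"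
  by (simp add: algebra_simps)

lemma commute_diff: "y * x = x * y \<Longrightarrow> z * x = x * z \<Longrightarrow> (y - z) * x = x * (y - (z::'a::ring_1))"
  by (simp add: algebra_simps)

lemma commute_minus: "y * x = x * y \<Longrightarrow> (- y) * x = x * (- (y::'a::ring_1))"
  by simp

lemma commute_one: "1 * x = x * (1::'a::ring_1)"
  by simp

lemma commute_power: "y * x = x * y \<Longrightarrow> y ^ n * x = x * (y::'a::ring_1) ^ n"
  by (induction n) (simp_all add: mult.assoc, metis mult.assoc)

lemma commute_scaleC:
  "y * x = x * y \<Longrightarrow> (z *\<^sub>C y) * x = x * (z *\<^sub>C (y::'a::complex_banach_algebra_1))"
  by simp

lemma commute_scaleR: "y * x = x * y \<Longrightarrow> (t *\<^sub>R y) * x = x * (t *\<^sub>R (y::'a::real_algebra_1))"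
  by simp

lemma commute_ainv: "invertible_element y \<Longrightarrow> y * x = x * y \<Longrightarrow> ainv y * x = x * ainv (y::'a::ring_1)"
  using ainv_commute[of y x] by simp

lemma commute_diff_scalar:
  "y * x = x * y \<Longrightarrow> y * (x - z *\<^sub>C 1) = (x - z *\<^sub>C 1) * (y::'a::complex_banach_algebra_1)"
  by (simp add: left_diff_distrib right_diff_distrib)

lemma commute_lim:
  fixes x :: "'a::real_normed_algebra_1"
  assumes "f \<longlonglongrightarrow> l" "\<And>n. f n * x = x * f n"
  shows "l * x = x * l"
proof (rule LIMSEQ_unique)
  show "(\<lambda>n. f n * x) \<longlonglongrightarrow> l * x" by (intro tendsto_intros assms)
  show "(\<lambda>n. f n * x) \<longlonglongrightarrow> x * l" unfolding assms(2) by (intro tendsto_intros assms)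
qed

lemmas commute_intros = commute_mult commute_add commute_diff commute_minus commute_one
  commute_power commute_scaleC commute_scaleR

text \<open>The cofactor carries an inverse found for \<open>x ^ n - z ^ n\<close> back to
  \<open>x - z\<close>; as it commutes with \<open>x\<close>, a one-sided computation gives both
  sides.\<close>

lemma power_diff_scalar:
  fixes x :: "'a::complex_banach_algebra_1"
  shows "\<exists>s. x ^ n - z ^ n *\<^sub>C 1 = (x - z *\<^sub>C 1) * s \<and> s * x = x * s"
proof (induction n)
  case 0
  then show ?case by (intro exI[of _ 0]) simp
next
  case (Suc n)
  then obtain s where s: "x ^ n - z ^ n *\<^sub>C 1 = (x - z *\<^sub>C 1) * s" "s * x = x * s" by blast
  have "x ^ Suc n - z ^ Suc n *\<^sub>C 1 = (x - z *\<^sub>C 1) * x ^ n + z *\<^sub>C (x ^ n - z ^ n *\<^sub>C 1)"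
    by (simp add: algebra_simps scaleC_algebra)
  also have "\<dots> = (x - z *\<^sub>C 1) * (x ^ n + z *\<^sub>C s)"
    unfolding s by (simp add: algebra_simps)
  finally show ?case
    by (intro exI[of _ "x ^ n + z *\<^sub>C s"] conjI commute_intros s refl)
qed

lemma norm_cis_minus_one_le: "cmod (1 - cis t) \<le> \<bar>t\<bar>"
proof -
  have "cmod (exp (\<i> * of_real t) - 1) = 2 * \<bar>sin (t / 2)\<bar>" by (rule dist_exp_i_1)
  also have "\<dots> \<le> 2 * \<bar>t / 2\<bar>" by (intro mult_left_mono abs_sin_x_le_abs_x) auto
  finally show ?thesis by (simp add: cis_conv_exp norm_minus_commute)
qed

text \<open>The discrete Cauchy integral \<open>(1/n) \<Sum> (1 - \<omega>\<^sup>k x)\<^sup>-\<^sup>1\<close> over the \<open>n\<close>-th roots of unity equals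
  \<open>(1 - x\<^sup>n)\<^sup>-\<^sup>1\<close>, so the Riesz projection onto the part of the spectrum inside the unit circle is the
  limit of \<open>(1 - x\<^sup>n)\<^sup>-\<^sup>1\<close>.\<close>

lemma riesz_idempotent:
  fixes x :: "'a::complex_banach_algebra_1"
  assumes inv: "\<And>z. cmod z = 1 \<Longrightarrow> z \<notin> spectrum x"
  obtains e where "e * e = e" "\<And>y. y * x = x * y \<Longrightarrow> y * e = e * y"
    and "\<And>n. n > 0 \<Longrightarrow> invertible_element (1 - x ^ n)"
    and "(\<lambda>n. ainv (1 - x ^ n)) \<longlonglongrightarrow> e"
    and "\<And>z. cmod z \<le> 1 \<Longrightarrow> \<exists>y. (x - z *\<^sub>C 1) * y = 1 - e \<and> y * (x - z *\<^sub>C 1) = 1 - e"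
    and "\<And>z. cmod z \<ge> 1 \<Longrightarrow> \<exists>y. (x - z *\<^sub>C 1) * y = e \<and> y * (x - z *\<^sub>C 1) = e"
proof -
  let ?U = "{z. invertible_element (1 - z *\<^sub>C x)}"
  have op: "open ?U" by (intro open_preimage_invertible continuous_intros)
  have sub: "sphere 0 1 \<subseteq> ?U"
  proof
    fix z :: complex assume "z \<in> sphere 0 1"
    then have z: "cmod z = 1" by simp
    then have "z \<noteq> 0" "inverse z \<notin> spectrum x" by (auto intro!: inv simp: norm_inverse)
    then show "z \<in> ?U" using one_minus_scaleC_invertible_iff[of z x] by blast
  qed
  obtain r where r: "r > 0" "(\<Union>z\<in>sphere 0 1. ball z r) \<subseteq> ?U"
    by (rule compact_subset_open_imp_ball_epsilon_subset[OF compact_sphere op sub])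
  \<comment> \<open>With \<open>d < r\<close> the annulus \<open>K\<close> stays in the region of
    invertibility, and with \<open>d < 1\<close> it avoids 0, so that its points can be projected
    radially to the circle. Being rotation invariant, it fits
    \<open>resolvent_averages\<close>.\<close>
  define d where "d = min (r/2) (1/2)"
  have d: "0 < d" "d < r" "d < 1" using r(1) by (auto simp: d_def)
  define K where "K = cball 0 (1 + d) \<inter> {z::complex. 1 - d \<le> cmod z}"
  have K: "z \<in> K \<longleftrightarrow> 1 - d \<le> cmod z \<and> cmod z \<le> 1 + d" for z by (auto simp: K_def)
  have "compact K" unfolding K_def by (intro compact_Int_closed compact_cball closed_Collect_le continuous_intros)
  moreover have "w * z \<in> K" if "z \<in> K" "cmod w = 1" for z w using that by (simp add: K norm_mult)
  moreover have "invertible_element (1 - z *\<^sub>C x)" if z: "z \<in> K" for z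
  proof -
    have z0: "cmod z > 0" using z d by (auto simp: K)
    let ?w = "z / of_real (cmod z)"
    have "z - ?w = of_real ((cmod z - 1) / cmod z) * z" using z0 by (simp add: field_simps)
    then have "cmod (z - ?w) = \<bar>cmod z - 1\<bar>" using z0 by (simp only: norm_mult norm_of_real) simp
    also have "\<dots> < r" using z d by (auto simp: K)
    finally have "z \<in> ball ?w r" by (simp add: dist_norm norm_minus_commute)
    moreover have "?w \<in> sphere 0 1" using z0 by (simp add: norm_divide)
    ultimately show ?thesis using r(2) by blast
  qed
  ultimately obtain C where C: "C > 0"
    and i: "\<And>n z. n > 0 \<Longrightarrow> z \<in> K \<Longrightarrow> invertible_element (1 - (z *\<^sub>C x) ^ n)"
    and bd: "\<And>n z. n > 0 \<Longrightarrow> z \<in> K \<Longrightarrow> norm (ainv (1 - (z *\<^sub>C x) ^ n)) \<le> C"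
    and eq: "\<And>e. e > 0 \<Longrightarrow> \<exists>d>0. \<forall>n>0. \<forall>z\<in>K. \<forall>z'\<in>K. cmod (z - z') < d \<longrightarrow>
           norm (ainv (1 - (z *\<^sub>C x) ^ n) - ainv (1 - (z' *\<^sub>C x) ^ n)) \<le> e"
    using resolvent_averages[of K x] by blast
  define F where "F n = ainv (1 - x ^ n)" for n
  \<comment> \<open>\<open>G t n\<close> is the same inverse at radius \<open>t\<close>. For
    \<open>t\<close> near 1 it is close to \<open>F n\<close> uniformly in \<open>n\<close>, while
    the power \<open>t ^ n\<close> yields a geometric gain: \<open>t > 1\<close> serves the range of
    the limit idempotent, \<open>t < 1\<close> its complement.\<close>
  define G where "G t n = ainv (1 - t ^ n *\<^sub>R x ^ n)" for t and n :: nat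
  have GE: "ainv (1 - (complex_of_real t *\<^sub>C x) ^ n) = G t n" for t n
    by (simp add: G_def power_scaleC scaleR_eq_scaleC)
  have K1: "1 \<in> K" using d by (simp add: K)
  have Fi: "invertible_element (1 - x ^ n)" and Fb: "norm (F n) \<le> C" if "n > 0" for n
    using i[OF that K1] bd[OF that K1] by (simp_all add: F_def)
  have Gi: "invertible_element (1 - t ^ n *\<^sub>R x ^ n)" and Gb: "norm (G t n) \<le> C"
    if "n > 0" "1 - d \<le> t" "t \<le> 1 + d" for n t
  proof -
    have "complex_of_real t \<in> K" using that d by (simp add: K)
    from i[OF that(1) this] bd[OF that(1) this] show "invertible_element (1 - t ^ n *\<^sub>R x ^ n)" "norm (G t n) \<le> C"
      unfolding GE by (simp_all add: power_scaleC scaleR_eq_scaleC)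
  qed
  have close: "\<exists>h>0. \<forall>n>0. \<forall>t. \<bar>t - 1\<bar> < h \<longrightarrow> 1 - d \<le> t \<longrightarrow> t \<le> 1 + d \<longrightarrow> norm (F n - G t n) \<le> e"
    if e: "e > 0" for e
  proof -
    obtain h where h: "h > 0" "\<And>n z z'. n > 0 \<Longrightarrow> z \<in> K \<Longrightarrow> z' \<in> K \<Longrightarrow> cmod (z - z') < h \<Longrightarrow>
           norm (ainv (1 - (z *\<^sub>C x) ^ n) - ainv (1 - (z' *\<^sub>C x) ^ n)) \<le> e"
      using eq[OF e] by blast
    have "norm (F n - G t n) \<le> e" if "n > 0" "\<bar>t - 1\<bar> < h" "1 - d \<le> t" "t \<le> 1 + d" for n t
    proof -
      have "cmod (complex_of_real 1 - complex_of_real t) = \<bar>t - 1\<bar>"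
        by (simp only: norm_of_real abs_minus_commute flip: of_real_diff)
      then have "cmod (complex_of_real 1 - complex_of_real t) < h" using that by simp
      then have "norm (ainv (1 - (complex_of_real 1 *\<^sub>C x) ^ n) - ainv (1 - (complex_of_real t *\<^sub>C x) ^ n)) \<le> e"
        using that d by (intro h(2)) (simp_all add: K)
      then show ?thesis unfolding GE by (simp add: G_def F_def)
    qed
    with h(1) show ?thesis by blast
  qed
  have "Cauchy F"
  proof (rule metric_CauchyI)
    fix e :: real assume e: "e > 0"
    obtain h where h: "h > 0" "\<And>n z z'. n > 0 \<Longrightarrow> z \<in> K \<Longrightarrow> z' \<in> K \<Longrightarrow> cmod (z - z') < h \<Longrightarrow>
           norm (ainv (1 - (z *\<^sub>C x) ^ n) - ainv (1 - (z' *\<^sub>C x) ^ n)) \<le> e/3"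
      using eq[of "e/3"] e by auto
    obtain N where N: "real N > 2 * pi / h" using reals_Archimedean2 by blast
    have N0: "N > 0" using N h(1) by (cases N) (auto simp: field_simps)
    \<comment> \<open>\<open>F (n * m)\<close> averages inverses of order \<open>n\<close> over
      rotations by angles in \<open>[0, 2 pi / n)\<close>, so equicontinuity compares it with
      \<open>F n\<close>. Two indices are then compared through their product.\<close>
    have key: "norm (F n - F (n * m)) \<le> e/3" if n: "n \<ge> N" and m: "m > 0" for n m
    proof -
      have n0: "n > 0" using n N0 by simp
      let ?w = "\<lambda>l. cis (2 * pi * real l / real (n * m))"
      have wK: "?w l \<in> K" for l using d by (simp add: K)
      have wn: "(?w l *\<^sub>C x) ^ n = cis (2 * pi / real m) ^ l *\<^sub>C x ^ n" for l
        using n0 by (simp add: power_scaleC Complex.DeMoivre mult_ac)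
      have inv': "invertible_element (1 - cis (2 * pi / real m) ^ l *\<^sub>C x ^ n)" for l
        using i[OF n0 wK[of l]] unfolding wn .
      have "F (n * m) = inverse (real m) *\<^sub>R (\<Sum>l<m. ainv (1 - (?w l *\<^sub>C x) ^ n))"
        unfolding wn F_def power_mult by (rule root_of_unity_average(2)[OF m inv'])
      moreover have "F n = inverse (real m) *\<^sub>R (\<Sum>l<m. ainv (1 - (1 *\<^sub>C x) ^ n))"
        using m by (simp add: F_def sum_constant_scaleR del: sum_constant)
      ultimately have "F n - F (n * m)
        = inverse (real m) *\<^sub>R (\<Sum>l<m. ainv (1 - (1 *\<^sub>C x) ^ n) - ainv (1 - (?w l *\<^sub>C x) ^ n))"
        by (simp only: sum_subtractf scaleR_diff_right)
      also have "norm \<dots> \<le> e/3"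
      proof (rule norm_average_le[OF m], rule h(2)[OF n0 K1 wK])
        fix l assume l: "l < m"
        have "cmod (1 - ?w l) \<le> \<bar>2 * pi * real l / real (n * m)\<bar>" by (rule norm_cis_minus_one_le)
        also have "\<dots> = 2 * pi / real n * (real l / real m)" by simp
        also have "\<dots> \<le> 2 * pi / real n * 1" using l by (intro mult_left_mono) auto
        also have "\<dots> \<le> 2 * pi / real N * 1" using n N0 by (intro mult_right_mono divide_left_mono) auto
        also have "\<dots> < h" using N N0 h(1) by (simp add: field_simps)
        finally show "cmod (1 - ?w l) < h" .
      qed
      finally show ?thesis .
    qed
    show "\<exists>M. \<forall>m\<ge>M. \<forall>n\<ge>M. dist (F m) (F n) < e"
    proof (intro exI allI impI)
      fix m n assume mn: "m \<ge> N" "n \<ge> N"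
      have "norm (F m - F n) \<le> norm (F m - F (m * n)) + norm (F n - F (n * m))"
        using norm_triangle_ineq4[of "F m - F (m * n)" "F n - F (n * m)"] by (simp add: mult.commute)
      also have "\<dots> \<le> e/3 + e/3" using mn N0 by (intro add_mono key) auto
      also have "\<dots> < e" using e by simp
      finally show "dist (F m) (F n) < e" by (simp add: dist_norm)
    qed
  qed
  then obtain e where e: "F \<longlonglongrightarrow> e" using Cauchy_convergent_iff convergent_def by blast
  have Fcomm: "F n * y = y * F n" if "y * x = x * y" "n > 0" for n y
    unfolding F_def using that Fi by (intro commute_ainv) (simp_all add: commute_intros algebra_simps commute_power)
  have ecomm: "y * e = e * y" if "y * x = x * y" for y
  proof -
    have "(\<lambda>n. F (Suc n)) \<longlonglongrightarrow> e" using e by (rule LIMSEQ_Suc)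
    from commute_lim[OF this Fcomm[OF that]] show ?thesis by simp
  qed
  have Gcomm: "G t n * x = x * G t n" if "n > 0" "1 - d \<le> t" "t \<le> 1 + d" for n t
    unfolding G_def by (intro commute_ainv Gi that commute_intros refl)
  have xe: "x * e = e * x" and xne: "x ^ n * e = e * x ^ n" for n
    using ecomm[of x] ecomm[of "x ^ n"] by (simp_all add: power_commutes)
  have Geq: "t ^ n *\<^sub>R (x ^ n * G t n) = G t n - 1" if "n > 0" "1 - d \<le> t" "t \<le> 1 + d" for n t
    using ainv_right[OF Gi[OF that]] by (simp add: G_def algebra_simps)
  have xG: "norm (x ^ n * G t n) \<le> (C + 1) / t ^ n" if "n > 0" "1 < t" "t \<le> 1 + d" for n t
  proof -
    have "t ^ n *\<^sub>R (x ^ n * G t n) = G t n - 1" using that d by (intro Geq) auto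
    then have "norm (t ^ n *\<^sub>R (x ^ n * G t n)) = norm (G t n - 1)" by simp
    then have "t ^ n * norm (x ^ n * G t n) = norm (G t n - 1)" using that by simp
    also have "\<dots> \<le> C + 1"
      by (rule order_trans[OF norm_triangle_ineq4]) (use Gb[of n t] that d in simp)
    finally show ?thesis using that by (simp add: field_simps)
  qed
  have lim_t: "(\<lambda>n. c / t ^ n) \<longlonglongrightarrow> 0" if "t > 1" for c t :: real
    using tendsto_mult_right_zero[OF LIMSEQ_power_zero[of "1/t"], of c] that
    by (simp add: power_one_over)
  have ee: "e * e = e"
  proof -
    \<comment> \<open>Split the right factor of \<open>(1 - F n) * F n\<close> as
      \<open>G t n + (F n - G t n)\<close> with \<open>t > 1\<close>. Since
      \<open>1 - F n = - (F n * x ^ n)\<close>, the first part contains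
      \<open>x ^ n * G t n\<close>, which is of order \<open>1 / t ^ n\<close>; the second is at
      most \<open>q\<close>.\<close>
    have "norm ((1 - e) * e) \<le> 0 + q" if q: "q > 0" for q
    proof -
      obtain h where h: "h > 0" "\<And>n t. n > 0 \<Longrightarrow> \<bar>t - 1\<bar> < h \<Longrightarrow> 1 - d \<le> t \<Longrightarrow> t \<le> 1 + d \<Longrightarrow>
          norm (F n - G t n) \<le> q / (1 + C)"
        using close[of "q / (1 + C)"] q C by auto
      define t where "t = 1 + min d (h/2)"
      have t: "1 < t" "t \<le> 1 + d" "\<bar>t - 1\<bar> < h" using h d by (auto simp: t_def min_def)
      have *: "norm ((1 - F n) * F n) \<le> (C * (C + 1)) / t ^ n + q" if n: "n > 0" for n
      proof -
        have "1 - F n = - (F n * x ^ n)" using ainv_left[OF Fi[OF n]] by (simp add: F_def algebra_simps)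
        then have "(1 - F n) * G t n = - (F n * (x ^ n * G t n))" by (simp only: mult_minus_left mult.assoc)
        then have "(1 - F n) * F n = - (F n * (x ^ n * G t n)) + (1 - F n) * (F n - G t n)"
          by (simp only: right_diff_distrib[of "1 - F n"]) simp
        also have "norm \<dots> \<le> norm (F n) * norm (x ^ n * G t n) + norm (1 - F n) * norm (F n - G t n)"
          by (rule norm_triangle_le) (simp add: add_mono norm_mult_ineq)
        also have "\<dots> \<le> C * ((C + 1) / t ^ n) + (1 + C) * (q / (1 + C))"
        proof (intro add_mono mult_mono)
          show "norm (1 - F n) \<le> 1 + C" by (rule order_trans[OF norm_triangle_ineq4]) (use Fb[OF n] in simp)
          show "norm (F n - G t n) \<le> q / (1 + C)" by (rule h(2)) (use n t d in auto)
        qed (use Fb[OF n] xG[OF n t(1,2)] C q in auto)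
        finally show ?thesis using C by simp
      qed
      have "(\<lambda>n. norm ((1 - F n) * F n)) \<longlonglongrightarrow> norm ((1 - e) * e)" by (intro tendsto_intros e)
      moreover have "(\<lambda>n. (C * (C + 1)) / t ^ n + q) \<longlonglongrightarrow> 0 + q" by (intro tendsto_add lim_t t tendsto_const)
      ultimately show ?thesis by (rule LIMSEQ_le) (use * in \<open>auto intro!: exI[of _ 1]\<close>)
    qed
    then have "norm ((1 - e) * e) \<le> 0" by (rule field_le_epsilon)
    then show ?thesis by (simp add: algebra_simps)
  qed
  obtain h where h: "h > 0" "\<And>n t. n > 0 \<Longrightarrow> \<bar>t - 1\<bar> < h \<Longrightarrow> 1 - d \<le> t \<Longrightarrow> t \<le> 1 + d \<Longrightarrow>
      norm (F n - G t n) \<le> 1/4"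
    using close[of "1/4"] by auto
  have "\<forall>\<^sub>F n in sequentially. dist (F n) e < 1/4" by (rule tendstoD[OF e]) simp
  then have ev: "\<forall>\<^sub>F n in sequentially. n > 0 \<and>
    (\<forall>t. \<bar>t - 1\<bar> < h \<longrightarrow> 1 - d \<le> t \<longrightarrow> t \<le> 1 + d \<longrightarrow> norm (e - G t n) \<le> 1/2)"
    using eventually_gt_at_top[of 0]
  proof eventually_elim
    case (elim n)
    have "norm (e - G t n) \<le> 1/2" if "\<bar>t - 1\<bar> < h" "1 - d \<le> t" "t \<le> 1 + d" for t
      using norm_triangle_ineq[of "e - F n" "F n - G t n"] h(2)[OF elim(2) that] elim(1)
      by (simp add: dist_norm norm_minus_commute)
    with elim show ?case by blast
  qed
  have small_e: "(\<lambda>n. x ^ n * e) \<longlonglongrightarrow> 0"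
  proof -
    define t where "t = 1 + min d (h/2)"
    have t: "1 < t" "t \<le> 1 + d" "\<bar>t - 1\<bar> < h" "1 - d \<le> t" using h d by (auto simp: t_def min_def)
    have "\<forall>\<^sub>F n in sequentially. norm (x ^ n * e) \<le> (2 * norm e * (C + 1)) / t ^ n"
      using ev
    proof eventually_elim
      case (elim n)
      then have eG: "norm (e - G t n) \<le> 1/2" using t by blast
      \<comment> \<open>The factor \<open>e - G t n\<close> has norm at most 1/2, so the second
        summand is absorbed by half of the left-hand side.\<close>
      have "x ^ n * e = e * (x ^ n * G t n) + x ^ n * e * (e - G t n)"
        unfolding mult.assoc[of e, symmetric] xne[of n, symmetric] right_diff_distrib
        by (simp add: mult.assoc ee)
      also have "norm \<dots> \<le> norm e * norm (x ^ n * G t n) + norm (x ^ n * e) * norm (e - G t n)"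
        by (rule norm_triangle_le) (simp add: add_mono norm_mult_ineq)
      also have "\<dots> \<le> norm e * ((C + 1) / t ^ n) + norm (x ^ n * e) * (1/2)"
        using elim t by (intro add_mono mult_left_mono xG eG) auto
      finally show ?case by simp
    qed
    then show ?thesis by (rule Lim_null_comparison) (rule lim_t[OF t(1)])
  qed
  have small_v: "\<forall>\<^sub>F n in sequentially. n > 0 \<and>
      (\<exists>v. x ^ n * v = 1 - e \<and> v * x = x * v \<and> (1 - e) * v = v \<and> norm v < 1)"
  proof -
    define t where "t = 1 - min d (h/2)"
    have t: "t < 1" "0 \<le> t" "t \<le> 1 + d" "\<bar>t - 1\<bar> < h" "1 - d \<le> t" using h d by (auto simp: t_def min_def)
    have "(\<lambda>n. t ^ n * (norm (1 - e) * (C * 2))) \<longlonglongrightarrow> 0"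
      by (intro tendsto_mult_left_zero LIMSEQ_power_zero) (use t in simp)
    then have "\<forall>\<^sub>F n in sequentially. t ^ n * (norm (1 - e) * (C * 2)) < 1"
      by (rule order_tendstoD) simp
    with ev show ?thesis
    proof eventually_elim
      case (elim n)
      then have n: "n > 0" and eG: "norm (G t n - e) \<le> 1/2" using t by (auto simp: norm_minus_commute)
      \<comment> \<open>\<open>x ^ n\<close> gets inverted on the range of \<open>1 - e\<close>:
        \<open>(1 - e) * ?W\<close> equals \<open>(1 - e) * (1 - G t n)\<close>, and
        \<open>1 - G t n\<close> is \<open>x ^ n * G t n\<close> times \<open>- t ^ n\<close>. As
        \<open>t < 1\<close>, this factor makes the inverse small.\<close>
      let ?W = "1 - (G t n - e)"
      have Wi: "invertible_element ?W" using eG by (intro neumann) simp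
      have "norm (ainv ?W) \<le> 1 / (1 - norm (G t n - e))" using eG by (intro neumann) simp
      also have "\<dots> \<le> 1 / (1/2)" using eG by (intro divide_left_mono) auto
      finally have Wn: "norm (ainv ?W) \<le> 2" by simp
      have Gx: "G t n * x = x * G t n" by (rule Gcomm[OF n t(5,3)])
      have Gx': "x ^ n * G t n = G t n * x ^ n" using commute_power[of x "G t n" n] Gx by simp
      have Wx: "ainv ?W * x = x * ainv ?W"
        by (intro commute_ainv Wi commute_intros Gx) (simp add: xe)
      let ?v = "- (t ^ n *\<^sub>R ((1 - e) * (G t n * ainv ?W)))"
      have "x ^ n * ?v = (1 - e) * (- (t ^ n *\<^sub>R (x ^ n * G t n))) * ainv ?W"
        using xne[of n] by (simp add: algebra_simps flip: mult.assoc)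
      also have "\<dots> = (1 - e) * (1 - G t n) * ainv ?W" unfolding Geq[OF n t(5,3)] by simp
      also have "(1 - e) * (1 - G t n) = (1 - e) * ?W" using ee by (simp add: algebra_simps)
      also have "(1 - e) * ?W * ainv ?W = 1 - e" using Wi by (simp add: mult.assoc)
      finally have v1: "x ^ n * ?v = 1 - e" .
      have v2: "?v * x = x * ?v" by (intro commute_intros Gx Wx) (simp add: xe)
      have "(1 - e) * (1 - e) = 1 - e" using ee by (simp add: algebra_simps)
      then have v3: "(1 - e) * ?v = ?v" by (simp flip: mult.assoc)
      have "norm ?v = t ^ n * norm ((1 - e) * (G t n * ainv ?W))" using t by simp
      also have "\<dots> \<le> t ^ n * (norm (1 - e) * (norm (G t n) * norm (ainv ?W)))"
        using t by (intro mult_left_mono order_trans[OF norm_mult_ineq] norm_mult_ineq) auto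
      also have "\<dots> \<le> t ^ n * (norm (1 - e) * (C * 2))"
        using t C by (intro mult_left_mono mult_mono Gb[OF n] Wn) auto
      finally have "norm ?v < 1" using elim by simp
      with v1 v2 v3 n show ?case by blast
    qed
  qed
  show ?thesis
  proof (rule that[OF ee ecomm Fi e[unfolded F_def]])
    fix z :: complex assume z: "cmod z \<le> 1"
    obtain n v where v: "n > 0" "x ^ n * v = 1 - e" "v * x = x * v" "(1 - e) * v = v" "norm v < 1"
      using eventually_happens[OF small_v] by auto
    obtain s where s: "x ^ n - z ^ n *\<^sub>C 1 = (x - z *\<^sub>C 1) * s" "s * x = x * s"
      using power_diff_scalar by blast
    \<comment> \<open>The product \<open>(x ^ n - z ^ n *\<^sub>C 1) * v\<close> equals
      \<open>(1 - e) * ?w\<close>, and \<open>?w\<close> is invertible because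
      \<open>norm v < 1\<close> and \<open>cmod z \<le> 1\<close>.\<close>
    let ?w = "1 - z ^ n *\<^sub>C v"
    have "norm (z ^ n *\<^sub>C v) \<le> 1 * norm v"
      unfolding norm_scaleC norm_power using z by (intro mult_right_mono power_le_one) auto
    then have w: "invertible_element ?w" using v(5) by (intro neumann) simp
    let ?y = "s * (v * ainv ?w)"
    have "(x - z *\<^sub>C 1) * ?y = (x ^ n - z ^ n *\<^sub>C 1) * v * ainv ?w" unfolding s(1) by (simp add: mult.assoc)
    also have "(x ^ n - z ^ n *\<^sub>C 1) * v = (1 - e) * ?w"
      using v(2) v(4) by (simp add: left_diff_distrib) (simp add: algebra_simps)
    also have "\<dots> * ainv ?w = 1 - e" using w by (simp add: mult.assoc)
    finally have r: "(x - z *\<^sub>C 1) * ?y = 1 - e" .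
    have "?y * x = x * ?y" by (intro commute_intros commute_ainv w s v)
    then have "?y * (x - z *\<^sub>C 1) = (x - z *\<^sub>C 1) * ?y" by (rule commute_diff_scalar)
    then show "\<exists>y. (x - z *\<^sub>C 1) * y = 1 - e \<and> y * (x - z *\<^sub>C 1) = 1 - e"
      unfolding r by (intro exI[of _ ?y]) (simp only: r)
  next
    fix z :: complex assume z: "cmod z \<ge> 1"
    have "\<forall>\<^sub>F n in sequentially. norm (x ^ n * e) < 1"
      using tendstoD[OF small_e, of 1] by simp
    from eventually_happens[OF this] obtain n where n: "norm (x ^ n * e) < 1" by auto
    obtain s where s: "x ^ n - z ^ n *\<^sub>C 1 = (x - z *\<^sub>C 1) * s" "s * x = x * s"
      using power_diff_scalar by blast
    let ?c = "inverse z ^ n"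
    let ?w = "1 - ?c *\<^sub>C (x ^ n * e)"
    have "z \<noteq> 0" using z by auto
    then have zn: "z ^ n * ?c = 1" by (simp flip: power_mult_distrib)
    have "norm (?c *\<^sub>C (x ^ n * e)) \<le> 1 * norm (x ^ n * e)"
      unfolding norm_scaleC norm_power norm_inverse
      using z by (intro mult_right_mono power_le_one) (auto simp: inverse_le_1_iff)
    then have w: "invertible_element ?w" using n by (intro neumann) simp
    let ?y = "s * ((- ?c) *\<^sub>C (e * ainv ?w))"
    have "(x - z *\<^sub>C 1) * ?y = (- ?c) *\<^sub>C ((x ^ n - z ^ n *\<^sub>C 1) * e) * ainv ?w"
      unfolding s(1) by (simp add: mult.assoc)
    also have "(- ?c) *\<^sub>C ((x ^ n - z ^ n *\<^sub>C 1) * e) = e - ?c *\<^sub>C (x ^ n * e)"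
      using zn by (simp add: left_diff_distrib scaleC_algebra mult.commute)
    also have "\<dots> = e * ?w"
      unfolding right_diff_distrib mult_scaleC_right mult.assoc[of e, symmetric] xne[of n, symmetric]
      by (simp add: mult.assoc ee)
    also have "\<dots> * ainv ?w = e" using w by (simp add: mult.assoc)
    finally have r: "(x - z *\<^sub>C 1) * ?y = e" .
    have "?y * x = x * ?y" by (intro commute_intros commute_ainv w s) (simp_all add: xe)
    then have "?y * (x - z *\<^sub>C 1) = (x - z *\<^sub>C 1) * ?y" by (rule commute_diff_scalar)
    then show "\<exists>y. (x - z *\<^sub>C 1) * y = e \<and> y * (x - z *\<^sub>C 1) = e"
      unfolding r by (intro exI[of _ ?y]) (simp only: r)
  qed
qed

section \<open>Functional calculus for self-adjoint elements\<close>

lemma star_zero [simp]: "star (0::'a::cstar_algebra_1) = 0"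
  using star_scaleC[of 0 "0::'a"] by simp

lemma star_minus: "star (- x) = - star (x::'a::cstar_algebra_1)"
  using star_add[of x "-x"] by (simp add: eq_neg_iff_add_eq_0 add.commute)

lemma star_diff: "star (x - y) = star x - star (y::'a::cstar_algebra_1)"
  using star_add[of x "-y"] by (simp add: star_minus)

lemma star_one [simp]: "star (1::'a::cstar_algebra_1) = 1"
  using star_mult[of "star 1" "1::'a"] by (simp add: star_star)

lemma star_scaleR: "star (r *\<^sub>R x) = r *\<^sub>R star (x::'a::cstar_algebra_1)"
  by (simp add: scaleR_eq_scaleC star_scaleC)

declare star_star [simp]

lemma star_power: "star (x ^ n) = star (x::'a::cstar_algebra_1) ^ n"
  by (induction n) (simp_all add: star_mult power_commutes)

lemma star_sum: "star (\<Sum>i\<in>I. f i) = (\<Sum>i\<in>I. star (f i :: 'a::cstar_algebra_1))"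
  by (induction I rule: infinite_finite_induct) (simp_all add: star_add)

lemma norm_star [simp]: "norm (star x) = norm (x::'a::cstar_algebra_1)"
proof -
  have le: "norm x \<le> norm (star x)" for x :: 'a
  proof (cases "norm x = 0")
    case False
    have "norm x * norm x \<le> norm (star x) * norm x"
      using norm_mult_ineq[of "star x" x] by (simp add: norm_star_mult power2_eq_square)
    then show ?thesis using False by (simp add: mult_le_cancel_right)
  qed simp
  from le[of x] le[of "star x"] show ?thesis by simp
qed

lemma bounded_linear_star: "bounded_linear (star :: 'a \<Rightarrow> 'a::cstar_algebra_1)"
  by (rule bounded_linear_intro[where K = 1]) (simp_all add: star_add star_scaleR)

lemmas tendsto_star [tendsto_intros] = bounded_linear.tendsto[OF bounded_linear_star]

lemma norm_selfadjoint_power: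
  fixes h :: "'a::cstar_algebra_1"
  assumes "star h = h"
  shows "norm (h ^ (2 ^ k)) = norm h ^ (2 ^ k)"
proof (induction k)
  case (Suc k)
  have "h ^ (2 ^ Suc k) = star (h ^ 2 ^ k) * h ^ 2 ^ k"
    using assms by (simp add: star_power mult_2 power_add)
  then have "norm (h ^ (2 ^ Suc k)) = (norm (h ^ 2 ^ k))\<^sup>2" by (simp add: norm_star_mult)
  then show ?case by (simp add: Suc power_mult[symmetric] mult.commute)
qed simp

text \<open>Along the exponents \<open>2 ^ k\<close> the norm of a self-adjoint element is
  multiplicative, so a growth rate of the powers bounds the norm itself. The hypothesis concerns
  powers rather than the spectrum because for combinations of orthogonal projections the powers are
  explicit.\<close>

lemma norm_selfadjoint_le_powers:
  fixes h :: "'a::cstar_algebra_1"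
  assumes h: "star h = h" and lim: "\<And>s. s > r \<Longrightarrow> (\<lambda>n. norm (h ^ n) / s ^ n) \<longlonglongrightarrow> 0" and r: "r \<ge> 0"
  shows "norm h \<le> r"
proof (rule dense_le)
  fix s assume s: "s < norm h"
  show "s \<le> r"
  proof (rule ccontr)
    assume "\<not> s \<le> r"
    then have sr: "s > r" by simp
    have "\<forall>\<^sub>F n in sequentially. norm (h ^ n) / s ^ n < 1"
      by (rule order_tendstoD[OF lim[OF sr]]) simp
    then obtain N where N: "\<And>n. n \<ge> N \<Longrightarrow> norm (h ^ n) / s ^ n < 1"
      unfolding eventually_sequentially by auto
    have "norm h ^ (2 ^ N) / s ^ (2 ^ N) < 1"
      using N[of "2 ^ N"] by (simp add: norm_selfadjoint_power[OF h] less_imp_le[OF less_exp])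
    then have "norm h ^ (2 ^ N) < s ^ (2 ^ N)" using sr r by (simp add: divide_less_eq)
    moreover have "s ^ (2 ^ N) \<le> norm h ^ (2 ^ N)" using s sr r by (intro power_mono) auto
    ultimately show False by simp
  qed
qed

lemma norm_selfadjoint_le_spectrum:
  fixes h :: "'a::cstar_algebra_1"
  assumes h: "star h = h" and r: "\<And>z. z \<in> spectrum h \<Longrightarrow> cmod z \<le> r" "r \<ge> 0"
  shows "norm h \<le> r"
  by (rule norm_selfadjoint_le_powers[OF h spectral_radius_powers[OF r(1)]]) (use r(2) in auto)

text \<open>Shift by an imaginary scalar: the squared modulus of the shifted point acquires the
  linear term \<open>2 * Im z * t\<close>, whereas the C*-identity bounds the squared norm of the
  shifted element by \<open>(norm h)\<^sup>2 + t\<^sup>2\<close>. For nonzero \<open>Im z\<close> a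
  suitable real \<open>t\<close> violates the comparison.\<close>

lemma spectrum_selfadjoint_real:
  fixes h :: "'a::cstar_algebra_1"
  assumes h: "star h = h" and z: "z \<in> spectrum h"
  shows "Im z = 0"
proof (rule ccontr)
  assume im: "Im z \<noteq> 0"
  have *: "(Im z)\<^sup>2 + 2 * Im z * t \<le> (norm h)\<^sup>2" for t :: real
  proof -
    let ?k = "h + (\<i> * of_real t) *\<^sub>C 1"
    have "?k - (z + \<i> * of_real t) *\<^sub>C 1 = h - z *\<^sub>C 1" by (simp add: scaleC_algebra)
    then have "z + \<i> * of_real t \<in> spectrum ?k" using z unfolding spectrum_def mem_Collect_eq by metis
    then have "(cmod (z + \<i> * of_real t))\<^sup>2 \<le> (norm ?k)\<^sup>2"
      by (intro power_mono spectrum_norm_le) auto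
    also have "\<dots> = norm (star ?k * ?k)" by (simp add: norm_star_mult)
    also have "star ?k * ?k = h * h + (t\<^sup>2) *\<^sub>R 1"
      by (simp add: star_add star_scaleC h algebra_simps scaleR_eq_scaleC power2_eq_square scaleC_algebra)
    also have "norm \<dots> \<le> (norm h)\<^sup>2 + t\<^sup>2"
      by (rule norm_triangle_le) (use norm_mult_ineq[of h h] in \<open>simp add: power2_eq_square\<close>)
    finally have "(Re z)\<^sup>2 + (Im z + t)\<^sup>2 \<le> (norm h)\<^sup>2 + t\<^sup>2" by (simp add: cmod_power2)
    moreover have "(Re z)\<^sup>2 \<ge> 0" by simp
    moreover have "(Im z + t)\<^sup>2 = (Im z)\<^sup>2 + 2 * Im z * t + t\<^sup>2" by (rule power2_sum[THEN trans]) simp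
    ultimately show ?thesis by linarith
  qed
  have "2 * Im z * (((norm h)\<^sup>2 + 1) / (2 * Im z)) = (norm h)\<^sup>2 + 1" using im by simp
  moreover have "(Im z)\<^sup>2 \<ge> 0" by simp
  ultimately show False using *[of "((norm h)\<^sup>2 + 1) / (2 * Im z)"] by linarith
qed

text \<open>Real coordinates turn functions of a self-adjoint element into functions of a real
  variable, for which polynomial approximation holds without conjugates.\<close>

definition rspec :: "'a::complex_banach_algebra_1 \<Rightarrow> real set" where
  "rspec h = {s. complex_of_real s \<in> spectrum h}"

lemma spectrum_eq_rspec:
  fixes h :: "'a::cstar_algebra_1"
  assumes "star h = h"
  shows "spectrum h = complex_of_real ` rspec h"
proof
  show "spectrum h \<subseteq> complex_of_real ` rspec h"
  proof
    fix z assume "z \<in> spectrum h"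
    moreover from spectrum_selfadjoint_real[OF assms this] have "z = of_real (Re z)"
      by (simp add: complex_eq_iff)
    ultimately show "z \<in> complex_of_real ` rspec h" unfolding rspec_def by (metis imageI mem_Collect_eq)
  qed
qed (auto simp: rspec_def)

lemma compact_rspec: "compact (rspec h)"
  unfolding compact_eq_bounded_closed
proof
  show "bounded (rspec h)"
    unfolding bounded_iff rspec_def using spectrum_norm_le[of _ h] by (auto intro!: exI[of _ "norm h"]) fastforce
  have "closed (complex_of_real -` spectrum h)"
    by (intro closed_vimage closed_spectrum continuous_intros)
  then show "closed (rspec h)" by (simp add: rspec_def vimage_def)
qed

section \<open>Polynomials in an element and spectral mapping\<close>

definition poly_alg :: "'a::complex_banach_algebra_1 \<Rightarrow> complex poly \<Rightarrow> 'a" where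
  "poly_alg h p = fold_coeffs (\<lambda>c y. c *\<^sub>C 1 + h * y) p 0"

lemma poly_alg_0 [simp]: "poly_alg h 0 = 0"
  by (simp add: poly_alg_def)

lemma poly_alg_pCons [simp]: "poly_alg h (pCons c p) = c *\<^sub>C 1 + h * poly_alg h p"
  by (cases "c = 0 \<and> p = 0") (auto simp: poly_alg_def)

lemma poly_alg_add: "poly_alg h (p + q) = poly_alg h p + poly_alg h q"
  by (induction p q rule: poly_induct2) (simp_all add: algebra_simps scaleC_algebra)

lemma poly_alg_smult: "poly_alg h (smult c p) = c *\<^sub>C poly_alg h p"
  by (induction p) (simp_all add: scaleC_algebra)

lemma poly_alg_diff: "poly_alg h (p - q) = poly_alg h p - poly_alg h q"
  using poly_alg_add[of h p "smult (-1) q"] by (simp add: poly_alg_smult[of h "-1" q, unfolded smult_minus_left smult_1_left] scaleC_algebra)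

lemma poly_alg_mult: "poly_alg h (p * q) = poly_alg h p * poly_alg h q"
  by (induction p) (simp_all add: poly_alg_add poly_alg_smult algebra_simps)

lemma poly_alg_commute: "y * h = h * y \<Longrightarrow> poly_alg h p * y = y * poly_alg h p"
proof (induction p)
  case (pCons c p)
  then have "h * poly_alg h p * y = y * (h * poly_alg h p)" by (metis mult.assoc)
  then show ?case by (simp add: algebra_simps)
qed simp

lemma poly_alg_invertible:
  assumes "\<And>z. z \<in> spectrum h \<Longrightarrow> poly p z \<noteq> 0"
  shows "invertible_element (poly_alg h p)"
  using assms
proof (induction "degree p" arbitrary: p rule: less_induct)
  case less
  show ?case
  proof (cases "degree p = 0")
    case True
    then obtain c where p: "p = [:c:]" by (metis degree_eq_zeroE)
    \<comment> \<open>The constant \<open>c\<close> is attained as a value of \<open>p\<close> on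
      the spectrum because the spectrum is nonempty.\<close>
    with less.prems spectrum_nonempty[of h] have "c \<noteq> 0" by auto
    then show ?thesis using p invertible_scaleC[of c 1] by simp
  next
    case False
    then obtain r where "poly p r = 0"
      using fundamental_theorem_of_algebra_alt[of p] False by (metis degree_pCons_0)
    then obtain q where p: "p = [:- r, 1:] * q" by (metis poly_eq_0_iff_dvd dvdE)
    with False have "q \<noteq> 0" by auto
    then have "degree q < degree p" unfolding p by (subst degree_mult_eq) auto
    then have "invertible_element (poly_alg h q)"
      by (rule less.hyps) (use less.prems in \<open>simp add: p\<close>)
    moreover have "r \<notin> spectrum h" using less.prems[of r] by (auto simp: p)
    then have "invertible_element (poly_alg h [:- r, 1:])"
      by (simp add: not_spectrum_iff scaleC_algebra)
    ultimately show ?thesis unfolding p poly_alg_mult by (intro invertible_mult)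
  qed
qed

lemma spectrum_poly_alg: "spectrum (poly_alg h p) = poly p ` spectrum h"
proof (intro equalityI subsetI)
  fix z assume z: "z \<in> spectrum (poly_alg h p)"
  show "z \<in> poly p ` spectrum h"
  proof (rule ccontr)
    assume "z \<notin> poly p ` spectrum h"
    then have "invertible_element (poly_alg h (p - [:z:]))" by (intro poly_alg_invertible) auto
    with z show False by (simp add: poly_alg_diff spectrum_def)
  qed
next
  fix z assume "z \<in> poly p ` spectrum h"
  then obtain s where s: "s \<in> spectrum h" "z = poly p s" by auto
  have "poly (p - [:z:]) s = 0" using s by simp
  then obtain q where q: "p - [:z:] = [:- s, 1:] * q" by (metis poly_eq_0_iff_dvd dvdE)
  have hs: "poly_alg h [:- s, 1:] = h - s *\<^sub>C 1" by (simp add: scaleC_algebra)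
  have "poly_alg h p - z *\<^sub>C 1 = poly_alg h (p - [:z:])" by (simp add: poly_alg_diff)
  then have e: "poly_alg h p - z *\<^sub>C 1 = (h - s *\<^sub>C 1) * poly_alg h q"
    unfolding q poly_alg_mult hs .
  have "(h - s *\<^sub>C 1) * poly_alg h q = poly_alg h q * (h - s *\<^sub>C 1)"
    using poly_alg_mult[of h q "[:- s, 1:]"] poly_alg_mult[of h "[:- s, 1:]" q] unfolding hs
    by (simp only: mult.commute)
  from invertible_commuting_factor[OF this] s(1) show "z \<in> spectrum (poly_alg h p)"
    unfolding spectrum_def mem_Collect_eq e by auto
qed

lemma star_poly_alg: "star h = h \<Longrightarrow> star (poly_alg h p) = poly_alg h (map_poly cnj p)"
proof (induction p)
  case (pCons c p)
  then show ?case
    using poly_alg_commute[of h h "map_poly cnj p"]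
    by (simp add: map_poly_pCons star_add star_scaleC star_mult)
qed simp

lemma poly_map_cnj_of_real: "poly (map_poly cnj p) (complex_of_real s) = cnj (poly p (complex_of_real s))"
  by simp

text \<open>The C*-identity reduces the claim to the self-adjoint element given by
  \<open>map_poly cnj p * p\<close>, whose norm is governed by its spectrum and hence by the values
  of \<open>p\<close> on \<open>rspec h\<close>. This estimate is what lets polynomials extend to
  continuous functions.\<close>

lemma norm_poly_alg_le:
  fixes h :: "'a::cstar_algebra_1"
  assumes h: "star h = h" and B: "B \<ge> 0" "\<And>s. s \<in> rspec h \<Longrightarrow> cmod (poly p (of_real s)) \<le> B"
  shows "norm (poly_alg h p) \<le> B"
proof -
  let ?q = "map_poly cnj p * p"
  have e: "star (poly_alg h p) * poly_alg h p = poly_alg h ?q"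
    by (simp add: star_poly_alg[OF h] poly_alg_mult)
  have "norm (poly_alg h ?q) \<le> B\<^sup>2"
  proof (rule norm_selfadjoint_le_spectrum)
    show "star (poly_alg h ?q) = poly_alg h ?q" unfolding e[symmetric] by (simp add: star_mult)
    fix z assume "z \<in> spectrum (poly_alg h ?q)"
    then obtain s where "s \<in> rspec h" "z = poly ?q (of_real s)"
      unfolding spectrum_poly_alg spectrum_eq_rspec[OF h] by auto
    then show "cmod z \<le> B\<^sup>2" using B
      by (simp add: poly_map_cnj_of_real norm_mult power2_eq_square mult_mono)
  qed simp
  then have "(norm (poly_alg h p))\<^sup>2 \<le> B\<^sup>2" by (simp flip: e norm_star_mult)
  then show ?thesis using B(1) by (rule power2_le_imp_le)
qed

lemma complex_poly_of_real_polynomial_function: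
  "real_polynomial_function g \<Longrightarrow> \<exists>p. \<forall>x. poly p (complex_of_real x) = of_real (g x)"
proof (induction rule: real_polynomial_function.induct)
  case (linear f)
  then interpret bounded_linear f .
  have f: "f x = x * f 1" for x using scaleR[of x 1] by simp
  show ?case
  proof (intro exI allI)
    fix x show "poly [:0, of_real (f 1):] (complex_of_real x) = of_real (f x)"
      unfolding f[of x] by simp
  qed
next
  case (const c)
  show ?case by (intro exI[of _ "[:of_real c:]"]) simp
next
  case (add f g)
  then obtain p q where "\<forall>x. poly p (complex_of_real x) = of_real (f x)"
    "\<forall>x. poly q (complex_of_real x) = of_real (g x)" by blast
  then show ?case by (intro exI[of _ "p + q"]) simp
next
  case (mult f g)
  then obtain p q where "\<forall>x. poly p (complex_of_real x) = of_real (f x)"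
    "\<forall>x. poly q (complex_of_real x) = of_real (g x)" by blast
  then show ?case by (intro exI[of _ "p * q"]) simp
qed

section \<open>Continuous functional calculus on the real spectrum\<close>

lemma complex_polynomial_approximation:
  fixes f :: "real \<Rightarrow> complex"
  assumes S: "compact S" and f: "continuous_on S f"
  obtains p where "uniform_limit S (\<lambda>n s. poly (p n) (of_real s)) f sequentially"
proof -
  have "\<exists>p. \<forall>s\<in>S. cmod (poly p (of_real s) - f s) < inverse (real (Suc n))" for n
  proof -
    let ?e = "inverse (real (Suc n)) / 2"
    have e: "?e > 0" by simp
    have "continuous_on S (\<lambda>s. Re (f s))" by (intro continuous_intros f)
    then obtain g1 where g1: "real_polynomial_function g1" "\<And>s. s \<in> S \<Longrightarrow> \<bar>Re (f s) - g1 s\<bar> < ?e"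
      using Stone_Weierstrass_real_polynomial_function[OF S _ e] by blast
    have "continuous_on S (\<lambda>s. Im (f s))" by (intro continuous_intros f)
    then obtain g2 where g2: "real_polynomial_function g2" "\<And>s. s \<in> S \<Longrightarrow> \<bar>Im (f s) - g2 s\<bar> < ?e"
      using Stone_Weierstrass_real_polynomial_function[OF S _ e] by blast
    obtain p1 p2 where p: "\<And>x. poly p1 (complex_of_real x) = of_real (g1 x)"
      "\<And>x. poly p2 (complex_of_real x) = of_real (g2 x)"
      using complex_poly_of_real_polynomial_function[OF g1(1)] complex_poly_of_real_polynomial_function[OF g2(1)] by blast
    have "cmod (poly (p1 + smult \<i> p2) (of_real s) - f s) < inverse (real (Suc n))" if "s \<in> S" for s
    proof -
      let ?z = "poly (p1 + smult \<i> p2) (of_real s) - f s"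
      have "cmod ?z \<le> \<bar>Re ?z\<bar> + \<bar>Im ?z\<bar>" by (rule cmod_le)
      also have "\<dots> = \<bar>g1 s - Re (f s)\<bar> + \<bar>g2 s - Im (f s)\<bar>" by (simp add: p)
      also have "\<dots> < ?e + ?e" using g1(2)[OF that] g2(2)[OF that] by (intro add_strict_mono) (simp_all only: abs_minus_commute)
      finally show ?thesis by simp
    qed
    then show ?thesis by blast
  qed
  then obtain p where p: "\<And>n s. s \<in> S \<Longrightarrow> cmod (poly (p n) (of_real s) - f s) < inverse (real (Suc n))"
    by metis
  have "uniform_limit S (\<lambda>n s. poly (p n) (of_real s)) f sequentially"
  proof (rule uniform_limitI)
    fix e :: real assume "e > 0"
    then have "\<forall>\<^sub>F n in sequentially. inverse (real (Suc n)) < e"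
      by (intro order_tendstoD[OF LIMSEQ_inverse_real_of_nat])
    then show "\<forall>\<^sub>F n in sequentially. \<forall>x\<in>S. dist (poly (p n) (of_real x)) (f x) < e"
      by eventually_elim (auto simp: dist_norm intro: less_trans[OF p])
  qed
  then show ?thesis by (rule that)
qed

text \<open>For self-adjoint \<open>h\<close> and \<open>f\<close> continuous on
  \<open>rspec h\<close>, approximating polynomials exist and every choice of them gives the same
  limit, by \<open>cfc_LIMSEQ\<close>; the value is meaningful in that case.\<close>

definition cfc :: "'a::cstar_algebra_1 \<Rightarrow> (real \<Rightarrow> complex) \<Rightarrow> 'a" where
  "cfc h f = lim (\<lambda>n. poly_alg h ((SOME p. uniform_limit (rspec h) (\<lambda>n s. poly (p n) (of_real s)) f sequentially) n))"

lemma poly_alg_uniform_limit_diff: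
  fixes h :: "'a::cstar_algebra_1"
  assumes h: "star h = h" and e: "e > 0"
    and p: "\<forall>s\<in>rspec h. dist (poly p (of_real s)) (f s) < e"
    and q: "\<forall>s\<in>rspec h. dist (poly q (of_real s)) (f s) < e"
  shows "norm (poly_alg h p - poly_alg h q) \<le> 2 * e"
  unfolding poly_alg_diff[symmetric]
proof (rule norm_poly_alg_le[OF h])
  fix s assume s: "s \<in> rspec h"
  have "cmod (poly (p - q) (of_real s)) = dist (poly p (of_real s)) (poly q (of_real s))"
    by (simp add: dist_norm)
  also have "\<dots> \<le> dist (poly p (of_real s)) (f s) + dist (poly q (of_real s)) (f s)"
    by (rule dist_triangle2)
  also have "\<dots> \<le> 2 * e" using p q s by fastforce
  finally show "cmod (poly (p - q) (of_real s)) \<le> 2 * e" .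
qed (use e in simp)

lemma cfc_LIMSEQ:
  fixes h :: "'a::cstar_algebra_1"
  assumes h: "star h = h"
    and p: "uniform_limit (rspec h) (\<lambda>n s. poly (p n) (of_real s)) f sequentially"
  shows "(\<lambda>n. poly_alg h (p n)) \<longlonglongrightarrow> cfc h f"
proof -
  define q where "q = (SOME p. uniform_limit (rspec h) (\<lambda>n s. poly (p n) (complex_of_real s)) f sequentially)"
  have q: "uniform_limit (rspec h) (\<lambda>n s. poly (q n) (of_real s)) f sequentially"
    unfolding q_def by (rule someI[of _ p]) (rule p)
  have "Cauchy (\<lambda>n. poly_alg h (q n))"
  proof (rule metric_CauchyI)
    fix e :: real assume e: "e > 0"
    obtain N where N: "\<And>n. n \<ge> N \<Longrightarrow> \<forall>s\<in>rspec h. dist (poly (q n) (of_real s)) (f s) < e/3"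
      using uniform_limitD[OF q, of "e/3"] e unfolding eventually_sequentially by auto
    show "\<exists>M. \<forall>m\<ge>M. \<forall>n\<ge>M. dist (poly_alg h (q m)) (poly_alg h (q n)) < e"
    proof (intro exI allI impI)
      fix m n assume "m \<ge> N" "n \<ge> N"
      from poly_alg_uniform_limit_diff[OF h _ N[OF this(1)] N[OF this(2)]] e
      show "dist (poly_alg h (q m)) (poly_alg h (q n)) < e" by (simp add: dist_norm)
    qed
  qed
  then have lq: "(\<lambda>n. poly_alg h (q n)) \<longlonglongrightarrow> cfc h f"
    unfolding cfc_def q_def[symmetric] using Cauchy_convergent_iff convergent_LIMSEQ_iff by blast
  have "(\<lambda>n. poly_alg h (p n) - poly_alg h (q n)) \<longlonglongrightarrow> 0"
  proof (rule tendstoI)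
    fix e :: real assume e: "e > 0"
    then have "e/3 > 0" by simp
    from uniform_limitD[OF p this] uniform_limitD[OF q this]
    show "\<forall>\<^sub>F n in sequentially. dist (poly_alg h (p n) - poly_alg h (q n)) 0 < e"
    proof eventually_elim
      case (elim n)
      from poly_alg_uniform_limit_diff[OF h _ elim] e show ?case by simp
    qed
  qed
  from tendsto_add[OF this lq] show ?thesis by simp
qed

lemma cfc_approximation:
  fixes h :: "'a::cstar_algebra_1"
  assumes h: "star h = h" and f: "continuous_on (rspec h) f"
  obtains p where "uniform_limit (rspec h) (\<lambda>n s. poly (p n) (of_real s)) f sequentially"
    and "(\<lambda>n. poly_alg h (p n)) \<longlonglongrightarrow> cfc h f"
  using complex_polynomial_approximation[OF compact_rspec f] cfc_LIMSEQ[OF h] by metis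

lemma bounded_image_rspec: "continuous_on (rspec h) f \<Longrightarrow> bounded (f ` rspec h)"
  by (intro compact_imp_bounded compact_continuous_image compact_rspec)

lemma cfc_poly:
  fixes h :: "'a::cstar_algebra_1"
  assumes h: "star h = h"
  shows "cfc h (\<lambda>s. poly p (of_real s)) = poly_alg h p"
  using cfc_LIMSEQ[OF h, of "\<lambda>n. p" "\<lambda>s. poly p (of_real s)"]
  by (auto intro: LIMSEQ_unique simp: uniform_limit_const)

lemma cfc_const: "star h = h \<Longrightarrow> cfc h (\<lambda>s. c) = c *\<^sub>C 1"
  using cfc_poly[of h "[:c:]"] by simp

lemma cfc_id: "star h = h \<Longrightarrow> cfc h complex_of_real = h"
  using cfc_poly[of h "[:0, 1:]"] by simp

lemma cfc_cong: 
  assumes "\<And>s. s \<in> rspec h \<Longrightarrow> f s = g s"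
  shows "cfc h f = cfc h g"
proof -
  have "uniform_limit (rspec h) (\<lambda>n s. poly (p n) (of_real s)) f sequentially \<longleftrightarrow>
    uniform_limit (rspec h) (\<lambda>n s. poly (p n) (of_real s)) g sequentially" for p :: "nat \<Rightarrow> complex poly"
    using assms by (intro uniform_limit_cong') auto
  then show ?thesis unfolding cfc_def by simp
qed

lemma cfc_add:
  fixes h :: "'a::cstar_algebra_1"
  assumes h: "star h = h" and "continuous_on (rspec h) f" "continuous_on (rspec h) g"
  shows "cfc h (\<lambda>s. f s + g s) = cfc h f + cfc h g"
proof -
  obtain p where p: "uniform_limit (rspec h) (\<lambda>n s. poly (p n) (of_real s)) f sequentially"
    "(\<lambda>n. poly_alg h (p n)) \<longlonglongrightarrow> cfc h f" using cfc_approximation assms by blast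
  obtain q where q: "uniform_limit (rspec h) (\<lambda>n s. poly (q n) (of_real s)) g sequentially"
    "(\<lambda>n. poly_alg h (q n)) \<longlonglongrightarrow> cfc h g" using cfc_approximation assms by blast
  have "uniform_limit (rspec h) (\<lambda>n s. poly (p n + q n) (of_real s)) (\<lambda>s. f s + g s) sequentially"
    using uniform_limit_add[OF p(1) q(1)] by simp
  from cfc_LIMSEQ[OF h this] have "(\<lambda>n. poly_alg h (p n) + poly_alg h (q n)) \<longlonglongrightarrow> cfc h (\<lambda>s. f s + g s)"
    by (simp add: poly_alg_add)
  then show ?thesis using tendsto_add[OF p(2) q(2)] by (rule LIMSEQ_unique)
qed

lemma cfc_mult:
  fixes h :: "'a::cstar_algebra_1"
  assumes h: "star h = h" and "continuous_on (rspec h) f" "continuous_on (rspec h) g"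
  shows "cfc h (\<lambda>s. f s * g s) = cfc h f * cfc h g"
proof -
  obtain p where p: "uniform_limit (rspec h) (\<lambda>n s. poly (p n) (of_real s)) f sequentially"
    "(\<lambda>n. poly_alg h (p n)) \<longlonglongrightarrow> cfc h f" using cfc_approximation assms by blast
  obtain q where q: "uniform_limit (rspec h) (\<lambda>n s. poly (q n) (of_real s)) g sequentially"
    "(\<lambda>n. poly_alg h (q n)) \<longlonglongrightarrow> cfc h g" using cfc_approximation assms by blast
  have "uniform_limit (rspec h) (\<lambda>n s. poly (p n * q n) (of_real s)) (\<lambda>s. f s * g s) sequentially"
    using uniform_lim_mult[OF p(1) q(1)] assms by (simp add: bounded_image_rspec)
  from cfc_LIMSEQ[OF h this] have "(\<lambda>n. poly_alg h (p n) * poly_alg h (q n)) \<longlonglongrightarrow> cfc h (\<lambda>s. f s * g s)"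
    by (simp add: poly_alg_mult)
  then show ?thesis using tendsto_mult[OF p(2) q(2)] by (rule LIMSEQ_unique)
qed

lemma star_cfc:
  fixes h :: "'a::cstar_algebra_1"
  assumes h: "star h = h" and "continuous_on (rspec h) f"
  shows "star (cfc h f) = cfc h (\<lambda>s. cnj (f s))"
proof -
  obtain p where p: "uniform_limit (rspec h) (\<lambda>n s. poly (p n) (of_real s)) f sequentially"
    "(\<lambda>n. poly_alg h (p n)) \<longlonglongrightarrow> cfc h f" using cfc_approximation assms by blast
  have "uniform_limit (rspec h) (\<lambda>n s. cnj (poly (p n) (of_real s))) (\<lambda>s. cnj (f s)) sequentially"
    by (rule bounded_linear.uniform_limit[OF bounded_linear_cnj p(1)])
  then have "uniform_limit (rspec h) (\<lambda>n s. poly (map_poly cnj (p n)) (of_real s)) (\<lambda>s. cnj (f s)) sequentially"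
    by (simp only: poly_map_cnj_of_real)
  from cfc_LIMSEQ[OF h this] have "(\<lambda>n. star (poly_alg h (p n))) \<longlonglongrightarrow> cfc h (\<lambda>s. cnj (f s))"
    by (simp add: star_poly_alg[OF h])
  then show ?thesis using LIMSEQ_unique tendsto_star[OF p(2)] by blast
qed

lemma cfc_commute:
  fixes h :: "'a::cstar_algebra_1"
  assumes h: "star h = h" and "continuous_on (rspec h) f" and y: "y * h = h * y"
  shows "cfc h f * y = y * cfc h f"
proof -
  obtain p where "(\<lambda>n. poly_alg h (p n)) \<longlonglongrightarrow> cfc h f" using cfc_approximation assms by blast
  then show ?thesis by (rule commute_lim) (rule poly_alg_commute[OF y])
qed

text \<open>Noninvertible elements form a closed set, and by spectral mapping the approximants
  \<open>poly_alg h (p n)\<close> minus their values at \<open>s\<close> all belong to it.\<close>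

lemma cfc_spectrum:
  fixes h :: "'a::cstar_algebra_1"
  assumes h: "star h = h" and "continuous_on (rspec h) f" and s: "s \<in> rspec h"
  shows "f s \<in> spectrum (cfc h f)"
proof -
  obtain p where p: "uniform_limit (rspec h) (\<lambda>n s. poly (p n) (of_real s)) f sequentially"
    "(\<lambda>n. poly_alg h (p n)) \<longlonglongrightarrow> cfc h f" using cfc_approximation assms by blast
  have "(\<lambda>n. poly_alg h (p n) - poly (p n) (of_real s) *\<^sub>C 1) \<longlonglongrightarrow> cfc h f - f s *\<^sub>C 1"
    by (intro tendsto_intros p(2) tendsto_uniform_limitI[OF p(1) s])
  moreover have "\<not> invertible_element (poly_alg h (p n) - poly (p n) (of_real s) *\<^sub>C 1)" for n
    using s spectrum_poly_alg[of h "p n"] unfolding spectrum_def rspec_def by blast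
  moreover have "closed {x::'a. \<not> invertible_element x}"
    using open_invertible by (simp add: closed_def Collect_neg_eq)
  ultimately have "\<not> invertible_element (cfc h f - f s *\<^sub>C 1)"
    using closed_sequentially by (smt (verit, best) mem_Collect_eq)
  then show ?thesis by (simp add: spectrum_def)
qed

lemma norm_cfc_le:
  fixes h :: "'a::cstar_algebra_1"
  assumes h: "star h = h" and f: "continuous_on (rspec h) f"
    and B: "B \<ge> 0" "\<And>s. s \<in> rspec h \<Longrightarrow> cmod (f s) \<le> B"
  shows "norm (cfc h f) \<le> B"
proof (rule field_le_epsilon)
  fix e :: real assume e: "e > 0"
  obtain p where p: "uniform_limit (rspec h) (\<lambda>n s. poly (p n) (of_real s)) f sequentially"
    "(\<lambda>n. poly_alg h (p n)) \<longlonglongrightarrow> cfc h f" using cfc_approximation[OF h f] .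
  have "\<forall>\<^sub>F n in sequentially. norm (poly_alg h (p n)) \<le> B + e"
    using uniform_limitD[OF p(1) e]
  proof eventually_elim
    case (elim n)
    show ?case
    proof (rule norm_poly_alg_le[OF h])
      fix s assume s: "s \<in> rspec h"
      then show "cmod (poly (p n) (of_real s)) \<le> B + e"
        using elim B(2)[OF s] norm_triangle_ineq[of "poly (p n) (of_real s) - f s" "f s"]
        by (fastforce simp: dist_norm)
    qed (use B e in simp)
  qed
  then show "norm (cfc h f) \<le> B + e"
    using tendsto_upperbound[OF tendsto_norm[OF p(2)]] by simp
qed

section \<open>Projections in the null space\<close>

text \<open>Infinitely many points of a compact set at distance at least \<open>r\<close> from 0
  accumulate at such a point, which would be a nonzero element of \<open>acc K\<close>.\<close>

lemma finite_spectrum_away_from_0: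
  fixes K :: "complex set"
  assumes K: "compact K" "acc K \<subseteq> {0}" and r: "r > 0"
  shows "finite {z \<in> K. r \<le> cmod z}"
proof (rule ccontr)
  let ?S = "{z \<in> K. r \<le> cmod z}"
  assume inf: "infinite ?S"
  have "compact (K \<inter> {z. r \<le> cmod z})"
    by (intro compact_Int_closed K closed_Collect_le continuous_intros)
  then have "compact ?S" by (simp add: Int_def)
  then obtain z where z: "z \<in> ?S" "z islimpt ?S"
    using inf unfolding compact_eq_Bolzano_Weierstrass by blast
  then have "z islimpt K" by (auto intro: islimpt_subset)
  then have "z \<in> acc K" using z(1) by (auto simp: acc_def iso_def isolated_in_islimpt_iff)
  with K(2) z(1) r show False by auto
qed

definition projection :: "'a::cstar_algebra_1 \<Rightarrow> bool" where
  "projection p \<longleftrightarrow> star p = p \<and> p * p = p"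

lemma norm_projection_le: "projection p \<Longrightarrow> norm p \<le> 1"
  using norm_star_mult[of p]
  by (cases "norm p = 0") (auto simp: projection_def power2_eq_square)

lemma projection_diff:
  assumes "projection p" "projection q" "p * q = q"
  shows "projection (p - q)" "q * p = q"
proof -
  show qp: "q * p = q" using assms star_mult[of p q] by (simp add: projection_def)
  then show "projection (p - q)" using assms by (simp add: projection_def star_diff algebra_simps)
qed

lemma spectrum_zero [simp]: "spectrum (0::'a::complex_banach_algebra_1) = {0}"
proof -
  have "invertible_element (- (z *\<^sub>C (1::'a))) \<longleftrightarrow> z \<noteq> 0" for z
  proof (cases "z = 0")
    case True
    then show ?thesis by (simp add: invertible_element_def)
  qed (simp add: invertible_scaleC)
  then show ?thesis by (auto simp: spectrum_def)
qed

section \<open>The null space under the Riesz property\<close>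

locale riesz_hom =
  fixes T :: "'a::cstar_algebra_1 \<Rightarrow> 'b::complex_banach_algebra_1"
  assumes bounded_hom: "bounded_algebra_hom T"
    and riesz_property: "Riesz_property T"
begin

lemma T_add: "T (x + y) = T x + T y"
  and T_scaleC: "T (z *\<^sub>C x) = z *\<^sub>C T x"
  and T_mult: "T (x * y) = T x * T y"
  and T_one [simp]: "T 1 = 1"
  using bounded_hom by (simp_all add: bounded_algebra_hom_def algebra_hom_def)

lemma T_zero [simp]: "T 0 = 0"
  using T_scaleC[of 0 0] by simp

lemma T_diff: "T (x - y) = T x - T y"
  using T_add[of x "(-1) *\<^sub>C y"] unfolding T_scaleC by (simp add: scaleC_minus_left)

lemma T_power: "T (x ^ n) = T x ^ n"
  by (induction n) (simp_all add: T_mult)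

lemma bounded_linear_T: "bounded_linear T"
proof -
  obtain K where "\<And>x. norm (T x) \<le> K * norm x"
    using bounded_hom by (auto simp: bounded_algebra_hom_def)
  then show ?thesis
    by (intro bounded_linear_intro[where K = K]) (simp_all add: T_add T_scaleC scaleR_eq_scaleC mult.commute)
qed

lemma T_invertible:
  assumes "invertible_element x"
  shows "invertible_element (T x)" "T (ainv x) = ainv (T x)"
proof -
  have *: "T x * T (ainv x) = 1" "T (ainv x) * T x = 1"
    using assms by (simp_all flip: T_mult)
  show "invertible_element (T x)" by (rule invertible_elementI[OF *])
  show "T (ainv x) = ainv (T x)" by (rule ainv_unique[OF *, symmetric])
qed

lemma spectrum_T: "spectrum (T x) \<subseteq> spectrum x"
  using T_invertible(1)[of "x - _ *\<^sub>C 1"] by (auto simp: spectrum_def T_diff T_scaleC)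

lemma finite_spectrum_null: "T y = 0 \<Longrightarrow> r > 0 \<Longrightarrow> finite {z \<in> spectrum y. r \<le> cmod z}"
  using riesz_property
  by (intro finite_spectrum_away_from_0 compact_spectrum) (auto simp: Riesz_property_def null_space_def)

text \<open>With \<open>k = (h\<^sup>2 - s)\<^sub>+\<close> one has \<open>h\<^sup>2 k = k\<^sup>2 + s k\<close>, hence \<open>k = k (h\<^sup>2 w)\<^sup>N\<close> for all \<open>N\<close>
  where \<open>w = (s + k)\<^sup>-\<^sup>1\<close> has norm at most \<open>1/s\<close>; applying \<open>T\<close> makes the right-hand side tend to 0.\<close>

lemma T_cutoff:
  assumes h: "star h = h" and s: "(norm (T h))\<^sup>2 < s"
  shows "T (cfc h (\<lambda>u. of_real (max 0 (u\<^sup>2 - s)))) = 0"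
proof -
  have s0: "s > 0" using s zero_le_power2[of "norm (T h)"] by linarith
  define k where "k = cfc h (\<lambda>u. of_real (max 0 (u\<^sup>2 - s)))"
  define w where "w = cfc h (\<lambda>u. of_real (1 / (s + max 0 (u\<^sup>2 - s))))"
  have pos: "s + max 0 (u\<^sup>2 - s) \<noteq> 0" for u using s0 max.cobounded1[of 0 "u\<^sup>2 - s"] by linarith
  have cw: "continuous_on (rspec h) (\<lambda>u. complex_of_real (1 / (s + max 0 (u\<^sup>2 - s))))"
    by (intro continuous_intros ballI pos)
  have ck: "continuous_on (rspec h) (\<lambda>u. complex_of_real (max 0 (u\<^sup>2 - s)))"
    by (intro continuous_intros)
  have cid: "continuous_on (rspec h) complex_of_real" by (intro continuous_intros)
  note cm = continuous_on_mult
  have "k * (h * h * w) = cfc h (\<lambda>u. of_real (max 0 (u\<^sup>2 - s)) *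
     (of_real u * of_real u * of_real (1 / (s + max 0 (u\<^sup>2 - s)))))"
    by (simp only: cfc_mult[OF h] cm cw ck cid k_def w_def cfc_id[OF h])
  also have "\<dots> = k"
    unfolding k_def
  proof (rule cfc_cong)
    fix u :: real
    have "max 0 (u\<^sup>2 - s) * (u * u * (1 / (s + max 0 (u\<^sup>2 - s)))) = max 0 (u\<^sup>2 - s)"
      using s0 by (cases "u = 0") (auto simp: max_def power2_eq_square)
    then show "complex_of_real (max 0 (u\<^sup>2 - s)) * (of_real u * of_real u * of_real (1 / (s + max 0 (u\<^sup>2 - s))))
      = of_real (max 0 (u\<^sup>2 - s))" by (simp only: flip: of_real_mult)
  qed
  finally have kw: "k * (h * h * w) = k" .
  have wh: "w * h = h * w" unfolding w_def by (rule cfc_commute[OF h cw]) simp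
  have kN: "k = k * ((h * h) ^ N * w ^ N)" for N
  proof (induction N)
    case (Suc N)
    have wN: "w * (h * h) ^ N = (h * h) ^ N * w"
      by (rule commute_power[symmetric]) (rule commute_mult[OF wh[symmetric] wh[symmetric]])
    have "k * ((h * h) ^ Suc N * w ^ Suc N) = k * (h * h) * ((h * h) ^ N * w) * w ^ N"
      by (simp only: power_Suc mult.assoc)
    then have "k * ((h * h) ^ Suc N * w ^ Suc N) = k * (h * h * w) * ((h * h) ^ N * w ^ N)"
      by (simp only: mult.assoc flip: wN)
    with Suc kw show ?case by simp
  qed simp
  obtain K where K: "K > 0" "\<And>x. norm (T x) \<le> norm x * K"
    using bounded_linear.pos_bounded[OF bounded_linear_T] by auto
  have nw: "norm w \<le> 1 / s"
    unfolding w_def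
  proof (rule norm_cfc_le[OF h cw])
    fix u show "cmod (of_real (1 / (s + max 0 (u\<^sup>2 - s)))) \<le> 1 / s"
      using s0 max.cobounded1[of 0 "u\<^sup>2 - s"] unfolding norm_of_real by (simp add: frac_le del: max.cobounded1)
  qed (use s0 in simp)
  have *: "norm (T k) \<le> norm (T k) * (((norm (T h))\<^sup>2 / s) ^ N * K)" for N
  proof -
    have "T k = T k * ((T h * T h) ^ N * T (w ^ N))"
      using arg_cong[OF kN[of N], of T] by (simp add: T_mult T_power)
    then have "norm (T k) = norm (T k * ((T h * T h) ^ N * T (w ^ N)))" by (rule arg_cong)
    also have "\<dots> \<le> norm (T k) * (norm ((T h * T h) ^ N) * norm (T (w ^ N)))"
      by (rule order_trans[OF norm_mult_ineq mult_left_mono[OF norm_mult_ineq norm_ge_zero]])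
    also have "\<dots> \<le> norm (T k) * (((norm (T h))\<^sup>2) ^ N * ((1 / s) ^ N * K))"
    proof (intro mult_left_mono mult_mono)
      show "norm ((T h * T h) ^ N) \<le> ((norm (T h))\<^sup>2) ^ N"
        by (rule order_trans[OF norm_power_ineq power_mono])
          (use norm_mult_ineq[of "T h" "T h"] in \<open>simp_all add: power2_eq_square\<close>)
      have "norm (w ^ N) \<le> (1 / s) ^ N"
        by (rule order_trans[OF norm_power_ineq power_mono[OF nw]]) simp
      then show "norm (T (w ^ N)) \<le> (1 / s) ^ N * K"
        using K(1) by (intro order_trans[OF K(2)] mult_right_mono) auto
    qed auto
    finally show ?thesis by (simp add: power_divide)
  qed
  have "(\<lambda>N. norm (T k) * (((norm (T h))\<^sup>2 / s) ^ N * K)) \<longlonglongrightarrow> 0"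
    by (intro tendsto_mult_right_zero tendsto_mult_left_zero LIMSEQ_power_zero) (use s s0 in simp)
  then have "norm (T k) \<le> 0" by (rule LIMSEQ_le_const) (use * in auto)
  then show ?thesis by (simp add: k_def)
qed

text \<open>Where \<open>F\<close> is nonzero on the spectrum, the cutoff \<open>?k\<close> is at
  least \<open>r - s\<close>, so \<open>F\<close> is a continuous multiple of \<open>?k\<close> and
  inherits its vanishing under \<open>T\<close>. The \<open>max\<close> in the denominator of
  \<open>?g\<close> keeps the quotient continuous where \<open>?k\<close> vanishes.\<close>

lemma T_cfc_eq_0:
  assumes h: "star h = h" and s: "(norm (T h))\<^sup>2 < s" and r: "s < r"
    and F: "continuous_on (rspec h) F" "\<And>u. u \<in> rspec h \<Longrightarrow> u\<^sup>2 < r \<Longrightarrow> F u = 0"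
  shows "T (cfc h F) = 0"
proof -
  let ?k = "\<lambda>u::real. complex_of_real (max 0 (u\<^sup>2 - s))"
  let ?g = "\<lambda>u. F u * of_real (1 / max (r - s) (u\<^sup>2 - s))"
  have pos: "max (r - s) (u\<^sup>2 - s) \<noteq> 0" for u using r by (simp add: max_def)
  have ck: "continuous_on (rspec h) ?k" and cg: "continuous_on (rspec h) ?g"
    by (intro continuous_intros F ballI pos)+
  have "cfc h F = cfc h (\<lambda>u. ?k u * ?g u)"
  proof (rule cfc_cong)
    fix u assume u: "u \<in> rspec h"
    show "F u = ?k u * ?g u"
    proof (cases "u\<^sup>2 < r")
      case False
      then have "max 0 (u\<^sup>2 - s) * (1 / max (r - s) (u\<^sup>2 - s)) = 1" using r by (auto simp: max_def)
      then have "?k u * of_real (1 / max (r - s) (u\<^sup>2 - s)) = 1" by (simp only: flip: of_real_mult) simp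
      then show ?thesis by (simp add: mult.left_commute)
    qed (use F u in auto)
  qed
  also have "\<dots> = cfc h ?k * cfc h ?g" by (rule cfc_mult[OF h ck cg])
  finally show ?thesis using T_cutoff[OF h s] by (simp add: T_mult)
qed

text \<open>\<open>p\<close> is the spectral projection of \<open>star x * x\<close> for large
  spectral values; the remainder \<open>(1 - p) * (star x * x) * (1 - p)\<close> has norm at most
  \<open>e\<close>. A continuous function can produce \<open>p\<close> because the cutoff sends the
  squares of the large spectral values into the spectrum of an element of the null space, where the
  Riesz property leaves only finitely many and hence a gap.\<close>

lemma approximating_projection:
  assumes e: "norm (T (star x * x)) < e"
  shows "\<exists>p. projection p \<and> T p = 0 \<and> (norm (x - x * p))\<^sup>2 \<le> e"
proof -
  let ?h = "star x * x"
  have h: "star ?h = ?h" by (simp add: star_mult)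
  have e0: "e > 0" using e norm_ge_zero[of "T ?h"] by linarith
  have "(norm (T ?h))\<^sup>2 < e\<^sup>2" using e by (intro power_strict_mono) auto
  then obtain s where s: "(norm (T ?h))\<^sup>2 < s" "s < e\<^sup>2" using dense by blast
  then obtain r where r: "s < r" "r < e\<^sup>2" using dense by blast
  let ?k = "\<lambda>u::real. complex_of_real (max 0 (u\<^sup>2 - s))"
  have ck: "continuous_on (rspec ?h) ?k" by (intro continuous_intros)
  let ?V = "(\<lambda>u. u\<^sup>2) ` {u \<in> rspec ?h. r \<le> u\<^sup>2}"
  have "?V \<subseteq> (\<lambda>z. Re z + s) ` {z \<in> spectrum (cfc ?h ?k). r - s \<le> cmod z}"
  proof
    fix v assume "v \<in> ?V"
    then obtain u where u: "u \<in> rspec ?h" "r \<le> u\<^sup>2" "v = u\<^sup>2" by auto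
    have m: "max 0 (u\<^sup>2 - s) = u\<^sup>2 - s" using u r by simp
    have "?k u \<in> spectrum (cfc ?h ?k)" by (rule cfc_spectrum[OF h ck u(1)])
    moreover have "r - s \<le> cmod (?k u)" unfolding norm_of_real m using u by linarith
    moreover have "v = Re (?k u) + s" unfolding Re_complex_of_real m using u by simp
    ultimately show "v \<in> (\<lambda>z. Re z + s) ` {z \<in> spectrum (cfc ?h ?k). r - s \<le> cmod z}" by blast
  qed
  then have fin: "finite ?V"
    by (rule finite_subset) (intro finite_imageI finite_spectrum_null T_cutoff h s(1), use r in simp)
  have "infinite {r<..<e\<^sup>2}" using r by simp
  then have "infinite ({r<..<e\<^sup>2} - ?V)" by (rule Diff_infinite_finite[OF fin])
  then obtain c where c: "c \<in> {r<..<e\<^sup>2} - ?V" using finite.emptyI by (metis ex_in_conv)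
  have "open ({r<..<e\<^sup>2} - ?V)" by (intro open_Diff finite_imp_closed fin) simp
  then obtain d where d: "d > 0" "ball c d \<subseteq> {r<..<e\<^sup>2} - ?V" using c openE by blast
  define \<alpha> where "\<alpha> = c - d/2"
  define \<beta> where "\<beta> = c + d/2"
  have in_ball: "t \<in> {r<..<e\<^sup>2} - ?V" if "\<alpha> \<le> t" "t \<le> \<beta>" for t
    using that d by (intro subsetD[OF d(2)]) (auto simp: \<alpha>_def \<beta>_def dist_real_def)
  have ab: "r < \<alpha>" "\<alpha> < \<beta>" "\<beta> < e\<^sup>2"
    using in_ball[of \<alpha>] in_ball[of \<beta>] d(1) by (auto simp: \<alpha>_def \<beta>_def)
  \<comment> \<open>The ramp from 0 to 1 lies inside the gap, so \<open>F\<close> takes only the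
    values 0 and 1 on the spectrum. The argument \<open>u\<^sup>2\<close> treats spectral values of
    either sign alike.\<close>
  define F where "F u = max 0 (min 1 ((u\<^sup>2 - \<alpha>) / (\<beta> - \<alpha>)))" for u :: real
  let ?F = "\<lambda>u. complex_of_real (F u)"
  have F: "u\<^sup>2 < \<alpha> \<and> F u = 0 \<or> \<beta> < u\<^sup>2 \<and> F u = 1" if "u \<in> rspec ?h" for u
  proof -
    have "u\<^sup>2 < \<alpha> \<or> \<beta> < u\<^sup>2" using that in_ball[of "u\<^sup>2"] ab by force
    then show ?thesis using ab by (auto simp: F_def max_def min_def divide_simps)
  qed
  have cF: "continuous_on (rspec ?h) ?F"
    unfolding F_def using ab by (intro continuous_intros) auto
  define p where "p = cfc ?h ?F"
  have "star p = p" unfolding p_def star_cfc[OF h cF] by simp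
  moreover have "p * p = p"
    unfolding p_def cfc_mult[OF h cF cF, symmetric] by (rule cfc_cong) (use F in fastforce)
  ultimately have p: "projection p" by (simp add: projection_def)
  have Tp: "T p = 0"
    unfolding p_def using F ab by (intro T_cfc_eq_0[OF h s(1) r(1) cF]) force
  have cc: "continuous_on (rspec ?h) (\<lambda>u. c :: complex)" for c by (intro continuous_intros)
  have c1: "continuous_on (rspec ?h) (\<lambda>u. 1 + (-1) * ?F u)" by (intro continuous_intros cF)
  have q: "1 - p = cfc ?h (\<lambda>u. 1 + (-1) * ?F u)"
    unfolding p_def cfc_add[OF h cc continuous_on_mult[OF cc cF]] cfc_mult[OF h cc cF] cfc_const[OF h]
    by (simp add: scaleC_minus_left)
  have cid: "continuous_on (rspec ?h) complex_of_real" by (intro continuous_intros)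
  have "star (1 - p) = 1 - p" using p by (simp add: projection_def star_diff)
  then have "star (x - x * p) * (x - x * p) = (1 - p) * ?h * (1 - p)"
    by (simp add: star_mult star_diff algebra_simps projection_def)
  also have "\<dots> = cfc ?h (\<lambda>u. (1 + (-1) * ?F u) * of_real u * (1 + (-1) * ?F u))"
    unfolding q by (simp only: cfc_mult[OF h] continuous_on_mult c1 cid cfc_id[OF h])
  also have "norm \<dots> \<le> e"
  proof (rule norm_cfc_le[OF h])
    show "continuous_on (rspec ?h) (\<lambda>u. (1 + (-1) * ?F u) * of_real u * (1 + (-1) * ?F u))"
      by (intro continuous_intros cF)
    fix u assume "u \<in> rspec ?h"
    from F[OF this] show "cmod ((1 + (-1) * ?F u) * of_real u * (1 + (-1) * ?F u)) \<le> e"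
    proof
      assume u: "u\<^sup>2 < \<alpha> \<and> F u = 0"
      then have "\<bar>u\<bar>\<^sup>2 \<le> e\<^sup>2" using ab by simp
      then have "\<bar>u\<bar> \<le> e" using e0 by (intro power2_le_imp_le[of "\<bar>u\<bar>" e]) auto
      then show ?thesis using u by simp
    qed (use e0 in simp)
  qed (use e0 in simp)
  finally have "(norm (x - x * p))\<^sup>2 \<le> e" by (simp add: norm_star_mult)
  with p Tp show ?thesis by blast
qed

text \<open>The Riesz property isolates the nonzero spectral value \<open>s\<close>, so a narrow hat
  function at \<open>s\<close> acts as an indicator on the spectrum. The factorizations through
  \<open>k\<close> keep \<open>P\<close> inside every corner that contains \<open>y\<close>.\<close>

lemma spectral_projection:
  assumes y: "star y = y" "T y = 0" and s: "s \<in> rspec y" "s \<noteq> 0"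
  obtains P k where "projection P" "P \<noteq> 0" "P = y * k" "P = k * y" "y * P = s *\<^sub>R P"
proof -
  have "finite {z \<in> spectrum y. \<bar>s\<bar>/2 \<le> cmod z}" using s(2) by (intro finite_spectrum_null y) simp
  then have fin: "finite (Re ` {z \<in> spectrum y. \<bar>s\<bar>/2 \<le> cmod z} - {s})" by simp
  then have "open (- (Re ` {z \<in> spectrum y. \<bar>s\<bar>/2 \<le> cmod z} - {s}))"
    using finite_imp_closed open_Compl by blast
  then obtain d' where d': "d' > 0" "ball s d' \<subseteq> - (Re ` {z \<in> spectrum y. \<bar>s\<bar>/2 \<le> cmod z} - {s})"
    by (rule openE[of _ s]) auto
  \<comment> \<open>The second bound forces points this close to \<open>s\<close> to have modulus at
    least half that of \<open>s\<close>, so that they fall into the finite set.\<close>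
  define d where "d = min d' (\<bar>s\<bar>/2)"
  have d: "d > 0" using d' s by (simp add: d_def)
  have far: "d \<le> \<bar>u - s\<bar>" if u: "u \<in> rspec y" "u \<noteq> s" for u
  proof (rule ccontr)
    assume "\<not> d \<le> \<bar>u - s\<bar>"
    moreover have "d \<le> d'" "d \<le> \<bar>s\<bar>/2" by (simp_all add: d_def)
    ultimately have "u \<in> ball s d'" "\<bar>u - s\<bar> < \<bar>s\<bar>/2" by (auto simp: dist_real_def)
    moreover from this have "\<bar>s\<bar>/2 \<le> \<bar>u\<bar>" by linarith
    then have "u \<in> Re ` {z \<in> spectrum y. \<bar>s\<bar>/2 \<le> cmod z}"
      using u(1) by (intro image_eqI[of _ _ "of_real u"]) (auto simp: rspec_def)
    ultimately show False using d' u by auto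
  qed
  define F where "F u = max 0 (1 - \<bar>u - s\<bar> / d)" for u :: real
  have F: "F s = 1" "\<And>u. u \<in> rspec y \<Longrightarrow> u \<noteq> s \<Longrightarrow> F u = 0"
  proof -
    fix u assume "u \<in> rspec y" "u \<noteq> s"
    then have "1 \<le> \<bar>u - s\<bar> / d" using far d by simp
    then show "F u = 0" by (simp add: F_def)
  qed (simp add: F_def)
  let ?F = "\<lambda>u. complex_of_real (F u)"
  have cF: "continuous_on (rspec y) ?F" unfolding F_def using d by (intro continuous_intros) auto
  have cid: "continuous_on (rspec y) complex_of_real" by (intro continuous_intros)
  have cc: "continuous_on (rspec y) (\<lambda>u. c :: complex)" for c by (intro continuous_intros)
  define P where "P = cfc y ?F"
  define k where "k = inverse (of_real s) *\<^sub>C P"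
  have "star P = P" unfolding P_def star_cfc[OF y(1) cF] by simp
  moreover have "P * P = P"
    unfolding P_def cfc_mult[OF y(1) cF cF, symmetric] by (rule cfc_cong) (use F in force)
  ultimately have P: "projection P" by (simp add: projection_def)
  have "y * P = cfc y (\<lambda>u. of_real u * ?F u)" unfolding P_def cfc_mult[OF y(1) cid cF] cfc_id[OF y(1)] ..
  also have "\<dots> = cfc y (\<lambda>u. of_real s * ?F u)" by (rule cfc_cong) (use F in force)
  also have "\<dots> = s *\<^sub>R P"
    unfolding P_def cfc_mult[OF y(1) cc cF] cfc_const[OF y(1)] by (simp add: scaleR_eq_scaleC)
  finally have yP: "y * P = s *\<^sub>R P" .
  have Py: "P * y = y * P" unfolding P_def by (rule cfc_commute[OF y(1) cF]) simp
  have "P \<noteq> 0"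
  proof
    assume "P = 0"
    moreover have "1 \<in> spectrum P" using cfc_spectrum[OF y(1) cF s(1)] F(1) by (simp add: P_def)
    ultimately show False by simp
  qed
  moreover have "P = y * k" "P = k * y"
    unfolding k_def mult_scaleC_left mult_scaleC_right Py yP using s(2) by (simp_all add: scaleR_eq_scaleC)
  ultimately show ?thesis using that[OF P _ _ _ yP] by blast
qed

lemma exists_nonzero_rspec:
  assumes "star y = y" "y \<noteq> (0::'a)"
  shows "\<exists>s\<in>rspec y. s \<noteq> 0"
proof (rule ccontr)
  assume "\<not> ?thesis"
  then have "z \<in> spectrum y \<Longrightarrow> cmod z \<le> 0" for z
    unfolding spectrum_eq_rspec[OF assms(1)] by auto
  then have "norm y \<le> 0" by (intro norm_selfadjoint_le_spectrum assms) auto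
  with assms show False by simp
qed

section \<open>Minimal projections and their finite sums\<close>

definition minimal_projection :: "'a \<Rightarrow> bool" where
  "minimal_projection q \<longleftrightarrow> projection q \<and> T q = 0 \<and> q \<noteq> 0 \<and>
     (\<forall>P. projection P \<and> P \<noteq> 0 \<and> q * P = P \<longrightarrow> P = q)"

text \<open>A nonzero spectral value \<open>s\<close> of a self-adjoint \<open>q * y * q\<close>
  gives a nonzero projection below \<open>q\<close>; minimality makes it \<open>q\<close>, so the
  element is \<open>s\<close> times \<open>q\<close>. Real and imaginary parts give the general
  case. In this sense \<open>q\<close> has rank one.\<close>

lemma minimal_projection_corner:
  assumes q: "minimal_projection q"
  shows "\<exists>c. q * x * q = c *\<^sub>C q"
proof -
  have q': "star q = q" "q * q = q" "T q = 0"
    using q by (auto simp: minimal_projection_def projection_def)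
  have sa: "\<exists>c. q * y * q = c *\<^sub>C q" if y: "star y = y" for y
  proof (cases "q * y * q = 0")
    case True
    then show ?thesis by (intro exI[of _ 0]) simp
  next
    case False
    let ?y = "q * y * q"
    have 1: "star ?y = ?y" "T ?y = 0" using y q' by (simp_all add: star_mult T_mult mult.assoc)
    obtain s where s: "s \<in> rspec ?y" "s \<noteq> 0" using exists_nonzero_rspec[OF 1(1) False] by blast
    obtain P k where P: "projection P" "P \<noteq> 0" "P = ?y * k" "P = k * ?y" "?y * P = s *\<^sub>R P"
      using spectral_projection[OF 1 s] by blast
    have "q * P = P" unfolding P(3) using q' by (simp flip: mult.assoc)
    then have "P = q" using q P by (auto simp: minimal_projection_def)
    then have "?y * q = s *\<^sub>R q" using P(5) by simp
    then show ?thesis using q' by (intro exI[of _ "of_real s"]) (simp add: mult.assoc scaleR_eq_scaleC)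
  qed
  obtain c1 where c1: "q * (x + star x) * q = c1 *\<^sub>C q"
    using sa[of "x + star x"] by (auto simp: star_add add.commute)
  obtain c2 where c2: "q * (\<i> *\<^sub>C (x - star x)) * q = c2 *\<^sub>C q"
    using sa[of "\<i> *\<^sub>C (x - star x)"] by (auto simp: star_diff star_scaleC scaleC_algebra)
  have "(1/2) *\<^sub>C (q * (x + star x) * q) - (\<i>/2) *\<^sub>C (q * (\<i> *\<^sub>C (x - star x)) * q)
     = (1/2 + 1/2) *\<^sub>C (q * x * q)"
    unfolding scaleC_add_left by (simp add: algebra_simps scaleC_algebra)
  then have "q * x * q = (c1/2 - \<i> * c2/2) *\<^sub>C q" unfolding c1 c2 by (simp add: scaleC_algebra)
  then show ?thesis by blast
qed

text \<open>With lists, adding two such elements is concatenation, and the later perturbation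
  argument is an induction that adds one summand at a time.\<close>

definition minimal_sum :: "'a \<Rightarrow> bool" where
  "minimal_sum p \<longleftrightarrow> (\<exists>qs. (\<forall>q\<in>set qs. minimal_projection q) \<and> p = sum_list qs)"

lemma minimal_sum_add: "minimal_sum p \<Longrightarrow> minimal_sum q \<Longrightarrow> minimal_sum (p + q)"
  unfolding minimal_sum_def by (metis UnE set_append sum_list_append)

text \<open>Otherwise there is an infinite sequence of nonzero orthogonal projections \<open>d\<^sub>n\<close> below \<open>p\<close>, and
  \<open>p + \<Sum> 2\<^sup>-\<^sup>n d\<^sub>n\<close> violates the Riesz property.\<close>

lemma projection_minimal_sum:
  assumes p: "projection p" "T p = 0"
  shows "minimal_sum p"
proof (rule ccontr)
  assume np: "\<not> minimal_sum p"
  let ?P = "\<lambda>p. projection p \<and> T p = 0 \<and> \<not> minimal_sum p"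
  \<comment> \<open>A nonminimal \<open>x\<close> splits as \<open>q + (x - q)\<close>. If both
    parts were finite sums of minimal projections, so would be \<open>x\<close>; hence one of them
    is a smaller counterexample.\<close>
  have step: "\<exists>y. ?P y \<and> x * y = y \<and> y \<noteq> x" if x: "?P x" for x
  proof -
    have "minimal_sum 0" by (auto simp: minimal_sum_def intro!: exI[of _ "[]"])
    then have "x \<noteq> 0" using x by auto
    have "\<not> minimal_projection x"
    proof
      assume "minimal_projection x"
      then have "minimal_sum x" unfolding minimal_sum_def by (intro exI[of _ "[x]"]) simp
      with x show False by simp
    qed
    then obtain q where q: "projection q" "q \<noteq> 0" "x * q = q" "q \<noteq> x"
      using x \<open>x \<noteq> 0\<close> by (auto simp: minimal_projection_def)
    have "T q = T x * T q" using q(3) by (simp flip: T_mult)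
    then have Tq: "T q = 0" using x by simp
    have "minimal_sum q \<Longrightarrow> minimal_sum (x - q) \<Longrightarrow> minimal_sum x"
      using minimal_sum_add[of q "x - q"] by simp
    then consider "\<not> minimal_sum q" | "\<not> minimal_sum (x - q)" using x by blast
    then show ?thesis
    proof cases
      case 1
      then show ?thesis using q Tq by blast
    next
      case 2
      moreover have "x * (x - q) = x - q" using x q by (simp add: projection_def right_diff_distrib)
      ultimately show ?thesis using x q Tq projection_diff(1)[of x q]
        by (intro exI[of _ "x - q"]) (simp add: T_diff)
    qed
  qed
  have "\<exists>f. \<forall>n. ?P (f n) \<and> (f n * f (Suc n) = f (Suc n) \<and> f (Suc n) \<noteq> f n)"
    by (rule dependent_nat_choice) (use p np step in \<open>blast+\<close>)
  then obtain f where f: "\<And>n. projection (f n)" "\<And>n. T (f n) = 0" "\<And>n. f n * f (Suc n) = f (Suc n)"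
    "\<And>n. f (Suc n) \<noteq> f n" by blast
  have ff: "f n * f n = f n" for n using f(1) by (simp add: projection_def)
  have le: "f m * f (m + k) = f (m + k)" for m k
  proof (induction k)
    case (Suc k)
    have "f m * f (m + Suc k) = f m * (f (m + k) * f (Suc (m + k)))" by (simp only: f add_Suc_right)
    also have "\<dots> = f m * f (m + k) * f (Suc (m + k))" by (simp only: mult.assoc)
    also have "\<dots> = f (m + Suc k)" by (simp only: Suc f add_Suc_right)
    finally show ?case .
  qed (simp add: ff)
  then have le: "f m * f n = f n" if "m \<le> n" for m n using that by (metis le_add_diff_inverse)
  define d where "d n = f n - f (Suc n)" for n
  have d: "projection (d n)" "d n \<noteq> 0" for n
    unfolding d_def using projection_diff(1)[OF f(1) f(1) f(3)] f(4)[of n] by auto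
  have dd: "d n * d n = d n" for n using d(1) by (simp add: projection_def)
  have orth1: "d m * d n = 0" if "m < n" for m n
  proof -
    have "d m * f k = 0" if "m < k" for k
      using le[of m k] le[of "Suc m" k] that by (simp add: d_def left_diff_distrib)
    then show ?thesis using that by (simp add: d_def[of n] right_diff_distrib)
  qed
  have orth: "d m * d n = 0" if "m \<noteq> n" for m n
  proof (cases "m < n")
    case False
    then have "d n * d m = 0" using that by (intro orth1) simp
    then have "star (d n * d m) = 0" by simp
    then show ?thesis using d(1) by (simp add: star_mult projection_def)
  qed (rule orth1)
  let ?g = "\<lambda>n. (1/2) ^ n *\<^sub>R d n"
  have sm: "summable ?g"
  proof (rule summable_comparison_test')
    show "summable (\<lambda>n. (1/2::real) ^ n)" by (rule summable_geometric) simp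
    fix n :: nat assume "n \<ge> 0"
    have "norm (?g n) = (1/2) ^ n * norm (d n)" by simp
    also have "\<dots> \<le> (1/2) ^ n * 1" by (intro mult_left_mono norm_projection_le d) simp
    finally show "norm (?g n) \<le> (1/2) ^ n" by simp
  qed
  \<comment> \<open>\<open>f 0\<close> is a left unit for every \<open>d n\<close> and moves the
    eigenvalues from \<open>(1/2) ^ n\<close> to \<open>1 + (1/2) ^ n\<close>. They then accumulate
    at 1, whereas the Riesz property would tolerate accumulation at 0.\<close>
  define y where "y = f 0 + suminf ?g"
  have "T (suminf ?g) = (\<Sum>n. T (?g n))" by (rule bounded_linear.suminf[OF bounded_linear_T sm])
  also have "\<dots> = 0" by (simp add: scaleR_eq_scaleC T_scaleC d_def T_diff f)
  finally have Ty: "T y = 0" by (simp add: y_def T_add f)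
  have yd: "y * d n = complex_of_real (1 + (1/2) ^ n) *\<^sub>C d n" for n
  proof -
    have "suminf ?g * d n = (\<Sum>m. ?g m * d n)" by (rule suminf_mult2[OF sm])
    also have "\<dots> = (\<Sum>m. if m = n then ?g n else 0)"
      by (intro arg_cong[of _ _ suminf] ext) (auto simp: orth dd)
    also have "\<dots> = ?g n" using sums_single[of n "\<lambda>_. ?g n"] sums_unique by force
    finally have "suminf ?g * d n = ?g n" .
    moreover have "f 0 * d n = d n" by (simp add: d_def right_diff_distrib le)
    ultimately show ?thesis by (simp add: y_def distrib_right of_real_add scaleC_add_left scaleR_eq_scaleC)
  qed
  have "complex_of_real (1 + (1/2) ^ n) \<in> spectrum y" for n
  proof (rule ccontr)
    assume "complex_of_real (1 + (1/2) ^ n) \<notin> spectrum y"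
    then have i: "invertible_element (y - complex_of_real (1 + (1/2) ^ n) *\<^sub>C 1)" by (simp only: not_spectrum_iff)
    have "(y - complex_of_real (1 + (1/2) ^ n) *\<^sub>C 1) * d n = 0"
      by (simp only: left_diff_distrib yd mult_scaleC_left mult_1_left) simp
    with ainv_cancel(1)[OF i, of "d n"] d(2)[of n] show False by simp
  qed
  then have "range (\<lambda>n. complex_of_real (1 + (1/2) ^ n)) \<subseteq> {z \<in> spectrum y. 1 \<le> cmod z}"
    by (auto simp only: norm_of_real) simp
  moreover have "infinite (range (\<lambda>n. complex_of_real (1 + (1/2) ^ n)))"
  proof (intro range_inj_infinite injI)
    fix m n :: nat
    assume "complex_of_real (1 + (1/2) ^ m) = complex_of_real (1 + (1/2) ^ n)"
    then have "(1/2::real) ^ m = (1/2) ^ n" by (simp only: of_real_eq_iff add_left_cancel)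
    then show "m = n" by (simp add: power_one_over)
  qed
  ultimately show False using finite_spectrum_null[OF Ty, of 1] finite_subset by auto
qed

end

section \<open>Countability of the spectrum\<close>

context riesz_hom
begin

text \<open>\<open>y + zq - \<mu> = (y - \<mu>)(1 + (y - \<mu>)\<^sup>-\<^sup>1 z q)\<close> is invertible unless the scalar analytic function
  \<open>1 + \<phi>(\<mu>)\<close> vanishes, where \<open>q (y - \<mu>)\<^sup>-\<^sup>1 z q = \<phi>(\<mu>) q\<close>.\<close>

lemma countable_spectrum_rank_one:
  fixes y z q :: 'a
  assumes q: "minimal_projection q" and c: "countable {\<mu> \<in> spectrum y. r < cmod \<mu>}"
  shows "countable {\<mu> \<in> spectrum (y + z * q). r < cmod \<mu>}"
proof -
  have q': "q * q = q" "q \<noteq> 0" "norm q \<le> 1"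
    using q norm_projection_le by (auto simp: minimal_projection_def projection_def)
  \<comment> \<open>The corner of \<open>q\<close> is scalar, so \<open>tr\<close> is a bounded
    linear functional, and through it one scalar function governs the perturbation by
    \<open>z * q\<close>.\<close>
  define tr where "tr x = (SOME c. q * x * q = c *\<^sub>C q)" for x
  have tr: "q * x * q = tr x *\<^sub>C q" for x
    unfolding tr_def by (rule someI_ex[OF minimal_projection_corner[OF q]])
  have tr_unique: "tr x = c" if "q * x * q = c *\<^sub>C q" for x c
  proof -
    have "(tr x - c) *\<^sub>C q = 0" using that tr[of x] by (simp add: scaleC_diff_left)
    then show ?thesis using q'(2) by (simp add: scaleC_eq_0_iff)
  qed
  have tr_scaleC: "tr (c *\<^sub>C x) = c * tr x" for c x
    by (rule tr_unique) (simp add: tr)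
  have tr_add: "tr (x + x') = tr x + tr x'" for x x'
    by (rule tr_unique) (simp add: distrib_left distrib_right tr scaleC_add_left)
  have "norm (tr x) \<le> norm x * 1" for x
  proof -
    have "cmod (tr x) * norm q = norm (q * x * q)" by (simp add: tr)
    also have "\<dots> \<le> norm q * norm x * norm q"
      by (rule order_trans[OF norm_mult_ineq mult_right_mono[OF norm_mult_ineq norm_ge_zero]])
    also have "\<dots> \<le> 1 * norm x * norm q" using q'(3) by (intro mult_right_mono) auto
    finally show ?thesis using q'(2) by simp
  qed
  then have "bounded_linear tr"
    by (intro bounded_linear_intro[where K = 1]) (simp_all add: tr_add tr_scaleC scaleR_eq_scaleC scaleR_conv_of_real)
  note tr_lim = bounded_linear.tendsto[OF this]
  have tr_diff: "tr (x - x') = tr x - tr x'" for x x'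
    using bounded_linear.linear[OF \<open>bounded_linear tr\<close>] by (rule linear_diff)
  define U where "U = - cball 0 r - {\<mu> \<in> spectrum y. r < cmod \<mu>}"
  have U: "\<mu> \<in> U \<longleftrightarrow> r < cmod \<mu> \<and> \<mu> \<notin> spectrum y" for \<mu> by (auto simp: U_def)
  define R where "R \<mu> = ainv (y - \<mu> *\<^sub>C 1)" for \<mu>
  define \<phi> where "\<phi> \<mu> = tr (R \<mu> * z)" for \<mu>
  have "U = - cball 0 r \<inter> - spectrum y" by (auto simp: U)
  then have oU: "open U" by (auto intro: closed_spectrum)
  have "connected (- cball (0::complex) r)"
    by (rule connected_complement_bounded_convex) auto
  then have cU: "connected U"
    unfolding U_def by (intro connected_open_diff_countable c) auto
  have fU: "fsigma U"
    using open_Union_compact_subsets[OF oU] unfolding fsigma_Union_compact by (metis image_subsetI mem_Collect_eq)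
  have inv: "invertible_element (y - \<mu> *\<^sub>C 1)" if "\<mu> \<in> U" for \<mu>
    using that by (simp add: U not_spectrum_iff)
  have "(\<phi> has_field_derivative tr (R \<mu> * R \<mu> * z)) (at \<mu>)" if \<mu>: "\<mu> \<in> U" for \<mu>
    unfolding has_field_derivative_iff
  proof (rule Lim_transform_eventually)
    have "isCont (\<lambda>\<nu>. y - \<nu> *\<^sub>C 1) \<mu>"
      unfolding isCont_def by (intro tendsto_intros)
    from isCont_o2[OF this isCont_ainv[OF inv[OF \<mu>]]]
    have "(R \<longlongrightarrow> R \<mu>) (at \<mu>)" unfolding R_def[abs_def] isCont_def .
    then show "((\<lambda>\<nu>. tr (R \<nu> * R \<mu> * z)) \<longlongrightarrow> tr (R \<mu> * R \<mu> * z)) (at \<mu>)"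
      by (intro tr_lim tendsto_intros)
    have "\<forall>\<^sub>F \<nu> in at \<mu>. \<nu> \<in> U" using oU \<mu> by (rule eventually_at_in_open')
    moreover have "\<forall>\<^sub>F \<nu> in at \<mu>. \<nu> \<noteq> \<mu>" by (simp add: eventually_at_filter)
    ultimately show "\<forall>\<^sub>F \<nu> in at \<mu>. tr (R \<nu> * R \<mu> * z) = (\<phi> \<nu> - \<phi> \<mu>) / (\<nu> - \<mu>)"
    proof eventually_elim
      case (elim \<nu>)
      have "R \<nu> - R \<mu> = R \<nu> * ((y - \<mu> *\<^sub>C 1) - (y - \<nu> *\<^sub>C 1)) * R \<mu>"
        unfolding R_def by (rule ainv_diff[OF inv[OF \<mu>] inv[OF elim(1)]])
      also have "(y - \<mu> *\<^sub>C 1) - (y - \<nu> *\<^sub>C 1) = (\<nu> - \<mu>) *\<^sub>C 1" by (simp add: scaleC_diff_left)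
      finally have "R \<nu> * z - R \<mu> * z = (\<nu> - \<mu>) *\<^sub>C (R \<nu> * R \<mu> * z)"
        by (simp flip: left_diff_distrib)
      then have "\<phi> \<nu> - \<phi> \<mu> = (\<nu> - \<mu>) * tr (R \<nu> * R \<mu> * z)"
        unfolding \<phi>_def by (simp flip: tr_diff tr_scaleC)
      then show ?case using elim(2) by simp
    qed
  qed
  then have hol: "(\<lambda>\<mu>. 1 + \<phi> \<mu>) holomorphic_on U"
    by (intro holomorphic_intros) (auto simp: holomorphic_on_open[OF oU])
  have fact: "y + z * q - \<mu> *\<^sub>C 1 = (y - \<mu> *\<^sub>C 1) * (1 + R \<mu> * z * q)" if "\<mu> \<in> U" for \<mu>
    using inv[OF that] unfolding R_def by (simp add: distrib_left mult.assoc ainv_cancel)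
  have zero: "1 + \<phi> \<mu> = 0" if \<mu>: "\<mu> \<in> spectrum (y + z * q)" "\<mu> \<in> U" for \<mu>
  proof (rule ccontr)
    assume nz: "1 + \<phi> \<mu> \<noteq> 0"
    let ?w = "R \<mu> * z"
    have qwq: "q * ?w * q = \<phi> \<mu> *\<^sub>C q" using tr[of ?w] by (simp add: \<phi>_def)
    \<comment> \<open>\<open>?w * q\<close> squares to \<open>\<phi> \<mu>\<close> times itself, so
      \<open>1 + ?w * q\<close> is inverted like a rank-one perturbation of the identity
      matrix.\<close>
    let ?c = "inverse (1 + \<phi> \<mu>)"
    have wqwq: "?w * q * (?w * q) = \<phi> \<mu> *\<^sub>C (?w * q)"
      using arg_cong[OF qwq, of "\<lambda>u. ?w * u"] by (simp add: mult.assoc)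
    have "1 - ?c - ?c * \<phi> \<mu> = 0" using nz by (simp add: field_simps)
    then have z0: "?w * q - ?c *\<^sub>C (?w * q) - ?c *\<^sub>C (\<phi> \<mu> *\<^sub>C (?w * q)) = 0"
      by (metis scaleC_diff_left scaleC_one scaleC_scaleC scaleC_zero_left)
    have "(1 + ?w * q) * (1 - ?c *\<^sub>C (?w * q)) = 1" "(1 - ?c *\<^sub>C (?w * q)) * (1 + ?w * q) = 1"
      using z0 wqwq by (simp_all only: distrib_left distrib_right left_diff_distrib right_diff_distrib
          mult_scaleC_left mult_scaleC_right mult_1_left mult_1_right) (simp_all add: algebra_simps scaleC_algebra)
    then have "invertible_element (1 + ?w * q)" by (rule invertible_elementI)
    then have "invertible_element (y + z * q - \<mu> *\<^sub>C 1)"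
      unfolding fact[OF \<mu>(2)] by (rule invertible_mult[OF inv[OF \<mu>(2)]])
    with \<mu>(1) show False by (simp add: spectrum_def)
  qed
  \<comment> \<open>A point beyond both norms and beyond \<open>r\<close> lies in \<open>U\<close>
    and outside both spectra. There \<open>1 + R \<nu> * z * q\<close> is invertible, so
    \<open>1 + \<phi>\<close> is not identically zero.\<close>
  define \<nu> where "\<nu> = complex_of_real (norm y + norm (y + z * q) + \<bar>r\<bar> + 1)"
  have cn: "cmod \<nu> = norm y + norm (y + z * q) + \<bar>r\<bar> + 1"
    unfolding \<nu>_def norm_of_real by (intro abs_of_nonneg add_nonneg_nonneg) auto
  have "\<nu> \<notin> spectrum y" "\<nu> \<notin> spectrum (y + z * q)"
    using spectrum_norm_le[of \<nu> y] spectrum_norm_le[of \<nu> "y + z * q"] cn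
      norm_ge_zero[of y] norm_ge_zero[of "y + z * q"] by linarith+
  then have \<nu>: "\<nu> \<in> U" "invertible_element (y + z * q - \<nu> *\<^sub>C 1)"
    using cn norm_ge_zero[of y] norm_ge_zero[of "y + z * q"] abs_ge_self[of r]
    unfolding U not_spectrum_iff by linarith+
  have "1 + \<phi> \<nu> \<noteq> 0"
  proof
    assume 0: "1 + \<phi> \<nu> = 0"
    let ?w = "R \<nu> * z"
    have "1 + ?w * q = R \<nu> * (y + z * q - \<nu> *\<^sub>C 1)"
      unfolding fact[OF \<nu>(1)] R_def using inv[OF \<nu>(1)] by (simp add: ainv_cancel)
    then have i: "invertible_element (1 + ?w * q)"
      unfolding R_def using invertible_mult[OF invertible_ainv[OF inv[OF \<nu>(1)]] \<nu>(2)] by simp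
    have "q * ?w * q = \<phi> \<nu> *\<^sub>C q" using tr[of ?w] by (simp add: \<phi>_def)
    then have "q * (1 + ?w * q) = (1 + \<phi> \<nu>) *\<^sub>C q"
      by (simp add: distrib_left scaleC_add_left mult.assoc)
    then have "q * (1 + ?w * q) * ainv (1 + ?w * q) = 0" using 0 by simp
    then show False using i q'(2) by (simp add: mult.assoc)
  qed
  then have "\<not> (\<lambda>\<mu>. 1 + \<phi> \<mu>) constant_on U \<or> (\<forall>\<mu>\<in>U. 1 + \<phi> \<mu> \<noteq> 0)"
    using \<nu>(1) unfolding constant_on_def by metis
  then have "countable {\<mu> \<in> U. 1 + \<phi> \<mu> = 0}"
  proof
    assume "\<not> (\<lambda>\<mu>. 1 + \<phi> \<mu>) constant_on U"
    from holomorphic_countable_zeros[OF hol oU cU fU this] show ?thesis by simp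
  next
    assume "\<forall>\<mu>\<in>U. 1 + \<phi> \<mu> \<noteq> 0"
    then have "{\<mu> \<in> U. 1 + \<phi> \<mu> = 0} = {}" by blast
    then show ?thesis by (simp only: countable_empty)
  qed
  with c have "countable ({\<mu> \<in> spectrum y. r < cmod \<mu>} \<union> {\<mu> \<in> U. 1 + \<phi> \<mu> = 0})" by simp
  moreover have "{\<mu> \<in> spectrum (y + z * q). r < cmod \<mu>} \<subseteq> {\<mu> \<in> spectrum y. r < cmod \<mu>} \<union> {\<mu> \<in> U. 1 + \<phi> \<mu> = 0}"
    using zero by (auto simp: U)
  ultimately show ?thesis by (rule countable_subset[rotated])
qed

lemma countable_spectrum_minimal_sum:
  assumes p: "minimal_sum p" and c: "countable {\<mu> \<in> spectrum y. r < cmod \<mu>}"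
  shows "countable {\<mu> \<in> spectrum (y + z * p). r < cmod \<mu>}"
proof -
  obtain qs where qs: "\<forall>q\<in>set qs. minimal_projection q" "p = sum_list qs"
    using p by (auto simp: minimal_sum_def)
  have "countable {\<mu> \<in> spectrum (y + z * sum_list qs). r < cmod \<mu>}"
    using qs(1)
  proof (induction qs)
    case (Cons q qs)
    then have "countable {\<mu> \<in> spectrum (y + z * sum_list qs). r < cmod \<mu>}" "minimal_projection q" by auto
    from countable_spectrum_rank_one[OF this(2,1), of z]
    show ?case by (simp add: distrib_left add_ac)
  qed (use c in simp)
  then show ?thesis by (simp add: qs(2))
qed

lemma spectrum_power_mem:
  assumes "z \<in> spectrum (x::'c::complex_banach_algebra_1)"
  shows "z ^ n \<in> spectrum (x ^ n)"
proof -
  obtain s where s: "x ^ n - z ^ n *\<^sub>C 1 = (x - z *\<^sub>C 1) * s" "s * x = x * s"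
    using power_diff_scalar by blast
  have "(x - z *\<^sub>C 1) * s = s * (x - z *\<^sub>C 1)" by (rule commute_diff_scalar[OF s(2), symmetric])
  from invertible_commuting_factor[OF this] assms s(1) show ?thesis
    by (auto simp: spectrum_def)
qed

text \<open>Some power of \<open>a\<close> is within \<open>\<epsilon>\<^sup>N\<close> of an element \<open>a\<^sup>N p\<close> with \<open>p\<close> a finite sum of minimal
  projections.\<close>

lemma countable_spectrum_away_from_0:
  assumes a: "spectrum (T a) \<subseteq> {0}" and e: "e > 0"
  shows "countable {z \<in> spectrum a. e < cmod z}"
proof -
  obtain K where K: "K > 0" "\<And>x. norm (T x) \<le> norm x * K"
    using bounded_linear.pos_bounded[OF bounded_linear_T] by auto
  \<comment> \<open>In \<open>T (star ?b * ?b)\<close> only the factor \<open>T ?b\<close> is small,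
    while \<open>star ?b\<close> may contribute \<open>K * norm ?b\<close>. The weight
    \<open>t\<close> compensates this growth and leaves exactly the bound
    \<open>(e ^ N)\<^sup>2\<close>.\<close>
  define t where "t = (norm a + 1) / e\<^sup>2"
  have "(\<lambda>n. t ^ n * norm (T a ^ n)) \<longlonglongrightarrow> 0" by (rule spectrum_subset_0_powers[OF a])
  then have "\<forall>\<^sub>F n in sequentially. t ^ n * norm (T a ^ n) < 1 / K"
    by (rule order_tendstoD) (use K in simp)
  then have "\<forall>\<^sub>F n in sequentially. t ^ n * norm (T a ^ n) < 1 / K \<and> n > 0"
    using eventually_gt_at_top by (rule eventually_conj)
  from eventually_happens[OF this] obtain N where N: "t ^ N * norm (T a ^ N) < 1 / K" "N > 0" by auto
  let ?b = "a ^ N"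
  have "norm (T (star ?b * ?b)) \<le> norm (T (star ?b)) * norm (T ?b)" unfolding T_mult by (rule norm_mult_ineq)
  also have "\<dots> \<le> (norm ?b * K) * norm (T ?b)"
    using K(2)[of "star ?b"] by (intro mult_right_mono) auto
  also have "\<dots> \<le> ((norm a + 1) ^ N * K) * norm (T ?b)"
    using K(1) by (intro mult_right_mono order_trans[OF norm_power_ineq power_mono]) auto
  also have "\<dots> = K * (e\<^sup>2) ^ N * (t ^ N * norm (T a ^ N))"
    using e by (simp add: t_def power_divide T_power)
  also have "\<dots> < K * (e\<^sup>2) ^ N * (1 / K)" using N(1) K(1) e by (intro mult_strict_left_mono) auto
  also have "\<dots> = (e ^ N)\<^sup>2" using K(1) by (simp add: mult.commute flip: power_mult)
  finally obtain p where p: "projection p" "T p = 0" "(norm (?b - ?b * p))\<^sup>2 \<le> (e ^ N)\<^sup>2"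
    using approximating_projection by blast
  have nr: "norm (?b - ?b * p) \<le> e ^ N" using p(3) by (rule power2_le_imp_le) (use e in simp)
  have "{\<mu> \<in> spectrum (?b - ?b * p). e ^ N < cmod \<mu>} = {}"
    using spectrum_norm_le[of _ "?b - ?b * p"] nr by fastforce
  then have "countable {\<mu> \<in> spectrum (?b - ?b * p). e ^ N < cmod \<mu>}" by (simp only: countable_empty)
  from countable_spectrum_minimal_sum[OF projection_minimal_sum[OF p(1,2)] this, of ?b]
  have c: "countable {\<mu> \<in> spectrum ?b. e ^ N < cmod \<mu>}" by simp
  have "{z \<in> spectrum a. e < cmod z} \<subseteq> (\<Union>\<mu>\<in>{\<mu> \<in> spectrum ?b. e ^ N < cmod \<mu>}. {z. z ^ N = \<mu>})"
    using spectrum_power_mem[of _ a N] power_strict_mono[of e _ N] e N(2) by (auto simp: norm_power)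
  moreover have "countable (\<Union>\<mu>\<in>{\<mu> \<in> spectrum ?b. e ^ N < cmod \<mu>}. {z. z ^ N = \<mu>})"
    using N(2) by (intro countable_UN c countable_finite finite_nth_roots)
  ultimately show ?thesis by (rule countable_subset)
qed

end

section \<open>The West decomposition\<close>

text \<open>Iteration gives \<open>x = N ^ n * x * b ^ n\<close>, and the decay of
  \<open>N ^ n\<close> beats the geometric growth of \<open>b ^ n\<close>. It serves to kill
  elements that reproduce themselves through a quasinilpotent factor.\<close>

lemma quasinilpotent_left_fixpoint:
  fixes x :: "'a::complex_banach_algebra_1"
  assumes N: "spectrum N \<subseteq> {0}" and x: "x = N * x * b"
  shows "x = 0"
proof -
  have xn: "x = N ^ n * x * b ^ n" for n
  proof (induction n)
    case (Suc n)
    have "N ^ Suc n * x * b ^ Suc n = N ^ n * (N * x * b) * b ^ n"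
      by (simp only: power_Suc2[of N] power_Suc[of b] mult.assoc)
    then show ?case using Suc x by simp
  qed simp
  have "norm x \<le> norm x * (norm b ^ n * norm (N ^ n))" for n
  proof -
    have "norm x = norm (N ^ n * x * b ^ n)" using xn[of n] by (rule arg_cong)
    also have "\<dots> \<le> norm (N ^ n) * norm x * norm (b ^ n)"
      by (rule order_trans[OF norm_mult_ineq mult_right_mono[OF norm_mult_ineq norm_ge_zero]])
    also have "\<dots> \<le> norm (N ^ n) * norm x * norm b ^ n" by (intro mult_left_mono norm_power_ineq) simp
    finally show ?thesis by (simp add: mult_ac)
  qed
  moreover have "(\<lambda>n. norm x * (norm b ^ n * norm (N ^ n))) \<longlonglongrightarrow> 0"
    by (intro tendsto_mult_right_zero spectrum_subset_0_powers N)
  ultimately have "norm x \<le> 0" by (intro LIMSEQ_le_const) auto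
  then show ?thesis by simp
qed

lemma quasinilpotent_right_eigenvalue:
  fixes x :: "'a::complex_banach_algebra_1"
  assumes N: "spectrum N \<subseteq> {0}" and x: "x * N = c *\<^sub>C x" and c: "c \<noteq> 0"
  shows "x = 0"
proof -
  have "invertible_element (N - c *\<^sub>C 1)" using N c by (auto simp flip: not_spectrum_iff)
  moreover have "x * (N - c *\<^sub>C 1) = 0" by (simp add: right_diff_distrib x)
  ultimately show ?thesis by (metis ainv_right mult.assoc mult.right_neutral mult_zero_left)
qed

text \<open>Inversion of a block-diagonal element: \<open>x\<close> and \<open>y\<close> invert each
  other on one block with unit \<open>g\<close>, and the other block, with unit \<open>f\<close>, is
  scalar.\<close>

lemma block_product:
  fixes x y f g :: "'a::complex_banach_algebra_1"
  assumes "x * y = g" "x * f = 0" "f * y = 0" "f * f = f" "w \<noteq> 0"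
  shows "(x - w *\<^sub>C f) * (y - inverse w *\<^sub>C f) = g + f"
  using assms by (simp add: left_diff_distrib right_diff_distrib scaleC_algebra)

text \<open>\<open>z\<close> is 1 minus the square of \<open>e - star e\<close>. It factors through
  \<open>k - \<i>\<close> and \<open>k + \<i>\<close> with \<open>k\<close> self-adjoint, hence is
  invertible, and it commutes with \<open>e\<close> and \<open>star e\<close>. The projection is
  \<open>e * star e * ainv z\<close>; \<open>e * z = e * star e * e\<close> yields
  \<open>p * e = e\<close>. The factorization \<open>p = e * x\<close> places \<open>p\<close> in
  every ideal that contains \<open>e\<close>.\<close>

lemma idempotent_range_projection:
  fixes e :: "'a::cstar_algebra_1"
  assumes e: "e * e = e"
  obtains p x where "projection p" "e * p = p" "p * e = e" "p = e * x"
proof -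
  let ?f = "star e"
  have f: "?f * ?f = ?f" using arg_cong[OF e, of star] by (simp add: star_mult)
  define k where "k = \<i> *\<^sub>C (e - ?f)"
  have k: "star k = k" by (simp add: k_def star_scaleC star_diff scaleC_algebra)
  define z where "z = 1 + k * k"
  have "k * k = - ((e - ?f) * (e - ?f))" by (simp add: k_def scaleC_minus_left)
  then have zd: "z = 1 - e + e * ?f + ?f * e - ?f" by (simp add: z_def algebra_simps e f)
  have "z = (k - \<i> *\<^sub>C 1) * (k - (- \<i>) *\<^sub>C 1)"
    by (simp add: z_def algebra_simps scaleC_algebra)
  moreover have "\<i> \<notin> spectrum k" "- \<i> \<notin> spectrum k" using spectrum_selfadjoint_real[OF k] by fastforce+
  ultimately have zi: "invertible_element z" by (simp only: not_spectrum_iff invertible_mult)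
  have ez: "e * z = e * ?f * e" and ze: "z * e = e * ?f * e"
    by (simp_all add: zd algebra_simps e flip: mult.assoc) (simp_all add: mult.assoc e)
  have fz: "?f * z = ?f * e * ?f" and zf: "z * ?f = ?f * e * ?f"
    by (simp_all add: zd algebra_simps f flip: mult.assoc) (simp_all add: mult.assoc f)
  let ?w = "ainv z"
  have ew: "e * ?w = ?w * e" by (rule ainv_commute[OF zi]) (simp add: ez ze)
  have fw: "?f * ?w = ?w * ?f" by (rule ainv_commute[OF zi]) (simp add: fz zf)
  have zs: "star z = z" by (simp add: z_def star_add star_mult k)
  have ws: "star ?w = ?w"
  proof (rule ainv_unique[symmetric])
    show "z * star ?w = 1" using arg_cong[OF ainv_left[OF zi], of star] by (simp add: star_mult zs)
    show "star ?w * z = 1" using arg_cong[OF ainv_right[OF zi], of star] by (simp add: star_mult zs)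
  qed
  define p where "p = e * (?f * ?w)"
  have "star p = ?w * e * ?f" by (simp add: p_def star_mult ws mult.assoc)
  also have "\<dots> = e * (?w * ?f)" by (simp add: mult.assoc flip: ew)
  finally have p1: "star p = p" by (simp add: p_def fw)
  have pe: "p * e = e"
  proof -
    have "p * e = e * ?f * (?w * e)" by (simp add: p_def mult.assoc)
    also have "\<dots> = e * ?f * e * ?w" by (simp add: mult.assoc flip: ew)
    also have "\<dots> = e * z * ?w" by (simp only: ez)
    finally show ?thesis using zi by (simp add: mult.assoc)
  qed
  have "p * p = p * e * (?f * ?w)" by (simp add: p_def mult.assoc)
  then have "p * p = e * (?f * ?w)" by (simp only: pe)
  then have p2: "p * p = p" by (simp only: flip: p_def)
  have ep: "e * p = p" by (simp add: p_def e flip: mult.assoc)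
  show ?thesis by (rule that[OF _ ep pe p_def]) (simp add: projection_def p1 p2)
qed

lemma orthogonal_projections_mult:
  fixes q :: "'i \<Rightarrow> 'a::cstar_algebra_1"
  assumes I: "finite I" and q: "\<And>i j. i \<in> I \<Longrightarrow> j \<in> I \<Longrightarrow> q i * q j = (if i = j then q i else 0)"
  shows "(\<Sum>i\<in>I. c i *\<^sub>C q i) * (\<Sum>i\<in>I. c' i *\<^sub>C q i) = (\<Sum>i\<in>I. (c i * c' i) *\<^sub>C q i)"
proof -
  have "(\<Sum>i\<in>I. c i *\<^sub>C q i) * (\<Sum>i\<in>I. c' i *\<^sub>C q i) = (\<Sum>i\<in>I. \<Sum>j\<in>I. c i *\<^sub>C q i * (c' j *\<^sub>C q j))"
    by (rule sum_product)
  also have "\<dots> = (\<Sum>i\<in>I. \<Sum>j\<in>I. if i = j then (c i * c' i) *\<^sub>C q i else 0)"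
    by (intro sum.cong refl) (simp add: q mult.commute)
  finally show ?thesis using I by simp
qed

text \<open>The powers of \<open>star ?y * ?y\<close> are combinations of the same projections, of
  norm at most \<open>card I\<close> times the power of \<open>M\<^sup>2\<close>; passing to the
  growth rate removes \<open>card I\<close>. A bound free of \<open>card I\<close> is what makes the
  series for \<open>d\<close> converge.\<close>

lemma norm_orthogonal_projections_le:
  fixes q :: "'i \<Rightarrow> 'a::cstar_algebra_1"
  assumes I: "finite I" and q: "\<And>i j. i \<in> I \<Longrightarrow> j \<in> I \<Longrightarrow> q i * q j = (if i = j then q i else 0)"
    and pr: "\<And>i. i \<in> I \<Longrightarrow> projection (q i)" and M: "M \<ge> 0" "\<And>i. i \<in> I \<Longrightarrow> cmod (c i) \<le> M"
  shows "norm (\<Sum>i\<in>I. c i *\<^sub>C q i) \<le> M"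
proof -
  let ?y = "\<Sum>i\<in>I. c i *\<^sub>C q i"
  let ?h = "\<Sum>i\<in>I. (cnj (c i) * c i) *\<^sub>C q i"
  have "star ?y = (\<Sum>i\<in>I. cnj (c i) *\<^sub>C q i)"
    using pr by (simp add: star_sum star_scaleC projection_def)
  then have h: "star ?y * ?y = ?h" using orthogonal_projections_mult[OF I q, of "\<lambda>i. cnj (c i)" c] by simp
  have pw: "?h ^ Suc n = (\<Sum>i\<in>I. (cnj (c i) * c i) ^ Suc n *\<^sub>C q i)" for n
  proof (induction n)
    case (Suc n)
    have "?h ^ Suc (Suc n) = ?h * (\<Sum>i\<in>I. (cnj (c i) * c i) ^ Suc n *\<^sub>C q i)"
      by (simp only: power_Suc[of ?h "Suc n"] Suc)
    then show ?case by (simp add: orthogonal_projections_mult[OF I q])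
  qed simp
  have "norm ?h \<le> M\<^sup>2"
  proof (rule norm_selfadjoint_le_powers)
    show "star ?h = ?h" unfolding h[symmetric] by (simp add: star_mult)
    fix s assume s: "s > M\<^sup>2"
    then have s0: "s > 0" using zero_le_power2[of M] by linarith
    have le: "norm (?h ^ Suc n) / s ^ Suc n \<le> real (card I) * (M\<^sup>2 / s) ^ Suc n" for n
    proof -
      have "norm (?h ^ Suc n) \<le> (\<Sum>i\<in>I. (M\<^sup>2) ^ Suc n)"
        unfolding pw
      proof (rule sum_norm_le)
        fix i assume i: "i \<in> I"
        have "cmod (c i) * cmod (c i) \<le> M\<^sup>2" unfolding power2_eq_square using M i by (intro mult_mono) auto
        then have "cmod ((cnj (c i) * c i) ^ Suc n) \<le> (M\<^sup>2) ^ Suc n"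
          unfolding norm_power norm_mult complex_mod_cnj by (intro power_mono) auto
        then have "cmod ((cnj (c i) * c i) ^ Suc n) * norm (q i) \<le> (M\<^sup>2) ^ Suc n * 1"
          using norm_projection_le[OF pr[OF i]] by (intro mult_mono) auto
        then show "norm ((cnj (c i) * c i) ^ Suc n *\<^sub>C q i) \<le> (M\<^sup>2) ^ Suc n" by (simp only: norm_scaleC mult_1_right)
      qed
      then show ?thesis using s0 by (simp add: power_divide divide_right_mono)
    qed
    have "(\<lambda>n. real (card I) * (M\<^sup>2 / s) ^ n) \<longlonglongrightarrow> 0"
      by (intro tendsto_mult_right_zero LIMSEQ_power_zero) (use s s0 in simp)
    then have "(\<lambda>n. real (card I) * (M\<^sup>2 / s) ^ Suc n) \<longlonglongrightarrow> 0" by (rule LIMSEQ_Suc)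
    then have "(\<lambda>n. norm (?h ^ Suc n) / s ^ Suc n) \<longlonglongrightarrow> 0"
      by (rule Lim_null_comparison[rotated]) (use le s0 in \<open>auto intro!: always_eventually\<close>)
    then show "(\<lambda>n. norm (?h ^ n) / s ^ n) \<longlonglongrightarrow> 0" by (rule LIMSEQ_imp_Suc)
  qed simp
  then have "(norm ?y)\<^sup>2 \<le> M\<^sup>2" by (simp flip: h norm_star_mult)
  then show ?thesis using M(1) by (rule power2_le_imp_le)
qed

section \<open>Spectral idempotents and left eigenvectors\<close>

context riesz_hom
begin

text \<open>The disc excludes 0, the only spectral value that \<open>T a\<close> can have. After
  rescaling to the unit circle, \<open>T x\<close> is therefore invertible with an inverse
  \<open>v\<close> whose powers tend to 0, and this forces the images of the approximants of
  \<open>e\<close>, hence \<open>T e\<close>, to vanish.\<close>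

lemma circle_idempotent:
  assumes a: "spectrum (T a) \<subseteq> {0}" and r: "0 < r" "r < cmod l"
    and circle: "\<And>z. cmod (z - l) = r \<Longrightarrow> z \<notin> spectrum a"
  obtains e where "e * e = e" "T e = 0" "\<forall>y. y * a = a * y \<longrightarrow> y * e = e * y"
    and "\<forall>z. cmod (z - l) \<le> r \<longrightarrow> (\<exists>y. (a - z *\<^sub>C 1) * y = 1 - e \<and> y * (a - z *\<^sub>C 1) = 1 - e)"
    and "\<forall>z. cmod (z - l) \<ge> r \<longrightarrow> (\<exists>y. (a - z *\<^sub>C 1) * y = e \<and> y * (a - z *\<^sub>C 1) = e)"
proof -
  let ?c = "inverse (complex_of_real r)"
  have l0: "cmod l > 0" using r by linarith
  define x where "x = ?c *\<^sub>C (a - l *\<^sub>C 1)"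
  have c: "?c \<noteq> 0" "complex_of_real r * ?c = 1" using r by auto
  have xw: "x - w *\<^sub>C 1 = ?c *\<^sub>C (a - (l + of_real r * w) *\<^sub>C 1)" for w
    using c(2) by (simp add: x_def scaleC_algebra mult.commute mult.left_commute)
  have az: "a - z *\<^sub>C 1 = of_real r *\<^sub>C (x - (?c * (z - l)) *\<^sub>C 1)" for z
    using r unfolding xw by (simp add: mult.assoc[symmetric])
  have cz: "cmod (?c * (z - l)) = cmod (z - l) / r" for z
    using r by (simp add: norm_mult norm_inverse norm_divide divide_inverse mult.commute)
  have sx: "w \<in> spectrum x \<longleftrightarrow> l + of_real r * w \<in> spectrum a" for w
    unfolding spectrum_def mem_Collect_eq xw invertible_scaleC[OF c(1)] ..
  have "w \<notin> spectrum x" if "cmod w = 1" for w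
    unfolding sx by (rule circle) (use that r in \<open>simp add: norm_mult\<close>)
  then obtain e where e: "e * e = e" "\<And>y. y * x = x * y \<Longrightarrow> y * e = e * y"
    "\<And>n. n > 0 \<Longrightarrow> invertible_element (1 - x ^ n)" "(\<lambda>n. ainv (1 - x ^ n)) \<longlonglongrightarrow> e"
    and e1: "\<And>z. cmod z \<le> 1 \<Longrightarrow> \<exists>y. (x - z *\<^sub>C 1) * y = 1 - e \<and> y * (x - z *\<^sub>C 1) = 1 - e"
    and e2: "\<And>z. cmod z \<ge> 1 \<Longrightarrow> \<exists>y. (x - z *\<^sub>C 1) * y = e \<and> y * (x - z *\<^sub>C 1) = e"
    using riesz_idempotent[of x] by blast
  let ?X = "T x"
  have TX: "?X - w *\<^sub>C 1 = ?c *\<^sub>C (T a - (l + of_real r * w) *\<^sub>C 1)" for w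
    using arg_cong[OF xw[of w], of T] by (simp add: T_diff T_scaleC)
  have sX: "w \<in> spectrum ?X \<Longrightarrow> l + of_real r * w = 0" for w
    using a unfolding spectrum_def TX invertible_scaleC[OF c(1)] by blast
  have "0 \<notin> spectrum ?X" using sX[of 0] r by auto
  then have iX: "invertible_element ?X" by (simp add: not_spectrum_iff)
  define v where "v = ainv ?X"
  have iv: "invertible_element v" unfolding v_def by (rule invertible_ainv[OF iX])
  have "(\<lambda>n. norm (v ^ n) / 1 ^ n) \<longlonglongrightarrow> 0"
  proof (rule spectral_radius_powers)
    fix z assume z: "z \<in> spectrum v"
    have z0: "z \<noteq> 0" using z iv by (auto simp: spectrum_def)
    have "v - z *\<^sub>C 1 = v * ((- z) *\<^sub>C (?X - inverse z *\<^sub>C 1))"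
      using z0 iX by (simp add: v_def right_diff_distrib scaleC_algebra)
    then have "\<not> invertible_element (v * ((- z) *\<^sub>C (?X - inverse z *\<^sub>C 1)))" using z by (simp add: spectrum_def)
    then have "\<not> invertible_element ((- z) *\<^sub>C (?X - inverse z *\<^sub>C 1))" using invertible_mult[OF iv] by blast
    then have "\<not> invertible_element (?X - inverse z *\<^sub>C 1)"
      using invertible_scaleC[of "- z" "?X - inverse z *\<^sub>C 1"] z0 by simp
    then have "l + of_real r * inverse z = 0" by (intro sX) (simp add: spectrum_def)
    then have "l * z = - of_real r" using z0 by (simp add: field_simps eq_neg_iff_add_eq_0)
    then have "cmod l * cmod z = r" using r by (metis norm_mult norm_minus_cancel norm_of_real abs_of_pos)
    then show "cmod z \<le> r / cmod l" using l0 by (simp add: pos_le_divide_eq mult.commute)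
  qed (use r l0 in auto)
  then have v0: "(\<lambda>n. v ^ n) \<longlonglongrightarrow> 0" by (intro tendsto_norm_zero_cancel[of "\<lambda>n. v ^ n"]) simp
  have lim: "(\<lambda>n. T (ainv (1 - x ^ n))) \<longlonglongrightarrow> T e"
    by (rule bounded_linear.tendsto[OF bounded_linear_T e(4)])
  \<comment> \<open>Each image \<open>A\<close> of an approximant satisfies
    \<open>A = A * v ^ n - v ^ n\<close>, and the right-hand side tends to 0.\<close>
  have "(\<lambda>n. T (ainv (1 - x ^ n)) * v ^ n - v ^ n) \<longlonglongrightarrow> T e * 0 - 0" by (intro tendsto_intros lim v0)
  moreover have "\<forall>\<^sub>F n in sequentially. T (ainv (1 - x ^ n)) * v ^ n - v ^ n = T (ainv (1 - x ^ n))"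
    using eventually_gt_at_top[of 0]
  proof eventually_elim
    case (elim n)
    let ?A = "T (ainv (1 - x ^ n))"
    have "?A * (1 - ?X ^ n) = 1"
      using arg_cong[OF ainv_left[OF e(3)[OF elim]], of T] by (simp add: T_mult T_diff T_power)
    then have "?A * (1 - ?X ^ n) * v ^ n = v ^ n" by simp
    moreover have "?X ^ n * v ^ n = 1"
      using ainv_right[OF ainv_power(1)[OF iX, of n]] ainv_power(2)[OF iX, of n] by (simp add: v_def)
    ultimately have "?A * v ^ n - ?A = v ^ n" by (simp add: left_diff_distrib right_diff_distrib mult.assoc)
    then show ?case by (simp add: algebra_simps)
  qed
  ultimately have "(\<lambda>n. T (ainv (1 - x ^ n))) \<longlonglongrightarrow> 0"
    by (simp add: tendsto_cong)
  then have Te: "T e = 0" using lim LIMSEQ_unique by blast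
  show ?thesis
  proof (rule that[OF e(1) Te]; intro allI impI)
    fix y assume "y * a = a * y"
    then show "y * e = e * y" by (intro e(2)) (simp add: x_def left_diff_distrib right_diff_distrib)
  next
    fix z assume "cmod (z - l) \<le> r"
    then have "cmod (?c * (z - l)) \<le> 1" unfolding cz using r by simp
    from e1[OF this] obtain y where "(x - (?c * (z - l)) *\<^sub>C 1) * y = 1 - e" "y * (x - (?c * (z - l)) *\<^sub>C 1) = 1 - e"
      by blast
    then show "\<exists>y. (a - z *\<^sub>C 1) * y = 1 - e \<and> y * (a - z *\<^sub>C 1) = 1 - e"
      using c(2) by (intro exI[of _ "?c *\<^sub>C y"]) (simp only: az mult_scaleC_left mult_scaleC_right scaleC_scaleC mult.commute[of ?c] scaleC_one simp_thms)
  next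
    fix z assume "cmod (z - l) \<ge> r"
    then have "cmod (?c * (z - l)) \<ge> 1" unfolding cz using r by simp
    from e2[OF this] obtain y where "(x - (?c * (z - l)) *\<^sub>C 1) * y = e" "y * (x - (?c * (z - l)) *\<^sub>C 1) = e"
      by blast
    then show "\<exists>y. (a - z *\<^sub>C 1) * y = e \<and> y * (a - z *\<^sub>C 1) = e"
      using c(2) by (intro exI[of _ "?c *\<^sub>C y"]) (simp only: az mult_scaleC_left mult_scaleC_right scaleC_scaleC mult.commute[of ?c] scaleC_one simp_thms)
  qed
qed

text \<open>A countable spectrum is missed by some small circle about \<open>l\<close>; the spectrum inside that circle is
  part of the spectrum of \<open>a e \<in> T\<^sup>-\<^sup>1(0)\<close>, to which the Riesz property applies.\<close>

lemma spectrum_isolated: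
  assumes a: "spectrum (T a) \<subseteq> {0}" and l: "l \<noteq> 0"
  obtains d where "d > 0" "\<And>z. z \<in> spectrum a \<Longrightarrow> z \<noteq> l \<Longrightarrow> d \<le> cmod (z - l)"
proof -
  \<comment> \<open>Circles about \<open>l\<close> of radius below \<open>cmod l / 2\<close> have
    points of modulus at least \<open>cmod l / 2\<close> only, so every spectral point on them
    belongs to \<open>?S\<close>.\<close>
  let ?S = "{z \<in> spectrum a. cmod l / 4 < cmod z}"
  have "countable ((\<lambda>z. cmod (z - l)) ` ?S)"
    using l by (intro countable_image countable_spectrum_away_from_0 a) simp
  moreover have "uncountable {0<..<cmod l / 2}" using l by (simp add: uncountable_open_interval)
  ultimately have "\<not> {0<..<cmod l / 2} \<subseteq> (\<lambda>z. cmod (z - l)) ` ?S" using countable_subset by blast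
  then obtain r where "r \<in> {0<..<cmod l / 2}" and r3: "r \<notin> (\<lambda>z. cmod (z - l)) ` ?S" by blast
  then have r: "0 < r" "r < cmod l / 2" by auto
  have big: "cmod l / 2 \<le> cmod z" if "cmod (z - l) \<le> r" for z
    using norm_triangle_ineq2[of l z] that r by (simp add: norm_minus_commute)
  have circle: "z \<notin> spectrum a" if "cmod (z - l) = r" for z
  proof
    assume z: "z \<in> spectrum a"
    have "cmod l / 2 \<le> cmod z" "cmod l > 0" using big[of z] that l by simp_all
    then have "cmod l / 4 < cmod z" by linarith
    with z have "z \<in> ?S" by simp
    with that r3 show False by blast
  qed
  have rl: "r < cmod l" using r(1,2) by linarith
  obtain e where e: "e * e = e" "T e = 0" "\<forall>y. y * a = a * y \<longrightarrow> y * e = e * y"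
    "\<forall>z. cmod (z - l) \<le> r \<longrightarrow> (\<exists>y. (a - z *\<^sub>C 1) * y = 1 - e \<and> y * (a - z *\<^sub>C 1) = 1 - e)"
    "\<forall>z. cmod (z - l) \<ge> r \<longrightarrow> (\<exists>y. (a - z *\<^sub>C 1) * y = e \<and> y * (a - z *\<^sub>C 1) = e)"
    by (rule circle_idempotent[OF a r(1) rl circle])
  have ae: "a * e = e * a" using e(3) by simp
  \<comment> \<open>Otherwise \<open>a - z *\<^sub>C 1\<close> would be inverted by
    \<open>e * ?b\<close> on the range of \<open>e\<close> and by \<open>y\<close> on that of
    \<open>1 - e\<close>, and the sum of the two would be an inverse.\<close>
  have mem: "z \<in> spectrum (a * e)" if z: "z \<in> spectrum a" "cmod (z - l) \<le> r" for z
  proof (rule ccontr)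
    assume "z \<notin> spectrum (a * e)"
    then have i: "invertible_element (a * e - z *\<^sub>C 1)" by (simp only: not_spectrum_iff)
    let ?b = "ainv (a * e - z *\<^sub>C 1)"
    obtain y where y: "(a - z *\<^sub>C 1) * y = 1 - e" "y * (a - z *\<^sub>C 1) = 1 - e" using e(4) z(2) by blast
    have eq1: "(a - z *\<^sub>C 1) * e = (a * e - z *\<^sub>C 1) * e"
      by (simp add: left_diff_distrib mult.assoc e(1))
    have "e * (a * e) = e * (e * a)" by (simp only: ae)
    also have "\<dots> = e * a" by (simp only: e(1) flip: mult.assoc)
    finally have eae: "e * (a * e) = e * a" .
    then have eq2: "e * (a - z *\<^sub>C 1) = e * (a * e - z *\<^sub>C 1)" by (simp add: right_diff_distrib)
    have "e * (a * e - z *\<^sub>C 1) = (a * e - z *\<^sub>C 1) * e"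
    proof (rule commute_diff_scalar)
      have "a * e * e = a * e" by (simp only: mult.assoc e(1))
      also have "\<dots> = e * (a * e)" by (rule trans[OF ae eae[symmetric]])
      finally show "e * (a * e) = a * e * e" ..
    qed
    then have eb: "e * ?b = ?b * e" by (rule ainv_commute[OF i])
    have "(a - z *\<^sub>C 1) * (e * ?b) = (a * e - z *\<^sub>C 1) * (?b * e)"
      using arg_cong[OF eq1, of "\<lambda>u. u * ?b"] by (simp add: mult.assoc eb)
    also have "\<dots> = e" using i by (simp add: ainv_cancel)
    finally have 1: "(a - z *\<^sub>C 1) * (e * ?b) = e" .
    have "(?b * e) * (a - z *\<^sub>C 1) = (e * ?b) * (a * e - z *\<^sub>C 1)"
      using arg_cong[OF eq2, of "\<lambda>u. ?b * u"] by (simp only: mult.assoc flip: eb) (simp only: eb flip: mult.assoc)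
    also have "\<dots> = e" using i by (simp add: mult.assoc)
    finally have 2: "(e * ?b) * (a - z *\<^sub>C 1) = e" by (simp only: eb)
    have "invertible_element (a - z *\<^sub>C 1)"
      by (rule invertible_elementI[of _ "e * ?b + y"]) (simp_all add: distrib_left distrib_right 1 2 y)
    with z(1) show False by (simp add: spectrum_def)
  qed
  have "finite {z \<in> spectrum (a * e). cmod l / 2 \<le> cmod z}"
    using l by (intro finite_spectrum_null) (simp_all add: T_mult e(2))
  moreover have "{z \<in> spectrum a. cmod (z - l) \<le> r} \<subseteq> {z \<in> spectrum (a * e). cmod l / 2 \<le> cmod z}"
    using mem big by blast
  ultimately have "finite ({z \<in> spectrum a. cmod (z - l) \<le> r} - {l})" using finite_subset by blast
  from finite_set_avoid[OF this, of l] obtain d where d: "d > 0"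
    "\<And>z. z \<in> spectrum a \<Longrightarrow> cmod (z - l) \<le> r \<Longrightarrow> z \<noteq> l \<Longrightarrow> d \<le> dist l z" by auto
  show ?thesis
  proof (rule that[of "min d r"])
    fix z assume "z \<in> spectrum a" "z \<noteq> l"
    then show "min d r \<le> cmod (z - l)" using d(2)[of z]
      by (cases "cmod (z - l) \<le> r") (simp_all add: dist_norm norm_minus_commute[of l] min_le_iff_disj)
  qed (use d r in simp)
qed

lemma finite_spectrum_riesz:
  assumes a: "spectrum (T a) \<subseteq> {0}" and r: "r > 0"
  shows "finite {z \<in> spectrum a. r \<le> cmod z}"
proof (rule finite_spectrum_away_from_0[OF compact_spectrum _ r])
  show "acc (spectrum a) \<subseteq> {0}"
  proof
    fix l assume l: "l \<in> acc (spectrum a)"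
    show "l \<in> {0}"
    proof (rule ccontr)
      assume "l \<notin> {0}"
      then have l0: "l \<noteq> 0" by simp
      obtain d where d: "d > 0" "\<And>z. z \<in> spectrum a \<Longrightarrow> z \<noteq> l \<Longrightarrow> d \<le> cmod (z - l)"
        using spectrum_isolated[OF a l0] by blast
      have "l islimpt spectrum a" using l by (auto simp: acc_def iso_def isolated_in_islimpt_iff)
      then obtain z where "z \<in> spectrum a" "z \<noteq> l" "dist z l < d" using d(1) by (auto simp: islimpt_approachable)
      with d(2)[of z] show False by (simp add: dist_norm)
    qed
  qed
qed

text \<open>The circle surrounds no spectral point except possibly \<open>l\<close>. For
  \<open>w \<noteq> 0\<close>, \<open>a - (l + w) *\<^sub>C 1\<close> is invertible on the range of
  \<open>e\<close>: if \<open>cmod w < d\<close> by isolation, otherwise because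
  \<open>l + w\<close> is outside the circle. On the other block
  \<open>(a - l *\<^sub>C 1) * e - w *\<^sub>C 1\<close> is the scalar \<open>- w\<close>, whence
  quasinilpotence.\<close>

lemma riesz_point_idempotent:
  assumes a: "spectrum (T a) \<subseteq> {0}" and l: "l \<noteq> 0"
  obtains e y where "e * e = e" "T e = 0" "a * e = e * a" "\<forall>x. x * a = a * x \<longrightarrow> x * e = e * x"
    and "spectrum ((a - l *\<^sub>C 1) * e) \<subseteq> {0}" "(a - l *\<^sub>C 1) * y = 1 - e" "y * (a - l *\<^sub>C 1) = 1 - e"
proof -
  obtain d where d: "d > 0" "\<And>z. z \<in> spectrum a \<Longrightarrow> z \<noteq> l \<Longrightarrow> d \<le> cmod (z - l)"
    using spectrum_isolated[OF a l] by blast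
  define r where "r = min d (cmod l) / 2"
  have r: "0 < r" "r < d" "r < cmod l" using d(1) l by (auto simp: r_def min_def)
  have circle: "z \<notin> spectrum a" if "cmod (z - l) = r" for z using d(2)[of z] r that by auto
  obtain e where e: "e * e = e" "T e = 0" "\<forall>y. y * a = a * y \<longrightarrow> y * e = e * y"
    "\<forall>z. cmod (z - l) \<le> r \<longrightarrow> (\<exists>y. (a - z *\<^sub>C 1) * y = 1 - e \<and> y * (a - z *\<^sub>C 1) = 1 - e)"
    "\<forall>z. cmod (z - l) \<ge> r \<longrightarrow> (\<exists>y. (a - z *\<^sub>C 1) * y = e \<and> y * (a - z *\<^sub>C 1) = e)"
    by (rule circle_idempotent[OF a r(1,3) circle])
  have ae: "a * e = e * a" using e(3) by simp
  have "w \<notin> spectrum ((a - l *\<^sub>C 1) * e)" if w: "w \<noteq> 0" for w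
  proof -
    let ?m = "a - (l + w) *\<^sub>C 1"
    obtain y where y: "?m * y = e" "y * ?m = e"
    proof (cases "cmod w < d")
      case True
      then have i: "invertible_element ?m" using d(2)[of "l + w"] w by (auto simp flip: not_spectrum_iff)
      have "e * ?m = ?m * e" by (rule commute_diff_scalar) (simp add: ae)
      then show ?thesis using i by (intro that[of "ainv ?m * e"]) (simp_all add: ainv_cancel mult.assoc)
    next
      case False
      then have "cmod (l + w - l) \<ge> r" using r by simp
      then show ?thesis using e(5) that by blast
    qed
    have em: "e * ?m = ?m * e" by (rule commute_diff_scalar) (simp add: ae)
    have N: "(a - l *\<^sub>C 1) * e - w *\<^sub>C 1 = ?m * e - w *\<^sub>C (1 - e)"
      by (simp add: left_diff_distrib distrib_right scaleC_algebra)
    let ?b = "e * y * e - inverse w *\<^sub>C (1 - e)"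
    have z: "e * (1 - e) = 0" "(1 - e) * e = 0" "(1 - e) * (1 - e) = 1 - e" by (simp_all add: algebra_simps e(1))
    have "?m * e * (e * y * e) = ?m * (e * e) * (y * e)" by (simp only: mult.assoc)
    also have "\<dots> = e * ?m * (y * e)" by (simp only: e(1) em)
    also have "\<dots> = e * (?m * y) * e" by (simp only: mult.assoc)
    finally have k1: "?m * e * (e * y * e) = e" by (simp only: y e(1))
    have "e * y * e * (?m * e) = e * y * (e * ?m) * e" by (simp only: mult.assoc)
    also have "\<dots> = e * (y * ?m) * (e * e)" unfolding em by (simp only: mult.assoc)
    finally have k2: "e * y * e * (?m * e) = e" by (simp only: y e(1))
    have z1: "?m * e * (1 - e) = 0" "e * y * e * (1 - e) = 0" by (simp_all only: mult.assoc z mult_zero_right)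
    have z2: "(1 - e) * (e * y * e) = 0" by (simp only: z mult_zero_left flip: mult.assoc)
    have z3: "(1 - e) * (?m * e) = 0" unfolding em[symmetric] by (simp only: z mult_zero_left flip: mult.assoc)
    have "invertible_element ((a - l *\<^sub>C 1) * e - w *\<^sub>C 1)"
      unfolding N
      using block_product[OF k1 z1(1) z2 z(3) w] block_product[OF k2 z1(2) z3 z(3), of "inverse w"] w
      by (intro invertible_elementI[of _ ?b]) simp_all
    then show ?thesis by (simp only: not_spectrum_iff)
  qed
  then have s: "spectrum ((a - l *\<^sub>C 1) * e) \<subseteq> {0}" by blast
  obtain y where "(a - l *\<^sub>C 1) * y = 1 - e" "y * (a - l *\<^sub>C 1) = 1 - e" using e(4)[THEN spec, of l] r by auto
  then show ?thesis using that[OF e(1,2) ae _ s] e(3) by blast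
qed

text \<open>With \<open>p\<close> the range projection of the idempotent \<open>e\<close> at
  \<open>l\<close>, the element \<open>z = (c - l) p\<close> lives in the corner of \<open>p\<close>
  and is to be annihilated from the left. If 0 is a spectral value of \<open>z * star z\<close> in
  this corner, its spectral projection does so; if not, \<open>z\<close> is right invertible there,
  which contradicts quasinilpotence of \<open>(c - l) e\<close>.\<close>

lemma left_eigenvector:
  assumes c: "spectrum (T c) \<subseteq> {0}" and l: "l \<in> spectrum c" "l \<noteq> 0"
  obtains g where "g \<noteq> 0" "g * (c - l *\<^sub>C 1) = 0"
proof -
  note result = that
  let ?m = "c - l *\<^sub>C 1"
  obtain e y where e: "e * e = e" "T e = 0" "c * e = e * c" "\<forall>x. x * c = c * x \<longrightarrow> x * e = e * x"
    "spectrum (?m * e) \<subseteq> {0}" "?m * y = 1 - e" "y * ?m = 1 - e"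
    by (rule riesz_point_idempotent[OF c l(2)])
  have "e \<noteq> 0"
  proof
    assume "e = 0"
    then have "invertible_element ?m" using e(6,7) by (intro invertible_elementI) auto
    with l(1) show False by (simp add: spectrum_def)
  qed
  have em: "e * ?m = ?m * e" by (rule commute_diff_scalar) (simp add: e(3))
  obtain p x where p: "projection p" "e * p = p" "p * e = e" "p = e * x"
    using idempotent_range_projection[OF e(1)] by blast
  have p0: "p \<noteq> 0" using p(3) \<open>e \<noteq> 0\<close> by auto
  have pp: "star p = p" "p * p = p" using p(1) by (simp_all add: projection_def)
  have Tp: "T p = 0" using p(4) e(2) by (simp add: T_mult)
  define z where "z = ?m * p"
  have zN: "z = ?m * e * p" by (simp add: z_def mult.assoc p(2))
  have z_em: "z = e * (?m * p)" unfolding zN by (simp only: mult.assoc flip: em)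
  have pz: "p * z = z" unfolding z_em by (simp add: p(3) flip: mult.assoc)
  have zp: "z * p = z" by (simp add: z_def mult.assoc pp)
  \<comment> \<open>Multiplying by \<open>e\<close> leads from the corner of \<open>p\<close> to the
    whole algebra, because \<open>p * e = e\<close> and \<open>e\<close> commutes with
    \<open>?m\<close>.\<close>
  have finish: thesis if P: "P \<noteq> 0" "P * p = P" "P * z = 0" for P
  proof (rule result)
    have "P * e * p = P" by (simp add: mult.assoc p(2) P(2))
    then show "P * e \<noteq> 0" using P(1) by auto
    have "P * e * ?m = P * (?m * (p * e))" by (simp only: mult.assoc p(3) em)
    also have "\<dots> = P * z * e" by (simp only: z_def mult.assoc)
    finally show "P * e * ?m = 0" using P(3) by simp
  qed
  define w where "w = z * star z"
  have w: "star w = w" "T w = 0" "p * w = w"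
    using pz by (simp_all add: w_def star_mult z_def T_mult Tp flip: mult.assoc)
  have wp: "w * p = w" using arg_cong[OF w(3), of star] by (simp add: star_mult w(1) pp(1))
  show thesis
  proof (cases "w = 0")
    case True
    then have "star (star z) * star z = 0" by (simp add: w_def)
    then have "(norm (star z))\<^sup>2 = 0" using norm_star_mult[of "star z"] by simp
    then have "z = 0" by simp
    then show thesis using p0 pp by (intro finish[of p]) auto
  next
    case False
    define t where "t = norm w"
    have t: "t > 0" using False by (simp add: t_def)
    \<comment> \<open>\<open>spectral_projection\<close> handles nonzero spectral values only;
      subtracting \<open>w\<close> from \<open>t\<close> times the unit of the corner turns the
      kernel of \<open>w\<close> into the eigenspace of \<open>b\<close> at
      \<open>t > 0\<close>.\<close>
    define b where "b = t *\<^sub>R p - w"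
    have b: "star b = b" "T b = 0"
      by (simp add: b_def star_diff star_scaleR pp(1) w)
        (simp add: b_def T_diff scaleR_eq_scaleC T_scaleC Tp w)
    have pb: "p * b = b" "b * p = b" by (simp_all add: b_def algebra_simps pp w wp)
    show thesis
    proof (cases "t \<in> rspec b")
      case True
      then obtain P k where P: "projection P" "P \<noteq> 0" "P = b * k" "P = k * b" "b * P = t *\<^sub>R P"
        using spectral_projection[OF b, of t] t by auto
      have pP: "p * P = P" unfolding P(3) by (simp add: pb flip: mult.assoc)
      have Pp: "P * p = P" unfolding P(4) by (simp add: pb mult.assoc)
      have "w * P = t *\<^sub>R (p * P) - b * P" by (simp add: b_def algebra_simps)
      then have wP: "w * P = 0" by (simp add: pP P(5))
      have "star (star z * P) * (star z * P) = star P * (w * P)"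
        by (simp add: star_mult w_def mult.assoc)
      then have "(norm (star z * P))\<^sup>2 = 0" by (simp add: wP flip: norm_star_mult)
      then have "star z * P = 0" by simp
      then have "star (star z * P) = 0" by simp
      then have "P * z = 0" using P(1) by (simp add: star_mult projection_def)
      then show thesis by (rule finish[OF P(2) Pp])
    next
      case False
      then have i: "invertible_element (b - of_real t *\<^sub>C 1)" by (simp add: rspec_def not_spectrum_iff)
      let ?v = "ainv (b - of_real t *\<^sub>C 1)"
      have "w = - (p * (b - of_real t *\<^sub>C 1))"
        by (simp add: right_diff_distrib pb) (simp add: b_def scaleR_eq_scaleC)
      then have "w * ?v = - (p * (b - of_real t *\<^sub>C 1) * ?v)" by simp
      also have "\<dots> = - p" using i by (simp add: mult.assoc)
      finally have "z * (star z * (- ?v)) = p" by (simp add: w_def mult.assoc)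
      then have "p = ?m * e * p * (star z * (- ?v))" by (simp only: flip: zN)
      then have "p = 0" by (rule quasinilpotent_left_fixpoint[OF e(5)])
      with p0 show thesis by simp
    qed
  qed
qed

section \<open>The eigenvalue sequence and the normal part\<close>

lemma riesz_sequence:
  assumes a: "spectrum (T a) \<subseteq> {0}"
  obtains l :: "nat \<Rightarrow> complex" and e where "l \<longlonglongrightarrow> 0"
    and "\<And>n. e n * e n = e n" "\<And>n. T (e n) = 0" "\<And>n. a * e n = e n * a"
    and "\<And>n. spectrum ((a - l n *\<^sub>C 1) * e n) \<subseteq> {0}" "\<And>i j. i \<noteq> j \<Longrightarrow> e i * e j = 0"
    and "\<And>z. z \<in> spectrum a \<Longrightarrow> z \<noteq> 0 \<Longrightarrow> \<exists>n y. (a - z *\<^sub>C 1) * y = 1 - e n"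
proof -
  define S where "S = spectrum a - {0}"
  have "S \<subseteq> (\<Union>k. {z \<in> spectrum a. 1 / real (Suc k) < cmod z})"
  proof
    fix z assume z: "z \<in> S"
    then have "cmod z > 0" by (simp add: S_def)
    then obtain k where "1 / real (Suc k) < cmod z" using nat_approx_posE by blast
    with z show "z \<in> (\<Union>k. {z \<in> spectrum a. 1 / real (Suc k) < cmod z})" by (auto simp: S_def)
  qed
  moreover have "countable (\<Union>k. {z \<in> spectrum a. 1 / real (Suc k) < cmod z})"
    by (intro countable_UN countable_spectrum_away_from_0 a) simp_all
  ultimately have "countable S" by (rule countable_subset)
  then obtain f :: "complex \<Rightarrow> nat" where f: "inj_on f S" by (auto simp: countable_def)
  define P where "P z e \<longleftrightarrow> e * e = e \<and> T e = 0 \<and> a * e = e * a \<and> (\<forall>x. x * a = a * x \<longrightarrow> x * e = e * x) \<and>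
      spectrum ((a - z *\<^sub>C 1) * e) \<subseteq> {0} \<and> (\<exists>y. (a - z *\<^sub>C 1) * y = 1 - e)" for z e
  have "\<exists>e. P z e" if "z \<in> S" for z
  proof -
    have z0: "z \<noteq> 0" using that by (simp add: S_def)
    obtain e y where "e * e = e" "T e = 0" "a * e = e * a" "\<forall>x. x * a = a * x \<longrightarrow> x * e = e * x"
      "spectrum ((a - z *\<^sub>C 1) * e) \<subseteq> {0}" "(a - z *\<^sub>C 1) * y = 1 - e" "y * (a - z *\<^sub>C 1) = 1 - e"
      by (rule riesz_point_idempotent[OF a z0])
    then have "P z e" unfolding P_def by blast
    then show ?thesis ..
  qed
  then obtain E where PE: "\<And>z. z \<in> S \<Longrightarrow> P z (E z)" by metis
  have E: "E z * E z = E z" "T (E z) = 0" "a * E z = E z * a" "\<And>x. x * a = a * x \<Longrightarrow> x * E z = E z * x"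
    "spectrum ((a - z *\<^sub>C 1) * E z) \<subseteq> {0}" "\<exists>y. (a - z *\<^sub>C 1) * y = 1 - E z" if "z \<in> S" for z
    using PE[OF that] by (simp_all add: P_def)
  define l where "l n = (if n \<in> f ` S then inv_into S f n else 0)" for n
  define e where "e n = (if n \<in> f ` S then E (inv_into S f n) else 0)" for n
  have lS: "l n \<in> S" "f (l n) = n" "e n = E (l n)" if "n \<in> f ` S" for n
    using that by (simp_all add: l_def e_def inv_into_into f_inv_into_f)
  have out: "l n = 0" "e n = 0" if "n \<notin> f ` S" for n using that by (simp_all add: l_def e_def)
  have orth: "e i * e j = 0" if ij: "i \<noteq> j" for i j
  proof (cases "i \<in> f ` S \<and> j \<in> f ` S")
    case True
    then have i: "i \<in> f ` S" and j: "j \<in> f ` S" by auto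
    note Ei = E[OF lS(1)[OF i], folded lS(3)[OF i]] and Ej = E[OF lS(1)[OF j], folded lS(3)[OF j]]
    have ne: "l i \<noteq> l j" using lS(2)[OF i] lS(2)[OF j] ij by auto
    \<comment> \<open>On the range of \<open>e j\<close> the element \<open>a - l i\<close> acts as
      the invertible \<open>?M\<close>, on that of \<open>e i\<close> as the quasinilpotent
      \<open>?N\<close>. Hence \<open>e i * e j\<close> reproduces itself as
      \<open>?N * (e i * e j) * ainv ?M\<close>.\<close>
    let ?N = "(a - l i *\<^sub>C 1) * e i"
    let ?M = "(a - l j *\<^sub>C 1) * e j - (l i - l j) *\<^sub>C 1"
    have "l i - l j \<notin> spectrum ((a - l j *\<^sub>C 1) * e j)" using Ej(5) ne by auto
    then have iM: "invertible_element ?M" by (simp only: not_spectrum_iff)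
    note ejej = Ej(1) and eiei = Ei(1)
    have "?M * e j = (a - l j *\<^sub>C 1) * e j - (l i - l j) *\<^sub>C e j"
      by (simp add: left_diff_distrib mult.assoc ejej)
    also have "\<dots> = (a - l i *\<^sub>C 1) * e j" by (simp add: left_diff_distrib scaleC_algebra)
    finally have Me: "(a - l i *\<^sub>C 1) * e j = ?M * e j" by simp
    have "e j * (a - l j *\<^sub>C 1) = (a - l j *\<^sub>C 1) * e j" using Ej(3) by (intro commute_diff_scalar) simp
    then have "e j * ?M = ?M * e j"
      by (intro commute_diff_scalar) (simp only: flip: mult.assoc)
    then have eM: "e j * ainv ?M = ainv ?M * e j" by (rule ainv_commute[OF iM])
    have eia: "e i * (a - l i *\<^sub>C 1) = (a - l i *\<^sub>C 1) * e i" using Ei(3) by (intro commute_diff_scalar) simp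
    have "?N * (e i * e j) * ainv ?M = (a - l i *\<^sub>C 1) * (e i * e i) * (e j * ainv ?M)"
      by (simp only: mult.assoc)
    also have "\<dots> = e i * (a - l i *\<^sub>C 1) * (e j * ainv ?M)" by (simp only: eiei eia)
    also have "\<dots> = e i * ((a - l i *\<^sub>C 1) * e j) * ainv ?M" by (simp only: mult.assoc)
    also have "\<dots> = e i * (?M * (ainv ?M * e j))" unfolding Me by (simp only: mult.assoc eM)
    also have "\<dots> = e i * e j" using iM by (simp add: ainv_cancel)
    finally have "e i * e j = ?N * (e i * e j) * ainv ?M" by simp
    then show ?thesis by (rule quasinilpotent_left_fixpoint[rotated]) (rule Ei(5))
  qed (auto simp: out)
  show ?thesis
  proof (rule that[of l e])
    show "l \<longlonglongrightarrow> 0"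
    proof (rule tendstoI)
      fix r :: real assume r: "r > 0"
      have "finite {n. r \<le> cmod (l n)}"
      proof (rule finite_subset)
        show "{n. r \<le> cmod (l n)} \<subseteq> f ` {z \<in> spectrum a. r \<le> cmod z}"
        proof
          fix n assume n: "n \<in> {n. r \<le> cmod (l n)}"
          have "n \<in> f ` S"
          proof (rule ccontr)
            assume "n \<notin> f ` S"
            then show False using out(1) n r by simp
          qed
          from lS[OF this] n show "n \<in> f ` {z \<in> spectrum a. r \<le> cmod z}"
            by (intro image_eqI[of _ _ "l n"]) (auto simp: S_def)
        qed
      qed (intro finite_imageI finite_spectrum_riesz a r)
      then have "\<forall>\<^sub>F n in cofinite. cmod (l n) < r" by (simp add: eventually_cofinite not_less)
      then show "\<forall>\<^sub>F n in sequentially. dist (l n) 0 < r" by (simp add: cofinite_eq_sequentially)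
    qed
    fix n
    show "e n * e n = e n" "T (e n) = 0" "a * e n = e n * a" "spectrum ((a - l n *\<^sub>C 1) * e n) \<subseteq> {0}"
      using E(1-3,5)[of "l n"] lS[of n] out[of n] by (cases "n \<in> f ` S"; simp)+
  next
    fix z assume "z \<in> spectrum a" "z \<noteq> 0"
    then have z: "z \<in> S" by (simp add: S_def)
    then have "e (f z) = E z" using f by (simp add: e_def)
    with E(6)[OF z] show "\<exists>n y. (a - z *\<^sub>C 1) * y = 1 - e n" by metis
  qed (rule orth)
qed

lemma west_decomposition:
  assumes a: "spectrum (T a) \<subseteq> {0}"
  obtains d where "normal_element d" "T d = 0" "spectrum (a - d) = {0}"
proof -
  obtain l :: "nat \<Rightarrow> complex" and e where l: "l \<longlonglongrightarrow> 0"
    and e: "\<And>n. e n * e n = e n" "\<And>n. T (e n) = 0" "\<And>n. a * e n = e n * a"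
      "\<And>n. spectrum ((a - l n *\<^sub>C 1) * e n) \<subseteq> {0}" "\<And>i j. i \<noteq> j \<Longrightarrow> e i * e j = 0"
    and ex: "\<And>z. z \<in> spectrum a \<Longrightarrow> z \<noteq> 0 \<Longrightarrow> \<exists>n y. (a - z *\<^sub>C 1) * y = 1 - e n"
    using riesz_sequence[OF a] by blast
  define E where "E n = (\<Sum>i<n. e i)" for n
  have ESuc: "E (Suc n) = E n + e n" for n by (simp add: E_def)
  have Ee: "E n * e j = (if j < n then e j else 0)" for n j
  proof -
    have "E n * e j = (\<Sum>i<n. if i = j then e j else 0)"
      unfolding E_def sum_distrib_right by (intro sum.cong refl) (auto simp: e)
    then show ?thesis by simp
  qed
  have EE: "E n * E m = E m" if "m \<le> n" for m n
    unfolding E_def[of m] sum_distrib_left using that by (intro sum.cong refl) (simp add: Ee)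
  have "\<exists>p. projection p \<and> E n * p = p \<and> p * E n = E n \<and> T p = 0" for n
  proof -
    obtain p x where p: "projection p" "E n * p = p" "p * E n = E n" "p = E n * x"
      using idempotent_range_projection[OF EE[OF order_refl]] by blast
    have "T (E n) = 0" unfolding E_def linear_sum[OF bounded_linear.linear[OF bounded_linear_T]] by (simp add: e)
    then have "T p = 0" by (subst p(4)) (simp add: T_mult)
    with p show ?thesis by blast
  qed
  then obtain p where p: "\<And>n. projection (p n)" "\<And>n. E n * p n = p n" "\<And>n. p n * E n = E n" "\<And>n. T (p n) = 0"
    by metis
  have pe: "p (Suc n) * e n = e n" for n
  proof -
    have "p (Suc n) * (E (Suc n) * e n) = E (Suc n) * e n" by (simp only: p(3) flip: mult.assoc)
    then show ?thesis by (simp add: Ee)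
  qed
  have p0: "p 0 = 0" using p(2)[of 0] by (simp add: E_def)
  have pp: "p n * p m = p m" if "m \<le> n" for m n
  proof -
    have Ep: "E n * p m = p m" using arg_cong[OF EE[OF that], of "\<lambda>u. u * p m"] by (simp add: mult.assoc p(2))
    have "p n * p m = p n * (E n * p m)" by (simp only: Ep)
    also have "\<dots> = E n * p m" by (simp only: p(3) flip: mult.assoc)
    also have "\<dots> = p m" by (rule Ep)
    finally show ?thesis .
  qed
  have pp': "p m * p n = p m" if "m \<le> n" for m n
    by (rule projection_diff(2)[OF p(1) p(1) pp[OF that]])
  define q where "q n = p (Suc n) - p n" for n
  have q: "projection (q n)" for n unfolding q_def by (intro projection_diff(1) p pp) simp
  have qp: "q i * p n = (if i < n then q i else 0)" for i n
    using pp[of n i] pp[of n "Suc i"] pp'[of i n] pp'[of "Suc i" n] by (auto simp: q_def left_diff_distrib not_less)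
  have qq: "q i * q j = (if i = j then q i else 0)" for i j
    unfolding q_def[of j] right_diff_distrib qp by auto
  let ?f = "\<lambda>n. l n *\<^sub>C q n"
  \<comment> \<open>Orthogonality bounds a tail by its largest coefficient, so convergence of
    \<open>l\<close> to 0 suffices, without absolute summability.\<close>
  have sm: "summable ?f"
    unfolding summable_Cauchy
  proof (intro allI impI)
    fix r :: real assume r: "r > 0"
    have "\<forall>\<^sub>F n in sequentially. dist (l n) 0 < r/2" using l by (rule tendstoD) (use r in simp)
    then obtain N where N: "\<And>n. n \<ge> N \<Longrightarrow> cmod (l n) < r/2" unfolding eventually_sequentially by auto
    have "norm (sum ?f {m..<n}) < r" if "m \<ge> N" for m n
    proof -
      have "norm (sum ?f {m..<n}) \<le> r/2"
        using r that N by (intro norm_orthogonal_projections_le qq q) (auto intro!: less_imp_le)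
      then show ?thesis using r by simp
    qed
    then show "\<exists>N. \<forall>m\<ge>N. \<forall>n. norm (sum ?f {m..<n}) < r" by blast
  qed
  define d where "d = suminf ?f"
  have dlim: "(\<lambda>n. sum ?f {..<n}) \<longlonglongrightarrow> d" unfolding d_def by (rule summable_LIMSEQ[OF sm])
  have normal: "normal_element d"
    unfolding normal_element_def
  proof (rule LIMSEQ_unique)
    show "(\<lambda>n. sum ?f {..<n} * star (sum ?f {..<n})) \<longlonglongrightarrow> d * star d" by (intro tendsto_intros dlim)
    have s: "star (sum ?f {..<n}) = (\<Sum>i<n. cnj (l i) *\<^sub>C q i)" for n
      using q by (simp add: star_sum star_scaleC projection_def)
    have "sum ?f {..<n} * star (sum ?f {..<n}) = star (sum ?f {..<n}) * sum ?f {..<n}" for n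
      unfolding s orthogonal_projections_mult[OF finite_lessThan qq] by (simp add: mult.commute)
    then show "(\<lambda>n. sum ?f {..<n} * star (sum ?f {..<n})) \<longlonglongrightarrow> star d * d"
      by (simp only:) (intro tendsto_intros dlim)
  qed
  have "T d = (\<Sum>n. T (?f n))" unfolding d_def by (rule bounded_linear.suminf[OF bounded_linear_T sm])
  then have Td: "T d = 0" by (simp add: T_scaleC q_def T_diff p)
  have "z \<notin> spectrum (a - d)" if z0: "z \<noteq> 0" for z
  proof
    assume z: "z \<in> spectrum (a - d)"
    have "spectrum (T (a - d)) \<subseteq> {0}" using a by (simp add: T_diff Td)
    from left_eigenvector[OF this z z0] obtain g where g: "g \<noteq> 0" "g * (a - d - z *\<^sub>C 1) = 0" by blast
    then have ga: "g * a = z *\<^sub>C g + g * d" by (simp add: algebra_simps)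
    have gd: "g * d = (\<Sum>n. g * ?f n)" unfolding d_def by (rule suminf_mult[OF sm, symmetric])
    have smg: "summable (\<lambda>n. g * ?f n)" by (rule summable_mult[OF sm])
    \<comment> \<open>If \<open>g * p n = 0\<close>, then \<open>g\<close> kills \<open>q i\<close>
      for \<open>i < n\<close>, while \<open>p (Suc n)\<close> kills \<open>q i\<close> for
      \<open>i > n\<close>; so \<open>g * d * p (Suc n)\<close> is \<open>l n\<close> times
      \<open>g * p (Suc n)\<close>. On \<open>e n\<close> this cancels the eigenvalue of
      \<open>a\<close>, and \<open>g * e n\<close> becomes a left eigenvector of the quasinilpotent
      \<open>(a - l n *\<^sub>C 1) * e n\<close> at \<open>z \<noteq> 0\<close>, hence zero.\<close>
    have gp: "g * p n = 0" for n
    proof (induction n)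
      case (Suc n)
      have gq: "g * q i = 0" if "i < n" for i
      proof -
        have "g * q i = g * (p n * q i)" using that pp[of i n] pp[of "Suc i" n] by (simp add: q_def right_diff_distrib)
        also have "\<dots> = 0" using Suc by (simp flip: mult.assoc)
        finally show ?thesis .
      qed
      have "g * d * p (Suc n) = (\<Sum>i. g * ?f i * p (Suc n))"
        unfolding gd by (rule suminf_mult2[OF smg])
      also have "\<dots> = (\<Sum>i. if i = n then l n *\<^sub>C (g * q n) else 0)"
        by (intro arg_cong[of _ _ suminf] ext) (auto simp: mult.assoc qp less_Suc_eq gq)
      also have "\<dots> = l n *\<^sub>C (g * q n)"
        using sums_unique[OF sums_single[of n "\<lambda>_. l n *\<^sub>C (g * q n)"]] by simp
      also have "g * q n = g * p (Suc n)" by (simp add: q_def right_diff_distrib Suc)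
      finally have gdp: "g * d * p (Suc n) = l n *\<^sub>C (g * p (Suc n))" .
      have gde: "g * d * e n = l n *\<^sub>C (g * e n)"
        using arg_cong[OF gdp, of "\<lambda>u. u * e n"] by (simp add: mult.assoc pe)
      have "g * e n * ((a - l n *\<^sub>C 1) * e n) = g * e n * (e n * (a - l n *\<^sub>C 1))"
        by (intro arg_cong[of _ _ "\<lambda>u. g * e n * u"] commute_diff_scalar[symmetric]) (simp add: e)
      also have "\<dots> = g * (e n * a) - l n *\<^sub>C (g * e n)"
        using e(1)[of n] by (simp add: right_diff_distrib flip: mult.assoc) (simp add: mult.assoc e(1))
      also have "g * (e n * a) = g * a * e n" by (simp add: mult.assoc e(3))
      also have "\<dots> = z *\<^sub>C (g * e n) + l n *\<^sub>C (g * e n)" unfolding ga by (simp add: distrib_right gde)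
      finally have "g * e n * ((a - l n *\<^sub>C 1) * e n) = z *\<^sub>C (g * e n)" by simp
      from quasinilpotent_right_eigenvalue[OF e(4) this z0] have ge: "g * e n = 0" .
      have "g * E n = g * p n * E n" by (simp add: mult.assoc p(3))
      then have "g * E (Suc n) = 0" using Suc ge by (simp add: ESuc distrib_left)
      then have "g * (E (Suc n) * p (Suc n)) = 0" by (simp flip: mult.assoc)
      then show ?case by (simp add: p(2))
    qed (simp add: p0)
    have "g * d = 0" unfolding gd by (simp add: q_def right_diff_distrib gp)
    then have gz: "g * (a - z *\<^sub>C 1) = 0" using ga by (simp add: right_diff_distrib)
    show False
    proof (cases "z \<in> spectrum a")
      case True
      from ex[OF this z0] obtain n y where y: "(a - z *\<^sub>C 1) * y = 1 - e n" by blast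
      have "g * e n = g * p (Suc n) * e n" by (simp only: pe mult.assoc)
      then have "g * e n = 0" by (simp add: gp)
      moreover have "g * (1 - e n) = 0" unfolding y[symmetric] by (simp add: gz flip: mult.assoc)
      ultimately show False using g(1) by (simp add: right_diff_distrib)
    next
      case False
      then have i: "invertible_element (a - z *\<^sub>C 1)" by (simp only: not_spectrum_iff)
      have "g * (a - z *\<^sub>C 1) * ainv (a - z *\<^sub>C 1) = 0" by (simp add: gz)
      then show False using i g(1) by (simp add: mult.assoc)
    qed
  qed
  then have "spectrum (a - d) \<subseteq> {0}" by (auto intro: ccontr)
  then have "spectrum (a - d) = {0}" using spectrum_nonempty[of "a - d"] by (simp only: subset_singleton_iff simp_thms)
  with normal Td show ?thesis by (rule that)
qed

end

theorem theorem2p1: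
  fixes T :: "'a::cstar_algebra_1 \<Rightarrow> 'b::cstar_algebra_1"
  assumes "bounded_algebra_hom T"
    and "Riesz_property T"
  shows "(\<forall>a. T a \<in> QN \<longrightarrow>
            (\<exists>c d. a = c + d \<and> normal_element d \<and> d \<in> null_space T \<and> c \<in> QN)) \<and>
         {a. T a \<in> QN} = {d + c | d c. d \<in> null_space T \<and> c \<in> QN}"
proof -
  interpret riesz_hom T by unfold_locales (rule assms)+
  have dec: "\<exists>c d. a = c + d \<and> normal_element d \<and> d \<in> null_space T \<and> c \<in> QN" if "T a \<in> QN" for a
  proof -
    have "spectrum (T a) \<subseteq> {0}" using that by (simp add: QN_def)
    then obtain d where "normal_element d" "T d = 0" "spectrum (a - d) = {0}"
      by (rule west_decomposition)
    then show ?thesis by (intro exI[of _ "a - d"] exI[of _ d]) (simp add: QN_def null_space_def)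
  qed
  \<comment> \<open>Here \<open>T (d + c) = T c\<close>, whose spectrum is contained in that of
    \<open>c\<close> and, being nonempty, is exactly \<open>{0}\<close>.\<close>
  have "T (d + c) \<in> QN" if "d \<in> null_space T" "c \<in> QN" for c d
    using that spectrum_T[of c] spectrum_nonempty[of "T c"] by (auto simp: T_add QN_def null_space_def)
  moreover have "\<exists>d c. a = d + c \<and> d \<in> null_space T \<and> c \<in> QN" if "T a \<in> QN" for a
    using dec[OF that] by (metis add.commute)
  ultimately have "{a. T a \<in> QN} = {d + c | d c. d \<in> null_space T \<and> c \<in> QN}" by blast
  with dec show ?thesis by blast
qed

end
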